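(* There exists a normal uniform algebra $B$, on a compact metrizable space $X$, such that every point of $X$ is a peak point for $B$ but there is an uncountable subset $L$ of $X$ such that for every $x\in L$ there is a one-parameter family $\{H_\rho^x: 0\le\rho<\infty\}$ of distinct closed primary ideals of $B$ contained in the maximal ideal $M_x$ satisfying $H_{\rho_1}^x\supsetneq H_{\rho_2}^x$ for all $0\le\rho_1<\rho_2$. Furthermore, $B$ can be taken to have (in addition) bounded relative units at every point of $X\setminus L$.
   Context: All spaces are Hausdorff. For $X$ compact, $C(X)$ is the algebra of continuous complex-valued functions on $X$ with the supremum norm $\|\cdot\|_X$. A uniform algebra on $X$ is a closed subalgebra of $C(X)$ that contains the constants and separates the points of $X$. A uniform algebra $A$ on $X$ is natural if its maximal ideal space is $X$ (identifying points with evaluation functionals); it is normal if it is natural and for each pair of disjoint closed sets $K_0,K_1\subset X$ there is $f\in A$ with $f=1$ on $K_1$ and $f=0$ on $K_0$. For $x\in X$, $M_x=\{f\in A: f(x)=0\}$ and $J_x=\{f\in A: f^{-1}(0)\text{ contains a neighborhood of }x\text{ in }X\}$. The point $x$ is a peak point for $A$ if there is $f\in A$ with $f(x)=1$ and $|f(y)|<1$ for every $y\in X\setminus\{x\}$. An ideal of $A$ is called primary if it is contained in a unique maximal ideal of $A$. $A$ has bounded relative units at $x$ if there is a constant $C\ge1$ such that for each compact subset $E$ of $X\setminus\{x\}$ there exists $f\in J_x$ with $f|E=1$ and $\|f\|_X\le C$. *)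

theory Defs
  imports "HOL-Analysis.Analysis" "HOL-Algebra.Subrings"
begin

text \<open>
  Functions on a space \<open>X\<close> are represented extensionally, that is, with the value
  \<open>undefined\<close> off \<open>topspace X\<close>, so that equality of functions on \<open>X\<close> is equality in HOL.
  All notions are meant for compact Hausdorff \<open>X\<close>; there every continuous function is bounded
  and the metric space of bounded continuous functions is all of \<open>C(X)\<close> with the
  metric of the supremum norm.
\<close>

abbreviation C_metric :: "'a topology \<Rightarrow> ('a \<Rightarrow> complex) metric"
  where "C_metric X \<equiv> cfunspace X euclidean_metric"

abbreviation C_space :: "'a topology \<Rightarrow> ('a \<Rightarrow> complex) set"
  where "C_space X \<equiv> mspace (C_metric X)"

lemma C_space_compact:
  assumes "compact_space X"
  shows "C_space X = {f \<in> extensional (topspace X). continuous_map X euclidean f}"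
  using compactin_mspace_cfunspace[of X euclidean_metric] assms
  by (auto simp: compact_space_def)

text \<open>Meaningful for nonempty \<open>X\<close> only; it is used at a point of \<open>X\<close>.\<close>

definition sup_norm :: "'a topology \<Rightarrow> ('a \<Rightarrow> complex) \<Rightarrow> real"
  where "sup_norm X f = (SUP x\<in>topspace X. cmod (f x))"

definition function_ring :: "'a topology \<Rightarrow> ('a \<Rightarrow> complex) set \<Rightarrow> ('a \<Rightarrow> complex) ring"
  where "function_ring X A =
    \<lparr>carrier = A,
     mult = (\<lambda>f g. \<lambda>x\<in>topspace X. f x * g x),
     one = (\<lambda>x\<in>topspace X. 1),
     zero = (\<lambda>x\<in>topspace X. 0),
     add = (\<lambda>f g. \<lambda>x\<in>topspace X. f x + g x)\<rparr>"

text \<open>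
  A subring of \<open>C(X)\<close> that contains the constants is closed under scalar multiplication,
  hence a subalgebra.
\<close>

definition uniform_algebra :: "'a topology \<Rightarrow> ('a \<Rightarrow> complex) set \<Rightarrow> bool"
  where "uniform_algebra X A \<longleftrightarrow>
    compact_space X \<and> Hausdorff_space X \<and>
    subring A (function_ring X (C_space X)) \<and>
    (\<forall>c. (\<lambda>x\<in>topspace X. c) \<in> A) \<and>
    closedin (mtopology_of (C_metric X)) A \<and>
    (\<forall>x\<in>topspace X. \<forall>y\<in>topspace X. x \<noteq> y \<longrightarrow> (\<exists>f\<in>A. f x \<noteq> f y))"

definition characters :: "'a topology \<Rightarrow> ('a \<Rightarrow> complex) set \<Rightarrow> (('a \<Rightarrow> complex) \<Rightarrow> complex) set"
  where "characters X A = {\<phi> \<in> extensional A.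
    (\<forall>f\<in>A. \<forall>g\<in>A. \<phi> (\<lambda>x\<in>topspace X. f x + g x) = \<phi> f + \<phi> g) \<and>
    (\<forall>c. \<forall>f\<in>A. \<phi> (\<lambda>x\<in>topspace X. c * f x) = c * \<phi> f) \<and>
    (\<forall>f\<in>A. \<forall>g\<in>A. \<phi> (\<lambda>x\<in>topspace X. f x * g x) = \<phi> f * \<phi> g) \<and>
    (\<exists>f\<in>A. \<phi> f \<noteq> 0)}"

text \<open>
  The maximal ideal space: the nonzero multiplicative linear functionals with the Gelfand
  topology, the topology of pointwise convergence on \<open>A\<close>.
\<close>

definition maximal_ideal_space ::
  "'a topology \<Rightarrow> ('a \<Rightarrow> complex) set \<Rightarrow> (('a \<Rightarrow> complex) \<Rightarrow> complex) topology"
  where "maximal_ideal_space X A =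
    subtopology (product_topology (\<lambda>f. euclidean) A) (characters X A)"

definition natural_uniform_algebra :: "'a topology \<Rightarrow> ('a \<Rightarrow> complex) set \<Rightarrow> bool"
  where "natural_uniform_algebra X A \<longleftrightarrow>
    uniform_algebra X A \<and>
    homeomorphic_map X (maximal_ideal_space X A) (\<lambda>x. \<lambda>f\<in>A. f x)"

definition normal_uniform_algebra :: "'a topology \<Rightarrow> ('a \<Rightarrow> complex) set \<Rightarrow> bool"
  where "normal_uniform_algebra X A \<longleftrightarrow>
    natural_uniform_algebra X A \<and>
    (\<forall>K0 K1. closedin X K0 \<and> closedin X K1 \<and> disjnt K0 K1 \<longrightarrow>
       (\<exists>f\<in>A. (\<forall>x\<in>K1. f x = 1) \<and> (\<forall>x\<in>K0. f x = 0)))"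

definition M_ideal :: "('a \<Rightarrow> complex) set \<Rightarrow> 'a \<Rightarrow> ('a \<Rightarrow> complex) set"
  where "M_ideal A x = {f \<in> A. f x = 0}"

definition J_ideal :: "'a topology \<Rightarrow> ('a \<Rightarrow> complex) set \<Rightarrow> 'a \<Rightarrow> ('a \<Rightarrow> complex) set"
  where "J_ideal X A x = {f \<in> A. \<exists>U. openin X U \<and> x \<in> U \<and> (\<forall>y\<in>U. f y = 0)}"

definition peak_point :: "'a topology \<Rightarrow> ('a \<Rightarrow> complex) set \<Rightarrow> 'a \<Rightarrow> bool"
  where "peak_point X A x \<longleftrightarrow>
    x \<in> topspace X \<and> (\<exists>f\<in>A. f x = 1 \<and> (\<forall>y \<in> topspace X - {x}. cmod (f y) < 1))"

definition closed_ideal :: "'a topology \<Rightarrow> ('a \<Rightarrow> complex) set \<Rightarrow> ('a \<Rightarrow> complex) set \<Rightarrow> bool"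
  where "closed_ideal X A I \<longleftrightarrow>
    ideal I (function_ring X A) \<and> closedin (subtopology (mtopology_of (C_metric X)) A) I"

definition primary_ideal :: "'a topology \<Rightarrow> ('a \<Rightarrow> complex) set \<Rightarrow> ('a \<Rightarrow> complex) set \<Rightarrow> bool"
  where "primary_ideal X A I \<longleftrightarrow>
    ideal I (function_ring X A) \<and> (\<exists>!M. maximalideal M (function_ring X A) \<and> I \<subseteq> M)"

definition bounded_relative_units :: "'a topology \<Rightarrow> ('a \<Rightarrow> complex) set \<Rightarrow> 'a \<Rightarrow> bool"
  where "bounded_relative_units X A x \<longleftrightarrow>
    (\<exists>C\<ge>1. \<forall>E. compactin X E \<and> E \<subseteq> topspace X - {x} \<longrightarrow>
       (\<exists>f \<in> J_ideal X A x. (\<forall>y\<in>E. f y = 1) \<and> sup_norm X f \<le> C))"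

end

theory Submission
  imports Defs "HOL-Complex_Analysis.Complex_Analysis"
begin

text \<open>
  A Swiss cheese \<open>K\<close> is cut out of a rectangle with \<open>0\<close> in the middle of its left edge, with so many
  holes that the uniform closure \<open>H(K)\<close> of the functions holomorphic near \<open>K\<close> contains cut-off
  functions at every point, but with the holes near \<open>0\<close> so small compared with
  \<open>\<bar>exp (1 / w)\<bar>\<close> that Green's formula prevents \<open>w exp (1 / w)\<close> from being approximated.
  If a function \<open>g\<close> of \<open>H(K)\<close> vanishing near \<open>0\<close> were close to \<open>w\<close>, then \<open>g exp (1 / w)\<close>, which lies
  in \<open>H(K)\<close>, would be such an approximation; so \<open>J\<^sub>0\<close> is not dense in \<open>M\<^sub>0\<close>.

  In the product of countably many copies of \<open>K\<close> and of \<open>{0,1}\<close>, let \<open>L\<close> be the set of points whose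
  \<open>K\<close>-coordinates all vanish; it is uncountable thanks to the factors \<open>{0,1}\<close>. Cut-off functions
  that vanish on \<open>L\<close> need not be bounded uniformly, but their roots of high order are bounded by \<open>3/2\<close>.
  Adjoining these roots gives bounded relative units off \<open>L\<close> and changes nothing over \<open>L\<close>, since
  averaging over the roots of unity leads back to functions on the product. Bounded relative
  units yield peak functions off \<open>L\<close>; on \<open>L\<close> the functions \<open>1 / (1 + w)\<close> in the coordinates do.

  For \<open>x\<close> in \<open>L\<close> the copies of \<open>K\<close> through \<open>x\<close> are indexed by numbers \<open>q m\<close> dense in the real line.
  The closure of the ideal of functions that vanish at \<open>x\<close>, and near \<open>x\<close> on the slices with \<open>q m < t\<close>,
  is primary, and it decreases strictly as \<open>t\<close> increases.
\<close>

section \<open>Uniform closures of algebras of functions\<close>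

text \<open>Bounded relative units at \<open>x\<close> would make \<open>J_x\<close> dense in
  \<open>M_x\<close>: multiply a function of \<open>M_x\<close> by units that are 1 off small
  neighbourhoods of \<open>x\<close>. So on \<open>L\<close> the cut-offs demanded by normality
  cannot be uniformly bounded, and the planar set has to supply cut-offs at 0 without such a bound.
  Its holes do: the bound of a cut-off is of the order of 1 / b for holes of total radius b, and b
  is exponentially small near 0. The test function w exp(1/w) has residue 1/2 at 0, but exp(1/w) is
  bounded by 1 for Re w < 0. Of the boundary integral over a square around 0 the left half therefore
  contributes nothing and the right half everything; this is the nonzero quantity that no
  approximation can reproduce. Adjoining roots is usually iterated, because new points call for new
  cut-offs. One step is enough here: over a small box of the base the sheets of a root are separated
  by idempotents, and multiplication by an idempotent does not increase the modulus. Countably many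
  roots suffice, which keeps the space metrizable, because the planar cut-offs come from rational
  parameters.\<close>

definition uclosure :: "'a set \<Rightarrow> ('a \<Rightarrow> complex) set \<Rightarrow> ('a \<Rightarrow> complex) set"
  where "uclosure S A = {f. \<forall>e>0. \<exists>g\<in>A. \<forall>x\<in>S. cmod (f x - g x) < e}"

text \<open>Members are total functions of which only the values on \<open>S\<close> matter, so
  pointwise operations need no restriction; the extensional functions of the statement are recovered
  later by \<open>restrict\<close>.\<close>

definition function_algebra :: "'a set \<Rightarrow> ('a \<Rightarrow> complex) set \<Rightarrow> bool"
  where "function_algebra S A \<longleftrightarrow>
    (\<forall>c. (\<lambda>x. c) \<in> A) \<and>
    (\<forall>f\<in>A. \<forall>g\<in>A. (\<lambda>x. f x + g x) \<in> A) \<and>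
    (\<forall>f\<in>A. \<forall>g\<in>A. (\<lambda>x. f x * g x) \<in> A) \<and>
    (\<forall>f\<in>A. \<exists>C. \<forall>x\<in>S. cmod (f x) \<le> C)"

lemma function_algebraD:
  assumes "function_algebra S A"
  shows "(\<lambda>x. c) \<in> A"
    and "f \<in> A \<Longrightarrow> g \<in> A \<Longrightarrow> (\<lambda>x. f x + g x) \<in> A"
    and "f \<in> A \<Longrightarrow> g \<in> A \<Longrightarrow> (\<lambda>x. f x * g x) \<in> A"
    and "f \<in> A \<Longrightarrow> \<exists>C>0. \<forall>x\<in>S. cmod (f x) \<le> C"
proof -
  show "\<exists>C>0. \<forall>x\<in>S. cmod (f x) \<le> C" if f: "f \<in> A"
  proof -
    obtain C where "\<forall>x\<in>S. cmod (f x) \<le> C"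
      using assms f unfolding function_algebra_def by blast
    then have "\<forall>x\<in>S. cmod (f x) \<le> max C 1" by fastforce
    then show ?thesis by (intro exI[of _ "max C 1"]) auto
  qed
qed (use assms[unfolded function_algebra_def] in blast)+

lemma uclosureI_dist:
  assumes "\<And>e. e > 0 \<Longrightarrow> \<exists>g\<in>A. \<forall>x\<in>S. cmod (f x - g x) \<le> e"
  shows "f \<in> uclosure S A"
  unfolding uclosure_def
proof (intro CollectI allI impI)
  fix e :: real assume "e > 0"
  then obtain g where "g \<in> A" "\<forall>x\<in>S. cmod (f x - g x) \<le> e/2" using assms[of "e/2"] by auto
  with \<open>e > 0\<close> show "\<exists>g\<in>A. \<forall>x\<in>S. cmod (f x - g x) < e" by force
qed

lemma uclosure_superset: "A \<subseteq> uclosure S A"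
proof
  fix f assume "f \<in> A"
  then show "f \<in> uclosure S A" unfolding uclosure_def by (auto intro!: bexI[of _ f])
qed

lemma uclosure_cong: "f \<in> uclosure S A \<Longrightarrow> (\<And>x. x \<in> S \<Longrightarrow> f x = g x) \<Longrightarrow> g \<in> uclosure S A"
  unfolding uclosure_def by simp

lemma uclosure_limit:
  assumes "\<And>e. e > 0 \<Longrightarrow> \<exists>g\<in>uclosure S A. \<forall>x\<in>S. cmod (f x - g x) \<le> e"
  shows "f \<in> uclosure S A"
proof (rule uclosureI_dist)
  fix e :: real assume "e > 0"
  then obtain g where g: "g \<in> uclosure S A" "\<forall>x\<in>S. cmod (f x - g x) \<le> e/2"
    using assms[of "e/2"] by auto
  have "e/2 > 0" using \<open>e > 0\<close> by simp
  then obtain h where h: "h \<in> A" "\<forall>x\<in>S. cmod (g x - h x) < e/2"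
    using g(1) unfolding uclosure_def mem_Collect_eq by meson
  show "\<exists>h\<in>A. \<forall>x\<in>S. cmod (f x - h x) \<le> e"
  proof (intro bexI[OF _ h(1)] ballI)
    fix x assume x: "x \<in> S"
    have "cmod (f x - h x) \<le> cmod (f x - g x) + cmod (g x - h x)"
      using norm_triangle_ineq[of "f x - g x" "g x - h x"] by simp
    also have "\<dots> \<le> e" using g(2) h(2) x by fastforce
    finally show "cmod (f x - h x) \<le> e" .
  qed
qed

lemma function_algebra_uclosure:
  assumes A: "function_algebra S A"
  shows "function_algebra S (uclosure S A)"
proof -
  have bdd: "\<exists>C>0. \<forall>x\<in>S. cmod (f x) \<le> C" if f: "f \<in> uclosure S A" for f
  proof -
    obtain g where g: "g \<in> A" "\<forall>x\<in>S. cmod (f x - g x) < 1"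
      using f unfolding uclosure_def mem_Collect_eq by (meson zero_less_one)
    obtain C where C: "C > 0" "\<forall>x\<in>S. cmod (g x) \<le> C" using function_algebraD(4)[OF A g(1)] by blast
    have "cmod (f x) \<le> C + 1" if "x \<in> S" for x
      using g(2) C(2) that norm_triangle_ineq[of "f x - g x" "g x"] by fastforce
    then show ?thesis using C(1) by (intro exI[of _ "C+1"]) auto
  qed
  have add: "(\<lambda>x. f x + g x) \<in> uclosure S A" if f: "f \<in> uclosure S A" and g: "g \<in> uclosure S A" for f g
  proof (rule uclosureI_dist)
    fix e :: real assume e: "e > 0"
    then have "e/2 > 0" by simp
    with f g obtain f' g' where fg: "f' \<in> A" "\<forall>x\<in>S. cmod (f x - f' x) < e/2"
      "g' \<in> A" "\<forall>x\<in>S. cmod (g x - g' x) < e/2" unfolding uclosure_def mem_Collect_eq by meson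
    have "cmod ((f x + g x) - (f' x + g' x)) \<le> e" if "x \<in> S" for x
    proof -
      have "cmod ((f x + g x) - (f' x + g' x)) = cmod ((f x - f' x) + (g x - g' x))"
        by (simp add: algebra_simps)
      also have "\<dots> \<le> cmod (f x - f' x) + cmod (g x - g' x)" by (rule norm_triangle_ineq)
      finally show ?thesis using fg that by fastforce
    qed
    then show "\<exists>h\<in>A. \<forall>x\<in>S. cmod (f x + g x - h x) \<le> e"
      using function_algebraD(2)[OF A fg(1,3)] by (intro bexI) auto
  qed
  have mult: "(\<lambda>x. f x * g x) \<in> uclosure S A" if f: "f \<in> uclosure S A" and g: "g \<in> uclosure S A" for f g
  proof (rule uclosureI_dist)
    fix e :: real assume e: "e > 0"
    obtain C where C: "C > 0" "\<forall>x\<in>S. cmod (f x) \<le> C" using bdd[OF f] by blast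
    obtain D where D: "D > 0" "\<forall>x\<in>S. cmod (g x) \<le> D" using bdd[OF g] by blast
    define d where "d = min 1 (e / (C + D + 1))"
    have CD: "C + D + 1 > 0" using C D by simp
    have "d \<le> e / (C + D + 1)" by (simp add: d_def)
    then have d3: "d * (C + D + 1) \<le> e" using CD by (simp only: pos_le_divide_eq)
    have d: "d > 0" "d \<le> 1"
      using e CD by (auto simp: d_def)
    obtain f' g' where fg: "f' \<in> A" "\<forall>x\<in>S. cmod (f x - f' x) < d"
      "g' \<in> A" "\<forall>x\<in>S. cmod (g x - g' x) < d" using d(1) f g unfolding uclosure_def mem_Collect_eq by meson
    have "cmod ((f x * g x) - (f' x * g' x)) \<le> e" if x: "x \<in> S" for x
    proof -
      have "(f x * g x) - (f' x * g' x) = f x * (g x - g' x) + (f x - f' x) * g x - (f x - f' x) * (g x - g' x)"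
        by (simp add: algebra_simps)
      also have "cmod \<dots> \<le> cmod (f x) * cmod (g x - g' x) + cmod (f x - f' x) * cmod (g x)
            + cmod (f x - f' x) * cmod (g x - g' x)"
        unfolding norm_mult[symmetric]
        by (rule order_trans[OF norm_triangle_ineq4 add_right_mono[OF norm_triangle_ineq]])
      also have "\<dots> \<le> C * d + d * D + 1 * d"
        using C D d fg(2,4) x by (intro add_mono mult_mono) (force intro: less_imp_le)+
      also have "\<dots> \<le> e" using d3 by (simp add: algebra_simps)
      finally show ?thesis .
    qed
    then show "\<exists>h\<in>A. \<forall>x\<in>S. cmod (f x * g x - h x) \<le> e"
      using function_algebraD(3)[OF A fg(1,3)] by (intro bexI) auto
  qed
  have const: "(\<lambda>x. c) \<in> uclosure S A" for c
    using function_algebraD(1)[OF A] uclosure_superset by blast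
  have bdd': "\<exists>C. \<forall>x\<in>S. cmod (f x) \<le> C" if f: "f \<in> uclosure S A" for f using bdd[OF f] by blast
  show ?thesis unfolding function_algebra_def
    by (intro conjI allI ballI const add mult bdd')
qed

lemma uclosure_continuous_on:
  fixes f :: "'a::topological_space \<Rightarrow> complex"
  assumes "f \<in> uclosure S A" "\<And>g. g \<in> A \<Longrightarrow> continuous_on S g"
  shows "continuous_on S f"
proof -
  have "\<exists>g. \<forall>n::nat. g n \<in> A \<and> (\<forall>x\<in>S. cmod (f x - g n x) < 1 / Suc n)"
    using assms(1) unfolding uclosure_def mem_Collect_eq by (intro choice allI) (meson of_nat_0_less_iff zero_less_Suc zero_less_divide_1_iff)
  then obtain g where g: "\<And>n. g n \<in> A" "\<And>n x. x \<in> S \<Longrightarrow> cmod (f x - g n x) < 1 / Suc n" by metis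
  have "uniform_limit S g f sequentially"
  proof (rule uniform_limitI)
    fix e :: real assume "e > 0"
    then obtain N where N: "1 / real (Suc N) < e" by (metis nat_approx_posE)
    show "\<forall>\<^sub>F n in sequentially. \<forall>x\<in>S. dist (g n x) (f x) < e"
    proof (intro eventually_sequentiallyI[of N] ballI)
      fix n x assume "N \<le> n" "x \<in> S"
      then have "cmod (f x - g n x) < 1 / real (Suc n)" using g(2)[OF \<open>x \<in> S\<close>, of n] by simp
      also have "\<dots> \<le> 1 / real (Suc N)" using \<open>N \<le> n\<close> by (simp add: frac_le)
      finally show "dist (g n x) (f x) < e" using N by (simp add: dist_norm norm_minus_commute)
    qed
  qed
  then show ?thesis using g(1) assms(2)
    by (intro uniform_limit_theorem[where f=g and F=sequentially]) auto
qed

section \<open>Cut-off functions on Swiss cheeses\<close>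

definition hol_germs :: "complex set \<Rightarrow> (complex \<Rightarrow> complex) set"
  where "hol_germs K = {f. \<exists>U. open U \<and> K \<subseteq> U \<and> f holomorphic_on U}"

abbreviation "HK K \<equiv> uclosure K (hol_germs K)"

lemma hol_germs_add: "f \<in> hol_germs K \<Longrightarrow> g \<in> hol_germs K \<Longrightarrow> (\<lambda>x. f x + g x) \<in> hol_germs K"
  and hol_germs_mult: "f \<in> hol_germs K \<Longrightarrow> g \<in> hol_germs K \<Longrightarrow> (\<lambda>x. f x * g x) \<in> hol_germs K"
proof -
  assume "f \<in> hol_germs K" "g \<in> hol_germs K"
  then obtain U V where "open U" "K \<subseteq> U" "f holomorphic_on U" "open V" "K \<subseteq> V" "g holomorphic_on V"
    unfolding hol_germs_def by auto
  then have "open (U \<inter> V)" "K \<subseteq> U \<inter> V" "f holomorphic_on (U \<inter> V)" "g holomorphic_on (U \<inter> V)"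
    by (auto intro: holomorphic_on_subset)
  then show "(\<lambda>x. f x + g x) \<in> hol_germs K" "(\<lambda>x. f x * g x) \<in> hol_germs K"
    unfolding hol_germs_def by (auto intro!: exI[of _ "U \<inter> V"] holomorphic_intros)
qed

lemma hol_germs_entire: "f holomorphic_on UNIV \<Longrightarrow> f \<in> hol_germs K"
  unfolding hol_germs_def by auto

lemma hol_germs_inverse:
  assumes "f \<in> hol_germs K" "\<And>w. w \<in> K \<Longrightarrow> f w \<noteq> 0"
  shows "(\<lambda>w. inverse (f w)) \<in> hol_germs K"
proof -
  obtain U where U: "open U" "K \<subseteq> U" "f holomorphic_on U" using assms unfolding hol_germs_def by auto
  define V where "V = {w \<in> U. f w \<noteq> 0}"
  have "open V" unfolding V_def
    using continuous_open_preimage[OF holomorphic_on_imp_continuous_on[OF U(3)] U(1), of "- {0}"]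
    by (simp add: vimage_def Int_def open_Compl)
  moreover have "K \<subseteq> V" using U assms(2) by (auto simp: V_def)
  moreover have "(\<lambda>w. inverse (f w)) holomorphic_on V"
    using U(3) by (intro holomorphic_intros) (auto simp: V_def intro: holomorphic_on_subset)
  ultimately show ?thesis unfolding hol_germs_def by auto
qed

lemma hol_germs_continuous_on: "f \<in> hol_germs K \<Longrightarrow> continuous_on K f"
  unfolding hol_germs_def using holomorphic_on_imp_continuous_on continuous_on_subset by blast

lemma HK_continuous_on: "f \<in> HK K \<Longrightarrow> continuous_on K f"
  using uclosure_continuous_on hol_germs_continuous_on by blast

lemma function_algebra_hol_germs:
  assumes "compact K" shows "function_algebra K (hol_germs K)"
proof -
  have "\<exists>C. \<forall>x\<in>K. cmod (f x) \<le> C" if "f \<in> hol_germs K" for f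
    using compact_continuous_image[OF hol_germs_continuous_on[OF that] assms]
    by (meson bounded_iff compact_imp_bounded imageI)
  then show ?thesis unfolding function_algebra_def
    using hol_germs_add hol_germs_mult hol_germs_entire by (simp add: holomorphic_on_const)
qed

lemma function_algebra_HK: "compact K \<Longrightarrow> function_algebra K (HK K)"
  by (simp add: function_algebra_hol_germs function_algebra_uclosure)

text \<open>An approximant \<open>g\<close> that is closer to \<open>f\<close> than half the minimum
  m of |f| satisfies |g| >= m/2 on \<open>K\<close>, so 1/g is again holomorphic near
  \<open>K\<close> and close to 1/f.\<close>

lemma HK_inverse:
  assumes K: "compact K" and f: "f \<in> HK K" and nz: "\<And>w. w \<in> K \<Longrightarrow> f w \<noteq> 0"
  shows "(\<lambda>w. inverse (f w)) \<in> HK K"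
proof (cases "K = {}")
  case True
  have "(\<lambda>_. 0) \<in> hol_germs K" by (rule hol_germs_entire) simp
  with True show ?thesis by (auto simp: uclosure_def)
next
  case False
  have "continuous_on K (\<lambda>w. cmod (f w))" using HK_continuous_on[OF f] by (intro continuous_intros)
  then obtain w0 where w0: "w0 \<in> K" "\<And>w. w \<in> K \<Longrightarrow> cmod (f w0) \<le> cmod (f w)"
    using continuous_attains_inf[OF K False] by metis
  define m where "m = cmod (f w0)"
  have m: "m > 0" using nz w0 by (simp add: m_def)
  show ?thesis
  proof (rule uclosureI_dist)
    fix e :: real assume e: "e > 0"
    define d where "d = min (m/2) (e * m * m / 2)"
    have d: "d > 0" "d \<le> m/2" "d \<le> e * m * m / 2" using e m by (auto simp: d_def)
    obtain g where g: "g \<in> hol_germs K" "\<forall>x\<in>K. cmod (f x - g x) < d"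
      using f d(1) unfolding uclosure_def mem_Collect_eq by meson
    have gm: "cmod (g w) \<ge> m/2" if "w \<in> K" for w
    proof -
      have "cmod (f w) \<le> cmod (f w - g w) + cmod (g w)" using norm_triangle_ineq[of "f w - g w" "g w"] by simp
      then show ?thesis using w0(2)[OF that] g(2) that d(2) by (fastforce simp: m_def)
    qed
    then have gnz: "g w \<noteq> 0" if "w \<in> K" for w using m that by fastforce
    have "cmod (inverse (f w) - inverse (g w)) \<le> e" if w: "w \<in> K" for w
    proof -
      have "inverse (f w) - inverse (g w) = (g w - f w) / (f w * g w)"
        using nz[OF w] gnz[OF w] by (simp add: field_simps)
      then have "cmod (inverse (f w) - inverse (g w)) = cmod (f w - g w) / (cmod (f w) * cmod (g w))"
        by (simp add: norm_divide norm_mult norm_minus_commute)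
      also have "\<dots> \<le> (e * m * m / 2) / (m * (m/2))"
      proof (rule frac_le)
        show "cmod (f w - g w) \<le> e * m * m / 2" using g(2) w d(3) by fastforce
        show "m * (m/2) \<le> cmod (f w) * cmod (g w)" using w0(2)[OF w] gm[OF w] m by (intro mult_mono) (auto simp: m_def)
      qed (use e m in auto)
      also have "\<dots> = e" using m by (simp add: field_simps)
      finally show ?thesis .
    qed
    then show "\<exists>h\<in>hol_germs K. \<forall>x\<in>K. cmod (inverse (f x) - h x) \<le> e"
      by (intro bexI[OF _ hol_germs_inverse[OF g(1) gnz]]) auto
  qed
qed

section \<open>Size of the logistic function away from its poles\<close>

text \<open>In the strip |Im t| <= \<pi> the only zero of 1 - exp t is 0. If |Re t| >= d/2, the
  modulus of exp t already differs from 1. Otherwise |Im t| >= d/2, and then either the real part of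
  1 - exp t is at least 1 or its imaginary part exp (Re t) sin (Im t) is large in modulus.\<close>

lemma cmod_one_minus_exp_ge:
  assumes im: "\<bar>Im t\<bar> \<le> pi" and d: "d \<le> cmod t" "0 < d" "d \<le> 1"
  shows "d / 12 \<le> cmod (1 - exp t)"
proof (cases "\<bar>Re t\<bar> \<ge> d / 2")
  case True
  have "\<bar>1 - exp (Re t)\<bar> \<le> cmod (1 - exp t)"
    using norm_triangle_ineq3[of 1 "exp t"] by simp
  moreover have "d / 12 \<le> \<bar>1 - exp (Re t)\<bar>"
  proof (cases "Re t \<ge> 0")
    case pos: True
    then have "d / 2 \<le> exp (Re t) - 1" using True exp_ge_add_one_self[of "Re t"] by linarith
    then show ?thesis using d by linarith
  next
    case neg: False
    have e: "1 + d / 2 \<le> exp (- Re t)" using True neg exp_ge_add_one_self[of "- Re t"] by simp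
    have "exp (Re t) = inverse (exp (- Re t))" by (simp add: exp_minus)
    also have "\<dots> \<le> inverse (1 + d / 2)" using e d by (intro le_imp_inverse_le) auto
    finally have "1 - exp (Re t) \<ge> 1 - inverse (1 + d / 2)" by simp
    also have "1 - inverse (1 + d / 2) = (d / 2) / (1 + d / 2)" using d by (simp add: field_simps)
    finally have "1 - exp (Re t) \<ge> (d / 2) / (1 + d / 2)" .
    moreover have "(d / 2) / (1 + d / 2) \<ge> (d / 2) / 2" using d by (intro divide_left_mono) auto
    ultimately show ?thesis using d by linarith
  qed
  ultimately show ?thesis by linarith
next
  case False
  have "d / 2 \<le> \<bar>Im t\<bar>" using cmod_le[of t] False d by linarith
  show ?thesis
  proof (cases "cos (Im t) \<le> 0")
    case True
    have "Re (1 - exp t) = 1 - exp (Re t) * cos (Im t)" by (simp add: Re_exp)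
    also have "\<dots> \<ge> 1" using True by (simp add: mult_nonneg_nonpos)
    finally have "1 \<le> Re (1 - exp t)" .
    then show ?thesis using complex_Re_le_cmod[of "1 - exp t"] d by linarith
  next
    case cpos: False
    have y: "\<bar>Im t\<bar> < pi / 2"
    proof (rule ccontr)
      assume "\<not> ?thesis"
      then have "cos \<bar>Im t\<bar> \<le> cos (pi/2)" using im by (subst cos_mono_le_eq) auto
      then show False using cpos by simp
    qed
    \<comment> \<open>From sin y >= y - y^3/6 and y < 2.\<close>
    have s: "\<bar>Im t\<bar> / 3 \<le> sin \<bar>Im t\<bar>"
    proof -
      define y where "y = \<bar>Im t\<bar>"
      have y0: "0 \<le> y" "y < 2" using y pi_less_4 by (auto simp: y_def)
      have "\<bar>sin y - (\<Sum>m<3. sin_coeff m * y ^ m)\<bar> \<le> inverse (fact 3) * \<bar>y\<bar> ^ 3"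
        by (rule Maclaurin_sin_bound)
      then have "\<bar>sin y - y\<bar> \<le> y ^ 3 / 6"
        using y0 by (simp add: sin_coeff_def numeral_3_eq_3 fact_numeral)
      moreover have "y ^ 3 \<le> 4 * y"
        using y0 mult_mono[of "y * y" 4 y y] mult_mono[of y 2 y 2] by (simp add: power3_eq_cube)
      ultimately show ?thesis unfolding y_def[symmetric] by linarith
    qed
    have "exp (- (d / 2)) \<le> exp (Re t)" using False by simp
    moreover have "1 - d / 2 \<le> exp (- (d / 2))" using exp_ge_add_one_self[of "- (d/2)"] by simp
    ultimately have e: "1 / 2 \<le> exp (Re t)" using d by linarith
    have "d / 12 \<le> (1 / 2) * (\<bar>Im t\<bar> / 3)" using \<open>d / 2 \<le> \<bar>Im t\<bar>\<close> by simp
    also have "\<dots> \<le> exp (Re t) * sin \<bar>Im t\<bar>" using e s by (intro mult_mono) auto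
    also have "\<dots> \<le> \<bar>Im (1 - exp t)\<bar>" by (cases "Im t \<ge> 0") (auto simp: Im_exp)
    also have "\<dots> \<le> cmod (1 - exp t)" by (rule abs_Im_le_cmod)
    finally show ?thesis .
  qed
qed

text \<open>The zeros of 1 + exp s are the odd multiples of \<i> \<pi>; the floor selects one whose
  difference t from s satisfies |Im t| <= \<pi>, and exp s = - exp t.\<close>

lemma cmod_one_plus_exp_ge:
  assumes "0 < d" "d \<le> 1"
    and "d \<le> cmod (s - \<i> * of_real (pi * (2 * of_int \<lfloor>Im s / (2 * pi)\<rfloor> + 1)))"
  shows "d / 12 \<le> cmod (1 + exp s)"
proof -
  define k where "k = \<lfloor>Im s / (2 * pi)\<rfloor>"
  define t where "t = s - \<i> * of_real (pi * (2 * of_int k + 1))"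
  have "of_int k \<le> Im s / (2 * pi)" "Im s / (2 * pi) < of_int k + 1" unfolding k_def by linarith+
  then have "2 * pi * of_int k \<le> Im s" "Im s < 2 * pi * (of_int k + 1)"
    by (simp_all add: field_simps)
  then have im: "\<bar>Im t\<bar> \<le> pi" by (auto simp: t_def algebra_simps)
  have "exp s = exp (t + \<i> * of_real (pi * (2 * of_int k + 1)))" by (simp add: t_def)
  also have "\<dots> = exp t * exp (\<i> * of_real (pi * (2 * of_int k + 1)))" by (rule exp_add)
  also have "exp (\<i> * of_real (pi * (2 * of_int k + 1))) = exp (\<i> * of_real pi)"
    unfolding exp_eq by (intro exI[of _ k]) (simp add: algebra_simps)
  finally have "exp s = - exp t" by simp
  then show ?thesis using cmod_one_minus_exp_ge[OF im, of d] assms unfolding t_def k_def by simp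
qed

lemma cmod_logistic_right:
  assumes "exp (- Re s) \<le> 1/2" shows "cmod (inverse (1 + exp s)) \<le> 2 * exp (- Re s)"
proof -
  have e: "2 \<le> exp (Re s)" using assms by (simp add: exp_minus field_simps)
  have "exp (Re s) / 2 \<le> exp (Re s) - 1" using e by simp
  also have "\<dots> \<le> cmod (1 + exp s)" using norm_triangle_ineq2[of "exp s" "-1"] by (simp add: add.commute)
  finally have "inverse (cmod (1 + exp s)) \<le> inverse (exp (Re s) / 2)" by (intro le_imp_inverse_le) auto
  also have "inverse (exp (Re s) / 2) = 2 * exp (- Re s)" by (simp add: exp_minus inverse_eq_divide)
  finally show ?thesis by (simp add: norm_inverse)
qed

lemma cmod_logistic_left:
  assumes "exp (Re s) \<le> 1/2" shows "cmod (inverse (1 + exp s) - 1) \<le> 2 * exp (Re s)"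
proof -
  have l: "1/2 \<le> cmod (1 + exp s)" using norm_triangle_ineq2[of "1" "- exp s"] assms by simp
  then have "1 + exp s \<noteq> 0" by auto
  then have "inverse (1 + exp s) - 1 = - exp s * inverse (1 + exp s)" by (simp add: field_simps)
  then have "cmod (inverse (1 + exp s) - 1) = exp (Re s) * inverse (cmod (1 + exp s))"
    by (simp add: norm_mult norm_inverse)
  also have "inverse (cmod (1 + exp s)) \<le> inverse (1/2)" using l by (intro le_imp_inverse_le) auto
  finally show ?thesis by simp
qed

text \<open>Supplies the limit together with a rate that does not depend on the sequence. Applied at
  each point to partial products, this gives uniform convergence.\<close>

lemma geometric_limit:
  fixes a :: "nat \<Rightarrow> complex"
  assumes "\<And>k. cmod (a (Suc k) - a k) \<le> e / 2 ^ k"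
  shows "\<exists>l. \<forall>k. cmod (l - a k) \<le> 2 * e / 2 ^ k"
proof -
  define d where "d k = a (Suc k) - a k" for k
  have g: "(\<lambda>i. e / 2 ^ (i + k)) sums (2 * e / 2 ^ k)" for k
    using sums_mult[OF power_half_series, of "2 * e / 2 ^ k"] by (simp add: power_add field_simps)
  have sd: "summable (\<lambda>i. d (i + k))" for k
    using summable_comparison_test'[of "\<lambda>i. e / 2 ^ (i + k)" 0 "\<lambda>i. d (i + k)"] assms g[of k]
    by (auto simp: d_def sums_iff)
  have "cmod (a 0 + suminf d - a k) \<le> 2 * e / 2 ^ k" for k
  proof -
    have "suminf d = (\<Sum>i. d (i + k)) + sum d {..<k}"
      using suminf_split_initial_segment[of d k] sd[of 0] by simp
    moreover have "sum d {..<k} = a k - a 0" unfolding d_def by (rule sum_lessThan_telescope)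
    ultimately have "a 0 + suminf d - a k = (\<Sum>i. d (i + k))" by simp
    also have "cmod \<dots> \<le> (\<Sum>i. e / 2 ^ (i + k))"
      using assms by (intro norm_suminf_le) (auto simp: d_def intro: sums_summable[OF g])
    also have "\<dots> = 2 * e / 2 ^ k" using g[of k] by (simp add: sums_iff)
    finally show ?thesis .
  qed
  then show ?thesis by blast
qed

section \<open>Systems of holes with prescribed total radius\<close>

text \<open>\<open>K\<close> is left arbitrary: the holes of all strips must be collected before the
  cheese can be cut, so each cut-off is constructed for every compact set that avoids its own
  holes.\<close>

definition holes_avoid :: "(complex \<times> real) set \<Rightarrow> complex set \<Rightarrow> bool"
  where "holes_avoid H K \<longleftrightarrow> (\<forall>(p, d)\<in>H. K \<inter> ball p d = {})"

text \<open>Bounding all finite subsums expresses that the radii of a possibly infinite set of holes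
  have sum at most \<open>b\<close>.\<close>

definition holes_budget :: "(complex \<times> real) set \<Rightarrow> real \<Rightarrow> bool"
  where "holes_budget H b \<longleftrightarrow> (\<forall>h\<in>H. snd h > 0) \<and> (\<forall>F. finite F \<longrightarrow> F \<subseteq> H \<longrightarrow> sum snd F \<le> b)"

text \<open>The function \<open>f\<close> is the infinite product of the logistic functions
  \<open>1 / (1 + exp (N\<^sub>n (\<omega> w - c\<^sub>n)))\<close>, where \<open>c\<^sub>n\<close> increases to \<open>c\<close>; the holes surround their poles,
  and the many factors close to \<open>0\<close> force \<open>f\<close> to vanish beyond \<open>c\<close>.\<close>

lemma half_plane_cut:
  fixes \<omega> :: complex and c0 c b \<eta> :: real
  assumes om: "cmod \<omega> = 1" and c: "c0 < c" and b: "0 < b" "b \<le> 1" and eta: "0 < \<eta>" "\<eta> \<le> 1"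
  shows "\<exists>H. holes_budget H b \<and> (\<forall>(p, d)\<in>H. c0 \<le> Re (\<omega> * p) \<and> Re (\<omega> * p) \<le> c) \<and>
    (\<forall>K. compact K \<longrightarrow> K \<subseteq> ball 0 2 \<longrightarrow> holes_avoid H K \<longrightarrow>
      (\<exists>f\<in>HK K. \<forall>w\<in>K. cmod (f w) \<le> 1 + 168 / b \<and> (c \<le> Re (\<omega> * w) \<longrightarrow> f w = 0) \<and>
         (Re (\<omega> * w) \<le> c0 \<longrightarrow> cmod (1 - f w) \<le> \<eta>)))"
proof -
  define M where "M = 1 + 168 / b"
  define g where "g = c - c0"
  \<comment> \<open>Factor n receives 2 N + 5 <= 7 N holes of radius \<open>dn n / N n\<close>, of
    total radius at most 7 \<open>dn n\<close> = (b/2) / 2^n, and these sum to at most b. The bound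
    168 / b in the statement is 12 / \<open>dn 0\<close>, the bound of the factor number 0.\<close>
  define dn where "dn n = b / 14 / 2 ^ n" for n :: nat
  \<comment> \<open>\<open>cn n\<close> increases from the midpoint of c0 and c towards c, and the
    gap to \<open>cn (Suc n)\<close> is 2 \<open>\<tau> n\<close>. So every point lies to the right
    of \<open>cn n\<close> or to the left of \<open>cn (Suc n)\<close> with margin
    \<open>\<tau> n\<close>.\<close>
  define cn where "cn n = c - g / 2 ^ (n+1)" for n :: nat
  define \<tau> where "\<tau> n = g / 2 ^ (n+3)" for n :: nat
  \<comment> \<open>Accuracy of factor n at distance \<open>\<tau> n\<close> from its transition
    line. The divisor 1 + 12 / \<open>dn (Suc n)\<close> compensates for the possible size of the
    next factor, the divisor \<open>M\<close> for that of the partial product.\<close>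
  define \<kappa> where "\<kappa> n = \<eta> / (2 ^ (n+3) * M * (1 + 12 / dn (Suc n)))" for n
  have g: "g > 0" using c by (simp add: g_def)
  have M: "M \<ge> 1" using b by (simp add: M_def)
  have dn: "0 < dn n" "dn n \<le> 1" for n
  proof -
    show "0 < dn n" using b by (simp add: dn_def)
    have "b / 14 / 2 ^ n \<le> b / 14 / 1" using b by (intro divide_left_mono) auto
    then show "dn n \<le> 1" using b unfolding dn_def by linarith
  qed
  have \<tau>: "\<tau> n > 0" for n using g by (simp add: \<tau>_def)
  have den: "1 \<le> M * (1 + 12 / dn (Suc n))" for n
    using mult_mono[of 1 M 1 "1 + 12 / dn (Suc n)"] M dn[of "Suc n"] by simp
  have \<kappa>pos: "\<kappa> n > 0" for n unfolding \<kappa>_def using M eta dn(1)[of "Suc n"]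
    by (intro divide_pos_pos mult_pos_pos) (auto intro: add_pos_nonneg)
  have \<kappa>c: "2 * M * \<kappa> n * (1 + 12 / dn (Suc n)) = \<eta> / 2 ^ (n+2)" for n
  proof -
    have "1 + 12 / dn (Suc n) \<noteq> 0" using dn(1)[of "Suc n"] by (smt (verit) divide_pos_pos)
    moreover have "2 * M * (\<eta> / (2 ^ (n+3) * M * D)) * D = \<eta> / 2 ^ (n+2)" if "D \<noteq> 0" for D
      using that M by (simp add: power_add)
    ultimately show ?thesis unfolding \<kappa>_def by blast
  qed
  have \<kappa>b: "2 * M * \<kappa> n \<le> \<eta> / 2 ^ (n+2)" for n
  proof -
    have "2 * M * \<kappa> n * 1 \<le> 2 * M * \<kappa> n * (1 + 12 / dn (Suc n))"
      using M \<kappa>pos[of n] dn(1)[of "Suc n"] by (intro mult_left_mono) auto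
    then show ?thesis using \<kappa>c[of n] by simp
  qed
  have \<kappa>s: "2 * \<kappa> n \<le> \<eta> / 2 ^ (n+2)" for n
  proof -
    have "1 * (2 * \<kappa> n) \<le> M * (2 * \<kappa> n)" using M \<kappa>pos[of n] by (intro mult_right_mono) auto
    also have "\<dots> = 2 * M * \<kappa> n" by simp
    finally show ?thesis using \<kappa>b[of n] by linarith
  qed
  have \<kappa>a: "\<kappa> n \<le> 1/2" for n
  proof -
    have "\<eta> / 2 ^ (n+2) \<le> 1" using eta by (simp add: divide_le_eq) (smt (verit) one_le_power)
    then show ?thesis using \<kappa>s[of n] by linarith
  qed
  have "\<exists>N. 1 \<le> N \<and> exp (- real N * \<tau> n) \<le> \<kappa> n" for n
  proof -
    obtain N :: nat where N: "real N \<ge> max 1 (- ln (\<kappa> n) / \<tau> n)" using real_arch_simple by blast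
    then have "- ln (\<kappa> n) / \<tau> n \<le> real N" by simp
    then have "- ln (\<kappa> n) \<le> real N * \<tau> n" using \<tau>[of n] by (simp only: pos_divide_le_eq)
    then have "exp (- real N * \<tau> n) \<le> exp (ln (\<kappa> n))" by simp
    then show ?thesis using N \<kappa>pos[of n] by (intro exI[of _ N]) simp
  qed
  then obtain N :: "nat \<Rightarrow> nat" where N: "\<And>n. 1 \<le> N n" "\<And>n. exp (- real (N n) * \<tau> n) \<le> \<kappa> n" by metis
  define s where "s n w = of_real (N n) * (\<omega> * w - of_real (cn n))" for n w
  define h where "h n w = inverse (1 + exp (s n w))" for n w
  define pole where "pole n k = (of_real (cn n) + \<i> * of_real (pi * (2 * of_int k + 1) / N n)) / \<omega>" for n and k :: int
  \<comment> \<open>As |Im s| <= 2 N on a set \<open>K\<close> inside the disc of radius 2, the pole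
    selected by the floor in \<open>cmod_one_plus_exp_ge\<close> has an index |k| <= N + 2.\<close>
  define I where "I = {(n, k). \<bar>k\<bar> \<le> int (N n) + 2}"
  define hole where "hole = (\<lambda>(n, k). (pole n k, dn n / N n))"
  define H where "H = hole ` I"
  have om0: "\<omega> \<noteq> 0" using om by auto
  have cn: "c0 + g / 2 \<le> cn n" "cn n \<le> c" for n
  proof -
    have "g / 2 ^ (n+1) \<le> g / 2" using g by (intro divide_left_mono) auto
    moreover have "c - c0 = g" by (simp add: g_def)
    ultimately show "c0 + g / 2 \<le> cn n" unfolding cn_def by linarith
    show "cn n \<le> c" using g by (simp add: cn_def)
  qed
  have Re_pole: "Re (\<omega> * pole n k) = cn n" for n k
    using om0 by (simp add: pole_def)
  have budget: "holes_budget H b"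
    unfolding holes_budget_def
  proof (intro conjI allI impI ballI)
    show "snd x > 0" if "x \<in> H" for x using that dn(1) N(1) by (auto simp: H_def hole_def Suc_le_eq)
    fix F assume F: "finite F" "F \<subseteq> H"
    obtain C where C: "C \<subseteq> I" "finite C" "F = hole ` C"
      using finite_subset_image[OF F(1) F(2)[unfolded H_def]] by blast
    obtain m where m: "fst ` C \<subseteq> {..<m}" using finite_nat_iff_bounded[of "fst ` C"] C(2) by auto
    have "sum snd F \<le> sum (snd \<circ> hole) C"
      unfolding C(3) using dn(1) N(1) C(2)
      by (intro sum_image_le) (auto simp: hole_def less_imp_le)
    also have "\<dots> \<le> sum (snd \<circ> hole) (SIGMA n:{..<m}. {- (int (N n) + 2)..int (N n) + 2})"
    proof (rule sum_mono2)
      show "C \<subseteq> (SIGMA n:{..<m}. {- (int (N n) + 2)..int (N n) + 2})"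
        using C(1) m by (fastforce simp: I_def)
    qed (auto simp: hole_def dn(1) less_imp_le)
    also have "\<dots> = (\<Sum>n<m. \<Sum>k\<in>{- (int (N n) + 2)..int (N n) + 2}. dn n / N n)"
      by (subst sum.Sigma) (auto simp: hole_def intro!: sum.cong)
    also have "\<dots> \<le> (\<Sum>n<m. 7 * dn n)"
    proof (rule sum_mono)
      fix n
      have "card {- (int (N n) + 2)..int (N n) + 2} = 2 * N n + 5" by auto
      then have "(\<Sum>k\<in>{- (int (N n) + 2)..int (N n) + 2}. dn n / N n) = (2 * real (N n) + 5) * dn n / real (N n)" by simp
      also have "\<dots> \<le> (7 * real (N n)) * dn n / real (N n)"
        using N(1)[of n] dn(1)[of n] by (intro divide_right_mono mult_right_mono) auto
      also have "\<dots> = 7 * dn n" using N(1)[of n] by simp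
      finally show "(\<Sum>k\<in>{- (int (N n) + 2)..int (N n) + 2}. dn n / N n) \<le> 7 * dn n" .
    qed
    also have "\<dots> = b / 2 * (\<Sum>n<m. (1/2) ^ n)"
      by (simp add: dn_def sum_distrib_left power_divide)
    also have "(\<Sum>n<m. (1/2) ^ n) \<le> (2::real)"
    proof -
      have "(\<Sum>n<m. (1/2) ^ n) = ((1/2) ^ m - 1) / (1/2 - 1 :: real)" by (rule geometric_sum) simp
      also have "\<dots> = 2 - 2 * (1/2) ^ m" by (simp add: field_simps)
      finally show ?thesis by simp
    qed
    finally show "sum snd F \<le> b" using b by simp
  qed
  have "\<exists>f\<in>HK K. \<forall>w\<in>K. cmod (f w) \<le> M \<and> (c \<le> Re (\<omega> * w) \<longrightarrow> f w = 0) \<and>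
         (Re (\<omega> * w) \<le> c0 \<longrightarrow> cmod (1 - f w) \<le> \<eta>)"
    if K: "compact K" "K \<subseteq> ball 0 2" "holes_avoid H K" for K
  proof -
    have low: "dn n / 12 \<le> cmod (1 + exp (s n w))" if w: "w \<in> K" for n w
    proof (rule cmod_one_plus_exp_ge[OF dn])
      define k where "k = \<lfloor>Im (s n w) / (2 * pi)\<rfloor>"
      have "\<bar>Im (s n w)\<bar> \<le> N n * 2"
      proof -
        have "\<bar>Im (s n w)\<bar> = N n * \<bar>Im (\<omega> * w)\<bar>" by (simp add: s_def abs_mult)
        also have "\<dots> \<le> N n * cmod (\<omega> * w)" by (intro mult_left_mono abs_Im_le_cmod) auto
        also have "cmod (\<omega> * w) \<le> 2" using w K(2) om by (auto simp: norm_mult dist_norm less_imp_le dest!: subsetD)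
        finally show ?thesis by (simp add: mult_left_mono)
      qed
      then have "\<bar>Im (s n w)\<bar> / (2 * pi) \<le> N n * 2 / (2 * pi)" by (intro divide_right_mono) auto
      then have "\<bar>Im (s n w) / (2 * pi)\<bar> \<le> N n * 2 / (2 * pi)" by (simp add: abs_divide)
      also have "\<dots> \<le> N n" using pi_gt3 by (simp add: divide_le_eq mult_le_cancel_left1)
      finally have "\<bar>k\<bar> \<le> int (N n) + 2" unfolding k_def by linarith
      then have "(n, k) \<in> I" by (simp add: I_def)
      then have "(pole n k, dn n / N n) \<in> H" unfolding H_def hole_def by force
      then have "dn n / N n \<le> dist (pole n k) w" using K(3) w unfolding holes_avoid_def by fastforce
      then have "dn n \<le> N n * cmod (w - pole n k)"
        using N(1)[of n] by (simp add: divide_le_eq dist_norm norm_minus_commute mult.commute)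
      also have "\<dots> = cmod (of_real (N n) * \<omega> * (w - pole n k))" using om by (simp add: norm_mult)
      also have "of_real (N n) * \<omega> * (w - pole n k) = s n w - \<i> * of_real (pi * (2 * of_int k + 1))"
        using om0 N(1)[of n] by (simp add: s_def pole_def field_simps)
      finally show "dn n \<le> cmod (s n w - \<i> * of_real (pi * (2 * of_int \<lfloor>Im (s n w) / (2 * pi)\<rfloor> + 1)))"
        by (simp add: k_def)
    qed
    have hb: "cmod (h n w) \<le> 12 / dn n" if "w \<in> K" for n w
    proof -
      have "inverse (cmod (1 + exp (s n w))) \<le> inverse (dn n / 12)"
        using low[OF that, of n] dn(1)[of n] by (intro le_imp_inverse_le) auto
      then show ?thesis by (simp add: h_def norm_inverse)
    qed
    have hgerm: "h n \<in> hol_germs K" for n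
      unfolding h_def
    proof (rule hol_germs_inverse)
      show "(\<lambda>w. 1 + exp (s n w)) \<in> hol_germs K"
        unfolding s_def by (intro hol_germs_entire holomorphic_intros)
      show "1 + exp (s n w) \<noteq> 0" if "w \<in> K" for w using low[OF that, of n] dn(1)[of n] by auto
    qed
    have Re_s: "Re (s n w) = N n * (Re (\<omega> * w) - cn n)" for n w by (simp add: s_def)
    have right: "cmod (h n w) \<le> 2 * \<kappa> n" if "cn n + \<tau> n \<le> Re (\<omega> * w)" for n w
    proof -
      have "N n * \<tau> n \<le> Re (s n w)" unfolding Re_s using that by (intro mult_left_mono) auto
      then have "exp (- Re (s n w)) \<le> exp (- real (N n) * \<tau> n)" by simp
      also have "\<dots> \<le> \<kappa> n" by (rule N(2))
      finally have e: "exp (- Re (s n w)) \<le> \<kappa> n" .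
      then have "exp (- Re (s n w)) \<le> 1/2" using \<kappa>a[of n] by linarith
      from cmod_logistic_right[OF this] e show ?thesis unfolding h_def by linarith
    qed
    have left: "cmod (h n w - 1) \<le> 2 * \<kappa> n" if "Re (\<omega> * w) \<le> cn n - \<tau> n" for n w
    proof -
      have "N n * \<tau> n \<le> N n * (cn n - Re (\<omega> * w))" using that by (intro mult_left_mono) auto
      then have "exp (Re (s n w)) \<le> exp (- real (N n) * \<tau> n)" unfolding Re_s by (simp add: algebra_simps)
      also have "\<dots> \<le> \<kappa> n" by (rule N(2))
      finally have e: "exp (Re (s n w)) \<le> \<kappa> n" .
      then have "exp (Re (s n w)) \<le> 1/2" using \<kappa>a[of n] by linarith
      from cmod_logistic_left[OF this] e show ?thesis unfolding h_def by linarith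
    qed
    define R where "R n w = (\<Prod>j<n. h j w)" for n w
    have RSuc: "R (Suc n) w = R n w * h n w" for n w by (simp add: R_def)
    have gap: "cn (Suc k) - 2 * \<tau> k = cn k" "\<tau> (Suc k) \<le> \<tau> k" for k
    proof -
      show "cn (Suc k) - 2 * \<tau> k = cn k" by (simp add: cn_def \<tau>_def field_simps power_add)
      show "\<tau> (Suc k) \<le> \<tau> k" using g by (simp add: \<tau>_def field_simps)
    qed
    \<comment> \<open>To the left, the new factor is close to 1 and the partial product is at most
      \<open>M\<close>. To the right, the previous factor is so small that it absorbs the crude
      bound of the new one.\<close>
    have diff: "cmod (R (Suc (Suc k)) w - R (Suc k) w) \<le> \<eta> / 2 ^ (k+2)"
      if w: "w \<in> K" and Rb: "cmod (R k w) \<le> M" "cmod (R (Suc k) w) \<le> M" for k w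
    proof (cases "Re (\<omega> * w) \<le> cn k + \<tau> k")
      case True
      then have "Re (\<omega> * w) \<le> cn (Suc k) - \<tau> (Suc k)" using gap[of k] by linarith
      then have l: "cmod (h (Suc k) w - 1) \<le> 2 * \<kappa> (Suc k)" by (rule left)
      have "R (Suc (Suc k)) w - R (Suc k) w = R (Suc k) w * (h (Suc k) w - 1)" by (simp add: RSuc algebra_simps)
      then have "cmod (R (Suc (Suc k)) w - R (Suc k) w) = cmod (R (Suc k) w) * cmod (h (Suc k) w - 1)"
        by (simp add: norm_mult)
      also have "\<dots> \<le> M * (2 * \<kappa> (Suc k))" using M Rb(2) l by (intro mult_mono) auto
      also have "\<dots> \<le> \<eta> / 2 ^ (Suc k + 2)" using \<kappa>b[of "Suc k"] by (simp add: mult_ac)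
      also have "\<dots> \<le> \<eta> / 2 ^ (k + 2)" using eta by (intro divide_left_mono) auto
      finally show ?thesis .
    next
      case False
      then have l: "cmod (h k w) \<le> 2 * \<kappa> k" by (intro right) simp
      have "R (Suc (Suc k)) w - R (Suc k) w = R k w * h k w * (h (Suc k) w - 1)" by (simp add: RSuc algebra_simps)
      then have "cmod (R (Suc (Suc k)) w - R (Suc k) w) = cmod (R k w) * cmod (h k w) * cmod (h (Suc k) w - 1)"
        by (simp add: norm_mult)
      also have "cmod (h (Suc k) w - 1) \<le> 1 + 12 / dn (Suc k)"
        using norm_triangle_ineq4[of "h (Suc k) w" 1] hb[OF w, of "Suc k"] by simp
      also have "cmod (R k w) * cmod (h k w) * (1 + 12 / dn (Suc k)) \<le> M * (2 * \<kappa> k) * (1 + 12 / dn (Suc k))"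
        using M Rb(1) l dn(1)[of "Suc k"] by (intro mult_right_mono mult_mono) (auto intro: add_nonneg_nonneg)
      also have "\<dots> = \<eta> / 2 ^ (k + 2)" using \<kappa>c[of k] by (simp add: mult_ac)
      finally show ?thesis by (simp add: mult_left_mono)
    qed
    have R1: "cmod (R (Suc 0) w) \<le> 168 / b" if "w \<in> K" for w
      using hb[OF that, of 0] by (simp add: R_def dn_def)
    \<comment> \<open>The product of the bounds 12 / \<open>dn j\<close> would be useless; the
      partial products stay bounded because their increments are summable, and the increment at
      \<open>k\<close> is estimated by means of the bounds obtained so far.\<close>
    have Rb: "cmod (R k w) \<le> M \<and> cmod (R (Suc k) w) \<le> 168 / b + \<eta> / 2 * (1 - 1 / 2 ^ k)" if w: "w \<in> K" for k w
    proof (induction k)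
      case 0
      then show ?case using R1[OF w] M by (simp add: R_def)
    next
      case (Suc k)
      have "\<eta> / 2 * (1 - 1 / 2 ^ k) \<le> 1 * 1" using eta by (intro mult_mono) auto
      then have a: "cmod (R (Suc k) w) \<le> M" using Suc unfolding M_def by linarith
      have "cmod (R (Suc (Suc k)) w) \<le> cmod (R (Suc k) w) + \<eta> / 2 ^ (k+2)"
        using diff[OF w _ a] Suc norm_triangle_ineq2[of "R (Suc (Suc k)) w" "R (Suc k) w"] by simp
      also have "\<dots> \<le> 168 / b + \<eta> / 2 * (1 - 1 / 2 ^ k) + \<eta> / 2 ^ (k+2)" using Suc by simp
      also have "\<dots> = 168 / b + \<eta> / 2 * (1 - 1 / 2 ^ Suc k)" by (simp add: field_simps)
      finally show ?case using a by simp
    qed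
    have "\<exists>l. \<forall>k. cmod (l - R (Suc k) w) \<le> 2 * (\<eta> / 4) / 2 ^ k" if w: "w \<in> K" for w
    proof (rule geometric_limit)
      fix k
      have "cmod (R (Suc k) w) \<le> M" using Rb[OF w, of "Suc k"] by simp
      then show "cmod (R (Suc (Suc k)) w - R (Suc k) w) \<le> \<eta> / 4 / 2 ^ k"
        using diff[OF w, of k] Rb[OF w, of k] by (simp add: power_add)
    qed
    then obtain f where f: "\<And>w k. w \<in> K \<Longrightarrow> cmod (f w - R (Suc k) w) \<le> 2 * (\<eta> / 4) / 2 ^ k" by metis
    have Rgerm: "R n \<in> hol_germs K" for n
    proof (induction n)
      case 0 then show ?case by (simp add: R_def[abs_def] hol_germs_entire)
    next
      case (Suc n) then show ?case using hol_germs_mult[OF Suc hgerm[of n]] by (simp add: R_def[abs_def])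
    qed
    have "f \<in> HK K"
    proof (rule uclosureI_dist)
      fix e :: real assume "e > 0"
      then obtain k where k: "(1/2) ^ k < e" using real_arch_pow_inv[of e "1/2"] by auto
      have "cmod (f w - R (Suc k) w) \<le> e" if "w \<in> K" for w
      proof -
        have "cmod (f w - R (Suc k) w) \<le> 2 * (\<eta> / 4) / 2 ^ k" by (rule f[OF that])
        also have "\<dots> \<le> 1 / 2 ^ k" using eta by (intro divide_right_mono) auto
        finally show ?thesis using k by (simp add: power_divide)
      qed
      then show "\<exists>g\<in>hol_germs K. \<forall>w\<in>K. cmod (f w - g w) \<le> e" by (intro bexI[OF _ Rgerm]) auto
    qed
    moreover have "cmod (f w) \<le> M" if w: "w \<in> K" for w
      using f[OF w, of 0] R1[OF w] norm_triangle_ineq2[of "f w" "R (Suc 0) w"] eta by (simp add: M_def)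
    moreover have "f w = 0" if w: "w \<in> K" and x: "c \<le> Re (\<omega> * w)" for w
    proof -
      have fk: "cmod (f w) \<le> 1 / 2 ^ k" for k
      proof -
        have "cn k + \<tau> k \<le> c" using g by (simp add: cn_def \<tau>_def field_simps power_add)
        then have "cmod (h k w) \<le> 2 * \<kappa> k" using x by (intro right) simp
        then have "cmod (R (Suc k) w) \<le> M * (2 * \<kappa> k)"
          unfolding RSuc norm_mult using M Rb[OF w, of k] by (intro mult_mono) auto
        also have "\<dots> \<le> \<eta> / 2 ^ (k+2)" using \<kappa>b[of k] by (simp add: mult_ac)
        finally have "cmod (f w) \<le> 2 * (\<eta> / 4) / 2 ^ k + \<eta> / 2 ^ (k+2)"
          using f[OF w, of k] norm_triangle_ineq2[of "f w" "R (Suc k) w"] by simp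
        also have "\<dots> = (3 * \<eta> / 4) / 2 ^ k" by (simp add: power_add)
        also have "\<dots> \<le> 1 / 2 ^ k" using eta by (intro divide_right_mono) auto
        finally show ?thesis .
      qed
      have "\<not> 0 < cmod (f w)"
      proof
        assume "0 < cmod (f w)"
        then obtain k where "(1/2) ^ k < cmod (f w)" using real_arch_pow_inv[of "cmod (f w)" "1/2"] by auto
        then show False using fk[of k] by (simp add: power_divide)
      qed
      then show ?thesis by simp
    qed
    moreover have "cmod (1 - f w) \<le> \<eta>" if w: "w \<in> K" and x: "Re (\<omega> * w) \<le> c0" for w
    proof -
      have "Re (\<omega> * w) \<le> cn 0 - \<tau> 0" using x g by (simp add: cn_def \<tau>_def g_def field_simps)
      then have "cmod (h 0 w - 1) \<le> 2 * \<kappa> 0" by (rule left)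
      then have "cmod (R (Suc 0) w - 1) \<le> \<eta> / 4" using \<kappa>s[of 0] by (simp add: R_def)
      moreover have "cmod (f w - R (Suc 0) w) \<le> \<eta> / 2" using f[OF w, of 0] by simp
      ultimately have "cmod (f w - 1) \<le> \<eta> / 2 + \<eta> / 4"
        using norm_triangle_ineq[of "f w - R (Suc 0) w" "R (Suc 0) w - 1"] by simp
      then show ?thesis using eta by (simp add: norm_minus_commute)
    qed
    ultimately show ?thesis by blast
  qed
  moreover have "\<forall>(p, d)\<in>H. c0 \<le> Re (\<omega> * p) \<and> Re (\<omega> * p) \<le> c"
  proof -
    have "c0 \<le> Re (\<omega> * pole n k) \<and> Re (\<omega> * pole n k) \<le> c" for n k
      unfolding Re_pole using cn[of n] g by linarith
    then have "case x of (p, d) \<Rightarrow> c0 \<le> Re (\<omega> * p) \<and> Re (\<omega> * p) \<le> c" if "x \<in> H" for x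
      using that unfolding H_def hole_def by (elim imageE) (simp only: split_beta prod.case fst_conv snd_conv)
    then show ?thesis by blast
  qed
  ultimately show ?thesis using budget unfolding M_def by blast
qed

lemma holes_budget_Un:
  assumes "holes_budget H a" "holes_budget G b"
  shows "holes_budget (H \<union> G) (a + b)"
  unfolding holes_budget_def
proof (intro conjI allI impI)
  show "\<forall>h\<in>H \<union> G. snd h > 0" using assms unfolding holes_budget_def by auto
  fix F assume F: "finite F" "F \<subseteq> H \<union> G"
  have "sum snd F = sum snd (F \<inter> H) + sum snd (F - H)"
    using sum.Int_Diff[OF F(1)] by blast
  also have "\<dots> \<le> a + b"
  proof (rule add_mono)
    have "finite (F \<inter> H)" "F \<inter> H \<subseteq> H" using F by auto
    then show "sum snd (F \<inter> H) \<le> a" using assms(1) unfolding holes_budget_def by blast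
    have "finite (F - H)" "F - H \<subseteq> G" using F by auto
    then show "sum snd (F - H) \<le> b" using assms(2) unfolding holes_budget_def by blast
  qed
  finally show "sum snd F \<le> a + b" .
qed

lemma holes_avoid_mono: "holes_avoid H K \<Longrightarrow> G \<subseteq> H \<Longrightarrow> holes_avoid G K"
  unfolding holes_avoid_def by blast

text \<open>If \<open>f\<^sub>1\<close> vanishes on the right, \<open>f\<^sub>2\<close> on the left, and each is so close to \<open>1\<close> on the
  other side that \<open>(1 - f\<^sub>1) (1 - f\<^sub>2)\<close> has modulus less than \<open>1\<close>, then
  \<open>f\<^sub>1 / (1 - (1 - f\<^sub>1) (1 - f\<^sub>2))\<close> is a cut-off function.\<close>

lemma strip_cut:
  fixes \<omega> :: complex and a b \<beta> :: real
  assumes om: "cmod \<omega> = 1" and ab: "a < b" and be: "0 < \<beta>" "\<beta> \<le> 1"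
  shows "\<exists>H. holes_budget H \<beta> \<and> (\<forall>(p, d)\<in>H. a \<le> Re (\<omega> * p) \<and> Re (\<omega> * p) \<le> b) \<and>
    (\<forall>K. compact K \<longrightarrow> K \<subseteq> ball 0 2 \<longrightarrow> holes_avoid H K \<longrightarrow>
      (\<exists>u\<in>HK K. \<forall>w\<in>K. (Re (\<omega> * w) \<le> a \<longrightarrow> u w = 1) \<and> (b \<le> Re (\<omega> * w) \<longrightarrow> u w = 0)))"
proof -
  define m where "m = (a + b) / 2"
  define M where "M = 1 + 168 / (\<beta> / 2)"
  \<comment> \<open>On either side of \<open>m\<close> one of |1 - f| and |1 - g| is at most
    \<open>\<eta>\<close> and the other at most 1 + M, so the product is at most 1/2.\<close>
  define \<eta> where "\<eta> = 1 / (2 * (1 + M))"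
  have M: "M \<ge> 1" using be by (simp add: M_def)
  have eta: "0 < \<eta>" "\<eta> \<le> 1" "\<eta> * (1 + M) = 1/2" using M by (auto simp: \<eta>_def field_simps)
  have b2: "0 < \<beta>/2" "\<beta>/2 \<le> 1" using be by auto
  have m: "a < m" "m < b" "- m < - a" using ab by (auto simp: m_def)
  obtain H1 where H1c: "holes_budget H1 (\<beta>/2) \<and> (\<forall>(p, d)\<in>H1. m \<le> Re (\<omega> * p) \<and> Re (\<omega> * p) \<le> b)
    \<and> (\<forall>K. compact K \<longrightarrow> K \<subseteq> ball 0 2 \<longrightarrow> holes_avoid H1 K \<longrightarrow>
      (\<exists>f\<in>HK K. \<forall>w\<in>K. cmod (f w) \<le> M \<and> (b \<le> Re (\<omega> * w) \<longrightarrow> f w = 0) \<and>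
         (Re (\<omega> * w) \<le> m \<longrightarrow> cmod (1 - f w) \<le> \<eta>)))"
    using half_plane_cut[OF om m(2) b2 eta(1,2)] unfolding M_def[symmetric] by (rule exE)
  note H1 = H1c[THEN conjunct1] H1c[THEN conjunct2, THEN conjunct1] H1c[THEN conjunct2, THEN conjunct2]
  have om': "cmod (- \<omega>) = 1" using om by simp
  obtain H2 where H2c: "holes_budget H2 (\<beta>/2) \<and> (\<forall>(p, d)\<in>H2. - m \<le> Re (- \<omega> * p) \<and> Re (- \<omega> * p) \<le> - a)
    \<and> (\<forall>K. compact K \<longrightarrow> K \<subseteq> ball 0 2 \<longrightarrow> holes_avoid H2 K \<longrightarrow>
      (\<exists>f\<in>HK K. \<forall>w\<in>K. cmod (f w) \<le> M \<and> (- a \<le> Re (- \<omega> * w) \<longrightarrow> f w = 0) \<and>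
         (Re (- \<omega> * w) \<le> - m \<longrightarrow> cmod (1 - f w) \<le> \<eta>)))"
    using half_plane_cut[OF om' m(3) b2 eta(1,2)] unfolding M_def[symmetric] by (rule exE)
  note H2 = H2c[THEN conjunct1] H2c[THEN conjunct2, THEN conjunct1] H2c[THEN conjunct2, THEN conjunct2]
  have "\<exists>u\<in>HK K. \<forall>w\<in>K. (Re (\<omega> * w) \<le> a \<longrightarrow> u w = 1) \<and> (b \<le> Re (\<omega> * w) \<longrightarrow> u w = 0)"
    if K: "compact K" "K \<subseteq> ball 0 2" "holes_avoid (H1 \<union> H2) K" for K
  proof -
    have K1: "holes_avoid H1 K" and K2: "holes_avoid H2 K" using K(3) holes_avoid_mono by blast+
    obtain f where f: "f \<in> HK K" "\<And>w. w \<in> K \<Longrightarrow> cmod (f w) \<le> M" "\<And>w. w \<in> K \<Longrightarrow> b \<le> Re (\<omega> * w) \<Longrightarrow> f w = 0"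
      "\<And>w. w \<in> K \<Longrightarrow> Re (\<omega> * w) \<le> m \<Longrightarrow> cmod (1 - f w) \<le> \<eta>" using H1(3)[rule_format, OF K(1,2) K1] by blast
    obtain g where g: "g \<in> HK K" "\<And>w. w \<in> K \<Longrightarrow> cmod (g w) \<le> M" "\<And>w. w \<in> K \<Longrightarrow> - a \<le> Re (- \<omega> * w) \<Longrightarrow> g w = 0"
      "\<And>w. w \<in> K \<Longrightarrow> Re (- \<omega> * w) \<le> - m \<Longrightarrow> cmod (1 - g w) \<le> \<eta>" using H2(3)[rule_format, OF K(1,2) K2] by blast
    have alg: "function_algebra K (HK K)" by (rule function_algebra_HK[OF K(1)])
    define q where "q = (\<lambda>w. f w + (g w + (-1) * (f w * g w)))"
    have q: "q \<in> HK K" unfolding q_def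
      by (intro function_algebraD[OF alg] f(1) g(1))
    have qe: "q w = 1 - (1 - f w) * (1 - g w)" for w by (simp add: q_def algebra_simps)
    have nz: "q w \<noteq> 0" if w: "w \<in> K" for w
    proof -
      have f1: "cmod (1 - f w) \<le> 1 + M" using f(2)[OF w] norm_triangle_ineq4[of 1 "f w"] by simp
      have g1: "cmod (1 - g w) \<le> 1 + M" using g(2)[OF w] norm_triangle_ineq4[of 1 "g w"] by simp
      have "cmod ((1 - f w) * (1 - g w)) \<le> \<eta> * (1 + M)"
      proof (cases "Re (\<omega> * w) \<le> m")
        case True
        then show ?thesis unfolding norm_mult using f(4)[OF w True] g1 eta(1) by (intro mult_mono) auto
      next
        case False
        then have "cmod (1 - g w) \<le> \<eta>" using g(4)[OF w] by simp
        then have "cmod (1 - f w) * cmod (1 - g w) \<le> (1 + M) * \<eta>" using f1 M by (intro mult_mono) auto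
        then show ?thesis by (simp add: norm_mult mult.commute)
      qed
      then have "cmod ((1 - f w) * (1 - g w)) < 1" using eta(3) by simp
      then show ?thesis unfolding qe by auto
    qed
    have "(\<lambda>w. f w * inverse (q w)) \<in> HK K"
      by (intro function_algebraD[OF alg] f(1) HK_inverse K(1) q nz)
    moreover have "f w * inverse (q w) = 1" if w: "w \<in> K" and "Re (\<omega> * w) \<le> a" for w
    proof -
      have "g w = 0" using g(3)[OF w] that by simp
      then have "q w = f w" by (simp add: qe)
      then show ?thesis using nz[OF w] by simp
    qed
    moreover have "f w * inverse (q w) = 0" if w: "w \<in> K" and "b \<le> Re (\<omega> * w)" for w
      using f(3)[OF that] by simp
    ultimately show ?thesis by (intro bexI[of _ "\<lambda>w. f w * inverse (q w)"]) auto
  qed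
  moreover have "holes_budget (H1 \<union> H2) \<beta>" using holes_budget_Un[OF H1(1) H2(1)] by simp
  moreover have "\<forall>(p, d)\<in>H1 \<union> H2. a \<le> Re (\<omega> * p) \<and> Re (\<omega> * p) \<le> b"
    using H1(2) H2(2) m by fastforce
  ultimately show ?thesis by blast
qed

section \<open>The rectangle and its countable system of strips\<close>

definition Q :: "complex set" where "Q = {w. 0 \<le> Re w \<and> Re w \<le> 1 \<and> \<bar>Im w\<bar> \<le> 1}"

lemma compact_Q: "compact Q"
proof -
  have "Q = cbox (- \<i>) (1 + \<i>)" by (auto simp: Q_def in_cbox_complex_iff)
  then show ?thesis by (metis compact_cbox)
qed

lemma Q_subset_ball: "Q \<subseteq> ball 0 2"
proof
  fix w assume "w \<in> Q"
  then have "(Re w)\<^sup>2 \<le> 1" "(Im w)\<^sup>2 \<le> 1" by (auto simp: Q_def abs_square_le_1)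
  then have "(cmod w)\<^sup>2 < 2\<^sup>2" by (simp add: cmod_power2)
  then show "w \<in> ball 0 2" using power2_less_imp_less[of "cmod w" 2] by (simp add: dist_norm)
qed

text \<open>The directions 1 and \<i> give strips with vertical and with horizontal sides. The
  condition \<open>0 < a * b\<close> keeps the strip away from the parallel line through 0, hence
  its holes at distance at least min |a| |b| from 0.\<close>

definition cut_params :: "(complex \<times> real \<times> real) set"
  where "cut_params = {1, \<i>} \<times> {(a, b). a \<in> \<rat> \<and> b \<in> \<rat> \<and> a < b \<and> 0 < a * b}"

lemma countable_cut_params: "countable cut_params"
proof -
  have "{(a::real, b::real). a \<in> \<rat> \<and> b \<in> \<rat> \<and> a < b \<and> 0 < a * b} \<subseteq> \<rat> \<times> \<rat>" by auto
  then have "countable {(a::real, b::real). a \<in> \<rat> \<and> b \<in> \<rat> \<and> a < b \<and> 0 < a * b}"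
    by (rule countable_subset) (intro countable_SIGMA countable_rat)
  then show ?thesis unfolding cut_params_def by (intro countable_SIGMA) auto
qed

text \<open>The factor \<open>exp (2 / \<bar>p\<bar>)\<close> bounds \<open>\<bar>exp (1 / w)\<bar>\<close> near the hole.\<close>

definition hole_weight :: "complex \<times> real \<Rightarrow> real"
  where "hole_weight h = snd h * (1 + exp (2 / cmod (fst h)))"

theorem swiss_cheese_exists:
  "\<exists>H. (\<forall>(p, d)\<in>H. 0 < d \<and> 6 * d \<le> cmod p) \<and>
     (\<forall>F. finite F \<longrightarrow> F \<subseteq> H \<longrightarrow> sum hole_weight F \<le> 1) \<and>
     (\<forall>(\<omega>, a, b)\<in>cut_params. \<forall>K. compact K \<longrightarrow> K \<subseteq> ball 0 2 \<longrightarrow> holes_avoid H K \<longrightarrow>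
       (\<exists>u\<in>HK K. \<forall>w\<in>K. (Re (\<omega> * w) \<le> a \<longrightarrow> u w = 1) \<and> (b \<le> Re (\<omega> * w) \<longrightarrow> u w = 0)))"
proof -
  \<comment> \<open>\<open>r\<close> bounds from below the distance from 0 of the centres belonging
    to a strip. The budget \<open>bd\<close> is at most r/6, which yields 6 d <= |p|, and its
    product with 1 + exp (2/r) is at most 2^(-n-1) for the n-th strip, so all weights together sum
    to at most 1.\<close>
  define r where "r = (\<lambda>(\<omega>::complex, a::real, b::real). min \<bar>a\<bar> \<bar>b\<bar>)"
  define bd where "bd x = min 1 (r x / 6) / (1 + exp (2 / r x)) / 2 ^ Suc (to_nat_on cut_params x)" for x
  have rpos: "r x > 0" if "x \<in> cut_params" for x
    using that by (auto simp: cut_params_def r_def)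
  have bd: "0 < bd x" "bd x \<le> 1" "bd x \<le> r x / 6" "bd x * (1 + exp (2 / r x)) \<le> 1 / 2 ^ Suc (to_nat_on cut_params x)"
    if "x \<in> cut_params" for x
  proof -
    define e where "e = 1 + exp (2 / r x)"
    define t where "t = (2::real) ^ Suc (to_nat_on cut_params x)"
    have e: "e \<ge> 1" by (simp add: e_def)
    have t: "t \<ge> 1" unfolding t_def by (rule one_le_power) simp
    have et: "e * t \<ge> 1" using mult_mono[of 1 e 1 t] e t by simp
    have b: "bd x = min 1 (r x / 6) / (e * t)" by (simp add: bd_def e_def t_def)
    show "0 < bd x" unfolding b using rpos[OF that] et by (intro divide_pos_pos) auto
    have le: "bd x \<le> min 1 (r x / 6)" unfolding b using rpos[OF that] et
      by (subst divide_le_eq) (auto simp: mult_le_cancel_left1)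
    then show "bd x \<le> 1" "bd x \<le> r x / 6" by auto
    have "bd x * e = min 1 (r x / 6) / t" using e by (simp add: b)
    also have "\<dots> \<le> 1 / t" using t by (intro divide_right_mono) auto
    finally show "bd x * (1 + exp (2 / r x)) \<le> 1 / 2 ^ Suc (to_nat_on cut_params x)" by (simp add: e_def t_def)
  qed
  define P where "P x H \<longleftrightarrow> (case x of (\<omega>, a, b) \<Rightarrow> holes_budget H (bd x) \<and> (\<forall>(p, d)\<in>H. a \<le> Re (\<omega> * p) \<and> Re (\<omega> * p) \<le> b) \<and>
    (\<forall>K. compact K \<longrightarrow> K \<subseteq> ball 0 2 \<longrightarrow> holes_avoid H K \<longrightarrow>
      (\<exists>u\<in>HK K. \<forall>w\<in>K. (Re (\<omega> * w) \<le> a \<longrightarrow> u w = 1) \<and> (b \<le> Re (\<omega> * w) \<longrightarrow> u w = 0))))" for x H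
  have "\<exists>H. P x H" if x: "x \<in> cut_params" for x
  proof -
    obtain \<omega> a b where xe: "x = (\<omega>, a, b)" by (cases x)
    have "cmod \<omega> = 1" "a < b" using x by (auto simp: xe cut_params_def)
    from strip_cut[OF this bd(1,2)[OF x]] show ?thesis unfolding P_def by (simp only: xe prod.case)
  qed
  then obtain H where H: "\<And>x. x \<in> cut_params \<Longrightarrow> P x (H x)" by metis
  define HH where "HH = (\<Union>x\<in>cut_params. H x)"
  have near: "0 < d" "d \<le> bd x" "r x \<le> cmod p" if x: "x \<in> cut_params" and pd: "(p, d) \<in> H x" for x p d
  proof -
    obtain \<omega> a b where xe: "x = (\<omega>, a, b)" by (cases x)
    have hb: "holes_budget (H x) (bd x)" and p: "a \<le> Re (\<omega> * p)" "Re (\<omega> * p) \<le> b"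
      using H[OF x] pd unfolding P_def xe by auto
    show "0 < d" using hb pd unfolding holes_budget_def by force
    show "d \<le> bd x" using hb pd unfolding holes_budget_def by (auto dest!: spec[of _ "{(p, d)}"])
    have om: "cmod \<omega> = 1" "0 < a * b" using x by (auto simp: xe cut_params_def)
    have "r x \<le> \<bar>Re (\<omega> * p)\<bar>" using p om(2) by (auto simp: r_def xe zero_less_mult_iff)
    also have "\<dots> \<le> cmod (\<omega> * p)" by (rule abs_Re_le_cmod)
    finally show "r x \<le> cmod p" using om by (simp add: norm_mult)
  qed
  have "\<forall>(p, d)\<in>HH. 0 < d \<and> 6 * d \<le> cmod p"
    using near bd(3) unfolding HH_def by fastforce
  moreover have "sum hole_weight F \<le> 1" if F: "finite F" "F \<subseteq> HH" for F
  proof -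
    have "\<exists>x. x \<in> cut_params \<and> h \<in> H x" if "h \<in> F" for h using F(2) that unfolding HH_def by blast
    \<comment> \<open>A hole may serve several strips; \<open>c\<close> charges it to one of
      them.\<close>
    then obtain c where c: "\<And>h. h \<in> F \<Longrightarrow> c h \<in> cut_params \<and> h \<in> H (c h)" by metis
    have w: "hole_weight h \<le> snd h * (1 + exp (2 / r (c h)))" if "h \<in> F" for h
    proof -
      obtain p d where h: "h = (p, d)" by (cases h)
      have n: "0 < d" "r (c h) \<le> cmod p" "0 < r (c h)" using near[of "c h" p d] c[OF that] rpos[of "c h"] by (auto simp: h)
      then have "0 < cmod p" by linarith
      then have "2 / cmod p \<le> 2 / r (c h)" using n by (intro divide_left_mono mult_pos_pos) auto
      then show ?thesis using n by (simp add: hole_weight_def h)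
    qed
    have "sum hole_weight F \<le> (\<Sum>h\<in>F. snd h * (1 + exp (2 / r (c h))))" by (rule sum_mono[OF w])
    also have "\<dots> = (\<Sum>x\<in>c ` F. \<Sum>h\<in>{h\<in>F. c h = x}. snd h * (1 + exp (2 / r (c h))))"
      by (rule sum.image_gen[OF F(1)])
    also have "\<dots> \<le> (\<Sum>x\<in>c ` F. 1 / 2 ^ Suc (to_nat_on cut_params x))"
    proof (rule sum_mono)
      fix x assume "x \<in> c ` F"
      then have x: "x \<in> cut_params" using c by auto
      have "(\<Sum>h\<in>{h\<in>F. c h = x}. snd h * (1 + exp (2 / r (c h)))) = sum snd {h\<in>F. c h = x} * (1 + exp (2 / r x))"
        by (simp add: sum_distrib_right)
      also have "\<dots> \<le> bd x * (1 + exp (2 / r x))"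
      proof (rule mult_right_mono)
        have "holes_budget (H x) (bd x)" using H[OF x] by (auto simp: P_def split: prod.splits)
        moreover have "{h\<in>F. c h = x} \<subseteq> H x" using c by auto
        ultimately show "sum snd {h\<in>F. c h = x} \<le> bd x" using F(1) unfolding holes_budget_def by auto
      qed (simp add: add_nonneg_nonneg)
      also have "\<dots> \<le> 1 / 2 ^ Suc (to_nat_on cut_params x)" by (rule bd(4)[OF x])
      finally show "(\<Sum>h\<in>{h\<in>F. c h = x}. snd h * (1 + exp (2 / r (c h)))) \<le> 1 / 2 ^ Suc (to_nat_on cut_params x)" .
    qed
    also have "\<dots> = (\<Sum>n\<in>to_nat_on cut_params ` c ` F. (1/2) ^ Suc n)"
    proof -
      have "inj_on (to_nat_on cut_params) (c ` F)"
        using inj_on_to_nat_on[OF countable_cut_params] c by (meson image_subsetI inj_on_subset)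
      then show ?thesis by (simp add: sum.reindex power_divide)
    qed
    also have "\<dots> \<le> (\<Sum>n. (1/2) ^ Suc n)"
      using F(1) power_half_series by (intro sum_le_suminf) (auto simp: sums_iff)
    also have "\<dots> = 1" using power_half_series by (simp add: sums_iff)
    finally show ?thesis .
  qed
  moreover have "\<exists>u\<in>HK K. \<forall>w\<in>K. (Re (\<omega> * w) \<le> a \<longrightarrow> u w = 1) \<and> (b \<le> Re (\<omega> * w) \<longrightarrow> u w = 0)"
    if x: "(\<omega>, a, b) \<in> cut_params" and K: "compact K" "K \<subseteq> ball 0 2" "holes_avoid HH K" for \<omega> a b K
  proof -
    have "holes_avoid (H (\<omega>, a, b)) K" using K(3) x by (rule_tac holes_avoid_mono) (auto simp: HH_def)
    then show ?thesis using H[OF x] K(1,2) unfolding P_def by simp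
  qed
  then have "\<forall>(\<omega>, a, b)\<in>cut_params. \<forall>K. compact K \<longrightarrow> K \<subseteq> ball 0 2 \<longrightarrow> holes_avoid HH K \<longrightarrow>
       (\<exists>u\<in>HK K. \<forall>w\<in>K. (Re (\<omega> * w) \<le> a \<longrightarrow> u w = 1) \<and> (b \<le> Re (\<omega> * w) \<longrightarrow> u w = 0))"
    by (intro ballI) (simp add: split_beta)
  ultimately show ?thesis by (intro exI[of _ HH] conjI allI impI)
qed

section \<open>Green's formula and the essential singularity\<close>

text \<open>Note that \<open>E 0 = 1\<close>, as \<open>1 / 0 = 0\<close>.\<close>

definition E :: "complex \<Rightarrow> complex" where "E w = exp (1 / w)"

text \<open>\<open>rect_bd l u F\<close> is \<open>- \<i>\<close> times the integral of \<open>F\<close> along the boundary of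
  \<open>[l,u] \<times> [-1,1]\<close>.\<close>

definition rect_bd :: "real \<Rightarrow> real \<Rightarrow> (complex \<Rightarrow> complex) \<Rightarrow> complex"
  where "rect_bd l u F = integral {-1..1} (\<lambda>y. F (Complex u y) - F (Complex l y)) +
     \<i> * integral {l..u} (\<lambda>x. F (Complex x 1) - F (Complex x (-1)))"

section \<open>Boundary integrals over rectangles and the residue of w exp(1/w)\<close>

lemma continuous_on_Complex_left: "continuous_on A (\<lambda>x. Complex x y)"
  by (simp add: Complex_eq continuous_intros)

lemma continuous_on_Complex_right: "continuous_on A (\<lambda>y. Complex x y)"
  by (simp add: Complex_eq continuous_intros)

lemma continuous_on_edge:
  assumes "continuous_on S F"
  shows "(\<And>x. x \<in> A \<Longrightarrow> Complex x y \<in> S) \<Longrightarrow> continuous_on A (\<lambda>x. F (Complex x y))"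
    and "(\<And>y. y \<in> A \<Longrightarrow> Complex x y \<in> S) \<Longrightarrow> continuous_on A (\<lambda>y. F (Complex x y))"
  using assms by (auto intro!: continuous_on_compose2[OF assms] continuous_on_Complex_left continuous_on_Complex_right)

lemma contour_integral_linepath_horizontal:
  assumes "l < u"
  shows "contour_integral (linepath (Complex l y) (Complex u y)) F = integral {l..u} (\<lambda>x. F (Complex x y))"
proof -
  have "contour_integral (linepath (Complex l y) (Complex u y)) F =
      contour_integral (linepath (of_real l) (of_real u)) (\<lambda>w. F (w + \<i> * of_real y))"
    unfolding contour_integral_integral
    by (intro integral_cong) (simp add: linepath_def Complex_eq scaleR_conv_of_real algebra_simps)
  also have "\<dots> = integral {l..u} (\<lambda>x. F (of_real x + \<i> * of_real y))"
    using assms by (subst contour_integral_linepath_Reals_eq) auto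
  finally show ?thesis by (simp add: Complex_eq)
qed

lemma contour_integral_rectpath:
  assumes lu: "l < u" and cont: "continuous_on (path_image (rectpath (Complex l (-1)) (Complex u 1))) F"
  shows "contour_integral (rectpath (Complex l (-1)) (Complex u 1)) F = \<i> * rect_bd l u F"
proof -
  let ?P = "path_image (rectpath (Complex l (-1)) (Complex u 1))"
  have im: "?P = {z. Re z \<in> {l, u} \<and> Im z \<in> {-1..1}} \<union> {z. Im z \<in> {-1, 1} \<and> Re z \<in> {l..u}}"
    using lu by (subst path_image_rectpath) auto
  have seg: "closed_segment (Complex l (-1)) (Complex u (-1)) \<subseteq> ?P"
    "closed_segment (Complex u (-1)) (Complex u 1) \<subseteq> ?P"
    "closed_segment (Complex u 1) (Complex l 1) \<subseteq> ?P"
    "closed_segment (Complex l 1) (Complex l (-1)) \<subseteq> ?P"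
    by (simp_all add: rectpath_def Let_def path_image_join) blast+
  have ci: "F contour_integrable_on linepath a b" if "closed_segment a b \<subseteq> ?P" for a b
    using continuous_on_subset[OF cont that] by (rule contour_integrable_continuous_linepath)
  have rev: "contour_integral (linepath b a) F = - contour_integral (linepath a b) F" if "closed_segment a b \<subseteq> ?P" for a b
    using contour_integral_reverse_linepath[OF continuous_on_subset[OF cont that]] by simp
  have hor: "contour_integral (linepath (Complex l y) (Complex u y)) F = integral {l..u} (\<lambda>x. F (Complex x y))"
    for y by (rule contour_integral_linepath_horizontal[OF lu])
  have ver: "contour_integral (linepath (Complex x (-1)) (Complex x 1)) F = \<i> * integral {-1..1} (\<lambda>y. F (Complex x y))" for x
    by (subst contour_integral_linepath_same_Re[of _ x _ "-1" 1]) auto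
  have int: "(\<lambda>x. F (Complex x y)) integrable_on {l..u}" if "y \<in> {-1, 1}" for y
    using that by (intro integrable_continuous_real continuous_on_edge[OF cont]) (auto simp: im)
  have int2: "(\<lambda>y. F (Complex x y)) integrable_on {-1..1}" if "x \<in> {l, u}" for x
    using that by (intro integrable_continuous_real continuous_on_edge[OF cont]) (auto simp: im)
  have "contour_integral (rectpath (Complex l (-1)) (Complex u 1)) F =
      contour_integral (linepath (Complex l (-1)) (Complex u (-1))) F +
      (contour_integral (linepath (Complex u (-1)) (Complex u 1)) F +
      (contour_integral (linepath (Complex u 1) (Complex l 1)) F +
       contour_integral (linepath (Complex l 1) (Complex l (-1))) F))"
    unfolding rectpath_def Let_def complex.sel
    using seg by (subst contour_integral_join; simp add: ci contour_integrable_join)+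
  also have "\<dots> = integral {l..u} (\<lambda>x. F (Complex x (-1))) + (\<i> * integral {-1..1} (\<lambda>y. F (Complex u y)) +
      (- integral {l..u} (\<lambda>x. F (Complex x 1)) - \<i> * integral {-1..1} (\<lambda>y. F (Complex l y))))"
    using rev[of "Complex l 1" "Complex u 1"] rev[of "Complex l (-1)" "Complex l 1"] seg
    by (simp add: hor ver closed_segment_commute)
  also have "\<dots> = \<i> * rect_bd l u F"
    unfolding rect_bd_def by (simp add: integral_diff int int2 algebra_simps)
  finally show ?thesis .
qed

lemma rect_bd_split:
  assumes "l \<le> m" "m \<le> u" and h: "\<And>y. y \<in> {-1, 1} \<Longrightarrow> continuous_on {l..u} (\<lambda>x. F (Complex x y))"
    and v: "\<And>x. x \<in> {l, m, u} \<Longrightarrow> continuous_on {-1..1} (\<lambda>y. F (Complex x y))"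
  shows "rect_bd l u F = rect_bd l m F + rect_bd m u F"
proof -
  have int: "(\<lambda>y. F (Complex x y)) integrable_on {-1..1}" if "x \<in> {l, m, u}" for x
    using v[OF that] by (rule integrable_continuous_real)
  have "continuous_on {l..u} (\<lambda>x. F (Complex x 1) - F (Complex x (-1)))"
    using h by (intro continuous_intros) auto
  then have "(\<lambda>x. F (Complex x 1) - F (Complex x (-1))) integrable_on {l..u}"
    by (rule integrable_continuous_real)
  from Henstock_Kurzweil_Integration.integral_combine[OF assms(1,2) this, symmetric] show ?thesis
    unfolding rect_bd_def by (simp add: integral_diff int distrib_left)
qed

text \<open>Of the terms w (1/w)^i / i! only the one with i = 2 has a nonzero integral, so the
  residue at 0 is 1/2. The partial sums converge uniformly on the circle.\<close>

lemma contour_integral_circle_essential: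
  "contour_integral (circlepath 0 1) (\<lambda>w. w * E w) = of_real pi * \<i>"
proof -
  define f where "f n w = (\<Sum>i\<le>n. w * ((1 / w) ^ i / fact i))" for n :: nat and w :: complex
  define c where "c i = (if i = 2 then of_real pi * \<i> else 0)" for i :: nat
  have trm: "((\<lambda>w. w * ((1 / w) ^ i / fact i)) has_contour_integral c i) (circlepath 0 1)" for i
  proof -
    consider "i = 0" | "i = 1" | k where "i = Suc (Suc k)" by (metis One_nat_def not0_implies_Suc)
    then show ?thesis
    proof cases
      case 1
      have "((\<lambda>w. w) has_contour_integral 0) (circlepath 0 1)"
        by (rule Cauchy_theorem_convex_simple[of _ UNIV]) (auto intro: holomorphic_intros)
      then show ?thesis using 1 by (simp add: c_def)
    next
      case 2
      have "((\<lambda>w. 1) has_contour_integral 0) (circlepath 0 1)"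
        by (rule Cauchy_theorem_convex_simple[of _ UNIV]) (auto intro: holomorphic_intros)
      then have "((\<lambda>w. w * ((1 / w) ^ i / fact i)) has_contour_integral 0) (circlepath 0 1)"
        by (rule has_contour_integral_eq) (auto simp: 2)
      then show ?thesis using 2 by (simp add: c_def)
    next
      case 3
      have "((\<lambda>u. (1 / fact i) / (u - 0) ^ Suc k) has_contour_integral (2 * pi * \<i> / fact k * (deriv ^^ k) (\<lambda>u. 1 / fact i) 0)) (circlepath 0 1)"
        by (rule Cauchy_has_contour_integral_higher_derivative_circlepath) (auto intro: holomorphic_intros)
      then have "((\<lambda>w. w * ((1 / w) ^ i / fact i)) has_contour_integral (2 * pi * \<i> / fact k * (deriv ^^ k) (\<lambda>u. 1 / fact i) 0)) (circlepath 0 1)"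
      proof (rule has_contour_integral_eq)
        fix x :: complex assume "x \<in> path_image (circlepath 0 1)"
        then have "x \<noteq> 0" by auto
        then have "x * ((1 / x) ^ i) = 1 / x ^ Suc k" unfolding 3 by (simp add: divide_simps)
        then show "(1 / fact i) / (x - 0) ^ Suc k = x * ((1 / x) ^ i / fact i)"
          by (metis diff_zero mult.commute mult_1 times_divide_eq_left times_divide_eq_right)
      qed
      moreover have "2 * pi * \<i> / fact k * (deriv ^^ k) (\<lambda>u. 1 / fact i) 0 = c i"
        by (cases k) (auto simp: 3 c_def numeral_2_eq_2)
      ultimately show ?thesis by simp
    qed
  qed
  have hf: "(f n has_contour_integral (\<Sum>i\<le>n. c i)) (circlepath 0 1)" for n
    unfolding f_def by (intro has_contour_integral_sum trm) auto
  have "uniform_limit (sphere 0 1) f (\<lambda>w. w * E w) sequentially"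
  proof (rule uniform_limitI)
    fix e :: real assume "e > 0"
    have "(\<lambda>n. exp 1 / fact n) \<longlonglongrightarrow> (0::real)"
      using tendsto_mult_right[OF summable_LIMSEQ_zero[OF summable_exp[of "1::real"]], of "exp 1"] by (simp add: field_simps)
    then have "\<forall>\<^sub>F n in sequentially. exp 1 / fact n < e"
      using \<open>e > 0\<close> by (rule order_tendstoD)
    then show "\<forall>\<^sub>F n in sequentially. \<forall>w\<in>sphere 0 1. dist (f n w) (w * E w) < e"
    proof (rule eventually_mono, intro ballI)
      fix n w assume n: "exp 1 / fact n < e" and w: "w \<in> sphere (0::complex) 1"
      have "f n w = w * (\<Sum>i\<le>n. (1 / w) ^ i / fact i)" by (simp add: f_def sum_distrib_left)
      then have "dist (f n w) (w * E w) = cmod (w * (E w - (\<Sum>i\<le>n. (1 / w) ^ i / fact i)))"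
        by (simp add: dist_norm norm_minus_commute algebra_simps)
      also have "\<dots> = cmod (exp (1 / w) - (\<Sum>i\<le>n. (1 / w) ^ i / fact i))"
        using w by (simp add: norm_mult E_def)
      also have "\<dots> \<le> exp (norm (1 / w)) * (norm (1 / w) ^ Suc n) / fact n" by (rule Taylor_exp_field)
      also have "\<dots> = exp 1 / fact n" using w by (simp add: norm_divide)
      finally show "dist (f n w) (w * E w) < e" using n by linarith
    qed
  qed
  then have lim: "(\<lambda>n. contour_integral (circlepath 0 1) (f n)) \<longlonglongrightarrow> contour_integral (circlepath 0 1) (\<lambda>w. w * E w)"
    using hf by (intro contour_integral_uniform_limit_circlepath(2)) (auto simp: contour_integrable_on_def intro!: always_eventually)
  have ev: "\<forall>\<^sub>F n in sequentially. contour_integral (circlepath 0 1) (f n) = of_real pi * \<i>"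
  proof (rule eventually_sequentiallyI)
    fix n :: nat assume "2 \<le> n"
    then have "(\<Sum>i\<le>n. c i) = of_real pi * \<i>" by (simp add: c_def)
    then show "contour_integral (circlepath 0 1) (f n) = of_real pi * \<i>"
      using contour_integral_unique[OF hf[of n]] by simp
  qed
  show ?thesis by (rule LIMSEQ_unique[OF lim tendsto_eventually[OF ev]])
qed

lemma E_holomorphic: "0 \<notin> S \<Longrightarrow> E holomorphic_on S"
  unfolding E_def by (intro holomorphic_intros) auto

lemma cmod_E: "cmod (E w) = exp (Re (1 / w))"
  by (simp add: E_def)

lemma Re_inverse_le: "Re (1 / w) \<le> 1 / cmod w"
  using complex_Re_le_cmod[of "1 / w"] by (simp add: norm_divide)

lemma cmod_E_le: "cmod (E w) \<le> exp (1 / cmod w)"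
  unfolding cmod_E using Re_inverse_le by simp

lemma cmod_E_left:
  assumes "Re w \<le> 0" shows "cmod (E w) \<le> 1"
proof -
  have "Re (1 / w) \<le> 0" using assms by (simp add: Re_divide divide_nonpos_nonneg)
  then show ?thesis by (simp add: cmod_E)
qed

lemma cmod_E_imaginary: "Re w = 0 \<Longrightarrow> cmod (E w) = 1"
  by (simp add: cmod_E Re_divide)

text \<open>For Re w <= 0 the essential singularity is harmless: |E w| <= 1 there, and the factor w
  forces the limit 0. This fails when 0 is approached through the right half plane.\<close>

lemma continuous_on_left_half_plane: "continuous_on {w. Re w \<le> 0} (\<lambda>w. w * E w)"
  unfolding continuous_on_eq_continuous_within
proof
  fix w assume w: "w \<in> {w. Re w \<le> 0}"
  show "continuous (at w within {w. Re w \<le> 0}) (\<lambda>w. w * E w)"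
  proof (cases "w = 0")
    case True
    have "((\<lambda>w. w * E w) \<longlongrightarrow> 0) (at 0 within {w. Re w \<le> 0})"
    proof (rule Lim_null_comparison)
      show "\<forall>\<^sub>F x in at 0 within {w. Re w \<le> 0}. norm (x * E x) \<le> norm x"
        unfolding eventually_at_filter
        using cmod_E_left by (intro always_eventually) (auto simp: norm_mult mult_left_le)
      show "((\<lambda>x. norm x) \<longlongrightarrow> 0) (at (0::complex) within {w. Re w \<le> 0})"
        by (intro tendsto_norm_zero tendsto_ident_at)
    qed
    then show ?thesis using True by (simp add: continuous_within)
  next
    case False
    then have "isCont (\<lambda>w. w * E w) w" unfolding E_def by (intro continuous_intros) auto
    then show ?thesis by (rule continuous_at_imp_continuous_at_within)
  qed
qed

text \<open>The imaginary axis halves the square [-1,1] x [-1,1]. The residue gives \<pi> for the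
  whole square, and the left half contributes 0 by Cauchy's theorem, which tolerates the singular
  boundary point by continuity.\<close>

lemma rect_bd_essential: "rect_bd 0 1 (\<lambda>w. w * E w) = of_real pi"
proof -
  let ?F = "\<lambda>w. w * E w"
  have hol: "?F holomorphic_on - {0}" by (intro holomorphic_intros E_holomorphic) auto
  have c0: "continuous_on (- {0}) ?F" by (rule holomorphic_on_imp_continuous_on[OF hol])
  have im: "path_image (rectpath (Complex l (-1)) (Complex u 1)) =
      {z. Re z \<in> {l, u} \<and> Im z \<in> {-1..1}} \<union> {z. Im z \<in> {-1, 1} \<and> Re z \<in> {l..u}}" if "l \<le> u" for l u
    using that by (subst path_image_rectpath) auto
  have res: "residue ?F 0 = 1/2"
  proof -
    have "(?F has_contour_integral 2 * pi * \<i> * residue ?F 0) (circlepath 0 1)"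
      by (rule base_residue[of UNIV]) (auto intro: holomorphic_on_subset[OF hol])
    then have "2 * pi * \<i> * residue ?F 0 = of_real pi * \<i>"
      using contour_integral_unique contour_integral_circle_essential by metis
    then have "2 * residue ?F 0 = 1" by simp
    then show ?thesis by (metis nonzero_mult_div_cancel_left zero_neq_numeral)
  qed
  have big: "rect_bd (-1) 1 ?F = of_real pi"
  proof -
    let ?g = "rectpath (Complex (-1) (-1)) (Complex 1 1)"
    have "contour_integral ?g ?F = 2 * pi * \<i> * (\<Sum>p\<in>{0}. winding_number ?g p * residue ?F p)"
      by (rule Residue_theorem[of UNIV]) (auto intro: holomorphic_on_subset[OF hol] simp: im)
    also have "(\<Sum>p\<in>{0}. winding_number ?g p * residue ?F p) = 1/2"
      using winding_number_rectpath[of 0 "Complex (-1) (-1)" "Complex 1 1"]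
      by (simp add: in_box_complex_iff res)
    finally have "contour_integral ?g ?F = of_real pi * \<i>" by simp
    moreover have "contour_integral ?g ?F = \<i> * rect_bd (-1) 1 ?F"
      by (rule contour_integral_rectpath) (auto intro!: continuous_on_subset[OF c0] simp: im)
    ultimately show ?thesis by simp
  qed
  have left: "rect_bd (-1) 0 ?F = 0"
  proof -
    let ?g = "rectpath (Complex (-1) (-1)) (Complex 0 1)"
    have sub: "path_image ?g \<subseteq> {w. Re w \<le> 0}" by (auto simp: im)
    have int: "interior {w. Re w \<le> 0} = {w. Re w < 0}"
      using interior_halfspace_le[of "1::complex" 0] by (simp add: inner_complex_def)
    have "(?F has_contour_integral 0) ?g"
    proof (rule Cauchy_theorem_convex[OF continuous_on_left_half_plane convex_halfspace_Re_le finite.emptyI])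
      fix x assume "x \<in> interior {w. Re w \<le> 0} - {}"
      then have "x \<noteq> 0" by (auto simp: int)
      then show "?F field_differentiable at x"
        using hol by (metis Compl_iff holomorphic_on_imp_differentiable_at open_Compl closed_singleton singletonD)
    qed (use sub in auto)
    moreover have "contour_integral ?g ?F = \<i> * rect_bd (-1) 0 ?F"
      by (rule contour_integral_rectpath) (auto intro!: continuous_on_subset[OF continuous_on_left_half_plane sub])
    ultimately show ?thesis using contour_integral_unique by fastforce
  qed
  have "rect_bd (-1) 1 ?F = rect_bd (-1) 0 ?F + rect_bd 0 1 ?F"
  proof (rule rect_bd_split)
    show "continuous_on {-1..1} (\<lambda>x. ?F (Complex x y))" if "y \<in> {-1, 1}" for y
      using that by (intro continuous_on_edge[OF c0]) (auto simp: complex_eq_iff)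
    show "continuous_on {-1..1} (\<lambda>y. ?F (Complex x y))" if "x \<in> {-1, 0, 1}" for x
    proof (cases "x = 1")
      case True then show ?thesis by (intro continuous_on_edge[OF c0]) (auto simp: complex_eq_iff)
    next
      case False then show ?thesis using that by (intro continuous_on_edge[OF continuous_on_left_half_plane]) auto
    qed
  qed auto
  then show ?thesis using big left by simp
qed

section \<open>Continuously differentiable bumps around the holes\<close>

text \<open>A quadratic spline rising from 0 to 1, whose derivative is a tent of height 2 over
  [0, 1]. It is continuously differentiable, which is all that Green's formula asks for.\<close>

definition smooth_step :: "real \<Rightarrow> real"
  where "smooth_step s = 2 * ((max 0 s)\<^sup>2 - 2 * (max 0 (s - 1/2))\<^sup>2 + (max 0 (s - 1))\<^sup>2)"

definition smooth_step' :: "real \<Rightarrow> real"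
  where "smooth_step' s = 4 * (max 0 s - 2 * max 0 (s - 1/2) + max 0 (s - 1))"

lemma max_square_deriv: "((\<lambda>t. (max 0 t)\<^sup>2) has_real_derivative 2 * max 0 t) (at (t::real))"
proof -
  consider "t > 0" | "t < 0" | "t = 0" by linarith
  then show ?thesis
  proof cases
    case 1
    have "((\<lambda>t. t\<^sup>2) has_real_derivative 2 * t) (at t)" by (auto intro!: derivative_eq_intros)
    then have "((\<lambda>t. (max 0 t)\<^sup>2) has_real_derivative 2 * t) (at t)"
      by (rule has_field_derivative_transform_within_open[of _ _ _ "{0<..}"]) (use 1 in auto)
    then show ?thesis using 1 by simp
  next
    case 2
    have "((\<lambda>t. 0) has_real_derivative 0) (at t)" by simp
    then have "((\<lambda>t. (max 0 t)\<^sup>2) has_real_derivative 0) (at t)"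
      by (rule has_field_derivative_transform_within_open[of _ _ _ "{..<0}"]) (use 2 in auto)
    then show ?thesis using 2 by simp
  next
    case 3
    have "((\<lambda>h. ((max 0 (0 + h))\<^sup>2 - (max 0 0)\<^sup>2) / h) \<longlongrightarrow> 0) (at (0::real))"
    proof (rule Lim_null_comparison)
      have "norm (((max 0 (0 + h))\<^sup>2 - (max 0 0)\<^sup>2) / h) \<le> \<bar>h\<bar>" for h :: real
        by (cases "h > 0") (auto simp: power2_eq_square max_def)
      then show "\<forall>\<^sub>F h in at (0::real). norm (((max 0 (0 + h))\<^sup>2 - (max 0 0)\<^sup>2) / h) \<le> \<bar>h\<bar>" by simp
      show "((\<lambda>h. \<bar>h\<bar>) \<longlongrightarrow> 0) (at (0::real))" by (intro tendsto_rabs_zero tendsto_ident_at)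
    qed
    then show ?thesis using 3 by (simp add: DERIV_def)
  qed
qed

lemma smooth_step_deriv: "(smooth_step has_real_derivative smooth_step' s) (at s)"
proof -
  have sh: "((\<lambda>t. (max 0 (t - c))\<^sup>2) has_real_derivative 2 * max 0 (s - c)) (at s)" for c
  proof -
    have "((\<lambda>t. t - c) has_real_derivative 1) (at s)" by (auto intro!: derivative_eq_intros)
    then show ?thesis using DERIV_chain2[where f = "\<lambda>t. (max 0 t)\<^sup>2" and g = "\<lambda>t. t - c"] max_square_deriv by fastforce
  qed
  have "((\<lambda>s. 2 * ((max 0 (s - 0))\<^sup>2 - 2 * (max 0 (s - 1/2))\<^sup>2 + (max 0 (s - 1))\<^sup>2)) has_real_derivative
      2 * (2 * max 0 (s - 0) - 2 * (2 * max 0 (s - 1/2)) + 2 * max 0 (s - 1))) (at s)"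
    by (intro DERIV_cmult DERIV_add DERIV_diff sh)
  then show ?thesis by (simp add: smooth_step_def[abs_def] smooth_step'_def algebra_simps)
qed

lemma smooth_step_ge_1: "1 \<le> s \<Longrightarrow> smooth_step s = 1" "1 \<le> s \<Longrightarrow> smooth_step' s = 0"
  by (auto simp: smooth_step_def smooth_step'_def max_def power2_eq_square algebra_simps)

lemma smooth_step_le_0: "s \<le> 0 \<Longrightarrow> smooth_step s = 0" "s \<le> 0 \<Longrightarrow> smooth_step' s = 0"
  by (auto simp: smooth_step_def smooth_step'_def max_def)

lemma smooth_step_bounds: "0 \<le> smooth_step s" "smooth_step s \<le> 1" "\<bar>smooth_step' s\<bar> \<le> 2"
proof -
  consider "s \<le> 0" | "0 \<le> s" "s \<le> 1/2" | "1/2 \<le> s" "s \<le> 1" | "1 \<le> s" by linarith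
  then have "0 \<le> smooth_step s \<and> smooth_step s \<le> 1 \<and> \<bar>smooth_step' s\<bar> \<le> 2"
  proof cases
    case 2
    then have "smooth_step s = 2 * s\<^sup>2" "smooth_step' s = 4 * s" by (auto simp: smooth_step_def smooth_step'_def max_def)
    moreover have "s\<^sup>2 \<le> (1/2)\<^sup>2" using 2 by (intro power_mono) auto
    ultimately show ?thesis using 2 by (auto simp: power2_eq_square)
  next
    case 3
    then have "smooth_step s = 1 - 2 * (1 - s)\<^sup>2" "smooth_step' s = 4 * (1 - s)"
      by (auto simp: smooth_step_def smooth_step'_def max_def power2_eq_square algebra_simps)
    moreover have "(1 - s)\<^sup>2 \<le> (1/2)\<^sup>2" using 3 by (intro power_mono) auto
    ultimately show ?thesis using 3 by (auto simp: power2_eq_square)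
  qed (use smooth_step_le_0 smooth_step_ge_1 in auto)
  then show "0 \<le> smooth_step s" "smooth_step s \<le> 1" "\<bar>smooth_step' s\<bar> \<le> 2" by auto
qed

text \<open>Rises on [-2, -1], is 1 on [-1, 1] and falls on [1, 2]; wherever one factor varies, the
  other is constantly 1.\<close>

definition plateau :: "real \<Rightarrow> real" where "plateau t = smooth_step (2 - t) * smooth_step (2 + t)"

definition plateau' :: "real \<Rightarrow> real"
  where "plateau' t = smooth_step (2 - t) * smooth_step' (2 + t) - smooth_step' (2 - t) * smooth_step (2 + t)"

lemma plateau_deriv: "(plateau has_real_derivative plateau' t) (at t)"
proof -
  have a: "((\<lambda>t. smooth_step (2 - t)) has_real_derivative - smooth_step' (2 - t)) (at t)"
  proof -
    have "((\<lambda>t. 2 - t) has_real_derivative - 1) (at t)" by (auto intro!: derivative_eq_intros)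
    from DERIV_chain2[OF smooth_step_deriv this] show ?thesis by simp
  qed
  have b: "((\<lambda>t. smooth_step (2 + t)) has_real_derivative smooth_step' (2 + t)) (at t)"
  proof -
    have "((\<lambda>t. 2 + t) has_real_derivative 1) (at t)" by (auto intro!: derivative_eq_intros)
    from DERIV_chain2[OF smooth_step_deriv this] show ?thesis by simp
  qed
  show ?thesis unfolding plateau_def[abs_def] plateau'_def
    using DERIV_mult[OF a b] by (simp add: algebra_simps)
qed

lemma plateau_inner: "\<bar>t\<bar> \<le> 1 \<Longrightarrow> plateau t = 1" "\<bar>t\<bar> \<le> 1 \<Longrightarrow> plateau' t = 0"
  by (auto simp: plateau_def plateau'_def smooth_step_ge_1)

lemma plateau_outer: "2 \<le> \<bar>t\<bar> \<Longrightarrow> plateau t = 0" "2 \<le> \<bar>t\<bar> \<Longrightarrow> plateau' t = 0"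
  by (cases "t \<ge> 0"; simp add: plateau_def plateau'_def smooth_step_le_0)+

lemma plateau_bounds: "0 \<le> plateau t" "plateau t \<le> 1" "\<bar>plateau' t\<bar> \<le> 4"
proof -
  show "0 \<le> plateau t" "plateau t \<le> 1" unfolding plateau_def
    using smooth_step_bounds by (auto intro: mult_le_one)
  have "\<bar>plateau' t\<bar> \<le> \<bar>smooth_step (2 - t)\<bar> * \<bar>smooth_step' (2 + t)\<bar> + \<bar>smooth_step' (2 - t)\<bar> * \<bar>smooth_step (2 + t)\<bar>"
    unfolding plateau'_def abs_mult[symmetric] by (rule abs_triangle_ineq4)
  also have "\<dots> \<le> 1 * 2 + 2 * 1"
    using smooth_step_bounds by (intro add_mono mult_mono) auto
  finally show "\<bar>plateau' t\<bar> \<le> 4" by simp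
qed

lemma continuous_on_plateau: "continuous_on S plateau" "continuous_on S plateau'"
proof -
  have s: "continuous_on UNIV smooth_step"
    using smooth_step_deriv DERIV_isCont continuous_at_imp_continuous_on by blast
  have s': "continuous_on UNIV smooth_step'" unfolding smooth_step'_def by (intro continuous_intros)
  show "continuous_on S plateau" "continuous_on S plateau'" unfolding plateau_def plateau'_def
    by (intro continuous_intros continuous_on_compose2[OF s] continuous_on_compose2[OF s']; simp)+
qed

text \<open>It is 1 on the square of half-side d around the centre, which contains the hole, and 0
  off the square of half-side 2 d, which lies in the disc of radius 3 d since 2 sqrt 2 < 3.\<close>

definition bump :: "complex \<times> real \<Rightarrow> complex \<Rightarrow> real"
  where "bump h w = plateau (Re (w - fst h) / snd h) * plateau (Im (w - fst h) / snd h)"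

definition bump_x :: "complex \<times> real \<Rightarrow> complex \<Rightarrow> real"
  where "bump_x h w = plateau' (Re (w - fst h) / snd h) / snd h * plateau (Im (w - fst h) / snd h)"

definition bump_y :: "complex \<times> real \<Rightarrow> complex \<Rightarrow> real"
  where "bump_y h w = plateau (Re (w - fst h) / snd h) * (plateau' (Im (w - fst h) / snd h) / snd h)"

lemma bump_deriv: "(bump h has_derivative (\<lambda>k. Re k * bump_x h w + Im k * bump_y h w)) (at w)"
proof -
  have a: "((\<lambda>w. Re (w - fst h) / snd h) has_derivative (\<lambda>k. Re k / snd h)) (at w)"
    unfolding divide_inverse by (auto intro!: derivative_eq_intros)
  have b: "((\<lambda>w. Im (w - fst h) / snd h) has_derivative (\<lambda>k. Im k / snd h)) (at w)"
    unfolding divide_inverse by (auto intro!: derivative_eq_intros)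
  have "(bump h has_derivative (\<lambda>k. plateau (Re (w - fst h) / snd h) * (Im k / snd h * plateau' (Im (w - fst h) / snd h)) +
      Re k / snd h * plateau' (Re (w - fst h) / snd h) * plateau (Im (w - fst h) / snd h))) (at w)"
    unfolding bump_def[abs_def]
    by (intro has_derivative_mult DERIV_compose_FDERIV[OF plateau_deriv] a b)
  then show ?thesis by (rule has_derivative_eq_rhs) (simp add: fun_eq_iff bump_x_def bump_y_def mult_ac)
qed

lemma continuous_on_bump: "continuous_on S (bump_x h)" "continuous_on S (bump_y h)" "continuous_on S (bump h)"
proof -
  have c: "continuous_on S (\<lambda>w. Re (w - fst h) / snd h)" "continuous_on S (\<lambda>w. Im (w - fst h) / snd h)"
    by (auto simp: divide_inverse intro!: continuous_intros)
  show "continuous_on S (bump_x h)" "continuous_on S (bump_y h)" "continuous_on S (bump h)"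
    unfolding bump_x_def bump_y_def bump_def divide_inverse[of "plateau' _"]
    by (intro continuous_intros continuous_on_compose2[OF continuous_on_plateau(1)[of UNIV]]
        continuous_on_compose2[OF continuous_on_plateau(2)[of UNIV]] c; simp)+
qed

lemma bump_bounds: "0 \<le> bump h w" "bump h w \<le> 1"
  unfolding bump_def using plateau_bounds by (auto intro: mult_le_one)

lemma bump_in_hole:
  assumes "snd h > 0" "w \<in> ball (fst h) (snd h)"
  shows "bump h w = 1" "bump_x h w = 0" "bump_y h w = 0"
proof -
  have "\<bar>Re (w - fst h)\<bar> \<le> snd h" "\<bar>Im (w - fst h)\<bar> \<le> snd h"
    using assms abs_Re_le_cmod[of "w - fst h"] abs_Im_le_cmod[of "w - fst h"]
    by (auto simp: dist_norm norm_minus_commute)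
  then have "\<bar>Re (w - fst h) / snd h\<bar> \<le> 1" "\<bar>Im (w - fst h) / snd h\<bar> \<le> 1"
    using assms(1) by (auto simp: abs_divide)
  then show "bump h w = 1" "bump_x h w = 0" "bump_y h w = 0"
    by (simp_all add: bump_def bump_x_def bump_y_def plateau_inner)
qed

lemma bump_far:
  assumes "snd h > 0" "3 * snd h < dist (fst h) w"
  shows "bump h w = 0" "bump_x h w = 0" "bump_y h w = 0"
proof -
  have "2 * snd h \<le> \<bar>Re (w - fst h)\<bar> \<or> 2 * snd h \<le> \<bar>Im (w - fst h)\<bar>"
  proof (rule ccontr)
    assume "\<not> ?thesis"
    then have "\<bar>Re (w - fst h)\<bar> \<le> \<bar>2 * snd h\<bar>" "\<bar>Im (w - fst h)\<bar> \<le> \<bar>2 * snd h\<bar>" by linarith+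
    then have "(Re (w - fst h))\<^sup>2 \<le> (2 * snd h)\<^sup>2" "(Im (w - fst h))\<^sup>2 \<le> (2 * snd h)\<^sup>2"
      unfolding abs_le_square_iff by blast+
    then have "(cmod (w - fst h))\<^sup>2 \<le> 8 * (snd h)\<^sup>2" unfolding cmod_power2 by (simp add: power_mult_distrib)
    moreover have "(3 * snd h)\<^sup>2 < (cmod (w - fst h))\<^sup>2"
      using assms by (intro power_strict_mono) (auto simp: dist_norm norm_minus_commute)
    ultimately show False using assms(1) by (simp add: power_mult_distrib) (smt (verit) zero_less_power)
  qed
  then have "2 \<le> \<bar>Re (w - fst h) / snd h\<bar> \<or> 2 \<le> \<bar>Im (w - fst h) / snd h\<bar>"
    using assms(1) by (simp add: abs_divide le_divide_eq)
  then show "bump h w = 0" "bump_x h w = 0" "bump_y h w = 0"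
    by (auto simp: bump_def bump_x_def bump_y_def plateau_outer)
qed

text \<open>The square supporting the bump enters as a product of indicators of two intervals, so
  that the bound can be integrated one variable at a time.\<close>

lemma bump_grad_bound:
  assumes "snd h > 0"
  shows "\<bar>bump_x h w\<bar> + \<bar>bump_y h w\<bar> \<le> 8 / snd h *
     (indicator {Re (fst h) - 2 * snd h..Re (fst h) + 2 * snd h} (Re w) *
      indicator {Im (fst h) - 2 * snd h..Im (fst h) + 2 * snd h} (Im w))"
proof -
  define s t where "s = Re (w - fst h) / snd h" and "t = Im (w - fst h) / snd h"
  have st: "\<bar>s\<bar> \<le> 2 \<longleftrightarrow> Re w \<in> {Re (fst h) - 2 * snd h..Re (fst h) + 2 * snd h}"
    "\<bar>t\<bar> \<le> 2 \<longleftrightarrow> Im w \<in> {Im (fst h) - 2 * snd h..Im (fst h) + 2 * snd h}"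
    using assms by (auto simp: s_def t_def abs_divide divide_le_eq abs_le_iff)
  have "\<bar>bump_x h w\<bar> \<le> 4 / snd h * 1" "\<bar>bump_y h w\<bar> \<le> 1 * (4 / snd h)"
    unfolding bump_x_def bump_y_def abs_mult abs_divide
    using assms plateau_bounds by (intro mult_mono divide_right_mono; simp)+
  moreover have "bump_x h w = 0 \<and> bump_y h w = 0" if "\<not> (\<bar>s\<bar> \<le> 2 \<and> \<bar>t\<bar> \<le> 2)"
    using that plateau_outer[of s] plateau_outer[of t]
    by (auto simp: bump_x_def bump_y_def s_def t_def)
  ultimately show ?thesis unfolding st by (auto simp: indicator_def split: if_splits)
qed

text \<open>The product form copes with overlapping holes: in each hole of \<open>J\<close> the
  function vanishes together with its partial derivatives, whatever the other factors do.\<close>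

definition hole_cut :: "(complex \<times> real) set \<Rightarrow> complex \<Rightarrow> real"
  where "hole_cut J w = (\<Prod>h\<in>J. 1 - bump h w)"

definition hole_cut_x :: "(complex \<times> real) set \<Rightarrow> complex \<Rightarrow> real"
  where "hole_cut_x J w = (\<Sum>h\<in>J. - bump_x h w * (\<Prod>k\<in>J - {h}. 1 - bump k w))"

definition hole_cut_y :: "(complex \<times> real) set \<Rightarrow> complex \<Rightarrow> real"
  where "hole_cut_y J w = (\<Sum>h\<in>J. - bump_y h w * (\<Prod>k\<in>J - {h}. 1 - bump k w))"

lemma hole_cut_deriv:
  "(hole_cut J has_derivative (\<lambda>k. Re k * hole_cut_x J w + Im k * hole_cut_y J w)) (at w)"
proof -
  have "((\<lambda>w. 1 - bump h w) has_derivative (\<lambda>k. - (Re k * bump_x h w + Im k * bump_y h w))) (at w)" for h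
    using has_derivative_diff[OF has_derivative_const bump_deriv[of h w]] by simp
  then have "(hole_cut J has_derivative (\<lambda>k. \<Sum>h\<in>J. - (Re k * bump_x h w + Im k * bump_y h w) * (\<Prod>j\<in>J - {h}. 1 - bump j w))) (at w)"
    unfolding hole_cut_def[abs_def] by (intro has_derivative_prod)
  then show ?thesis
    by (rule has_derivative_eq_rhs)
      (simp add: fun_eq_iff hole_cut_x_def hole_cut_y_def sum_distrib_left sum.distrib[symmetric] algebra_simps)
qed

lemma continuous_on_hole_cut: "continuous_on S (hole_cut_x J)" "continuous_on S (hole_cut_y J)" "continuous_on S (hole_cut J)"
  unfolding hole_cut_x_def hole_cut_y_def hole_cut_def
  by (intro continuous_intros continuous_on_bump)+

lemma hole_cut_bounds: "0 \<le> hole_cut J w" "hole_cut J w \<le> 1"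
  unfolding hole_cut_def using bump_bounds by (auto intro!: prod_nonneg prod_le_1)

lemma hole_cut_in_hole:
  assumes "finite J" "h \<in> J" "snd h > 0" "w \<in> ball (fst h) (snd h)"
  shows "hole_cut J w = 0" "hole_cut_x J w = 0" "hole_cut_y J w = 0"
proof -
  have z: "(\<Prod>k\<in>J - {g}. 1 - bump k w) = 0" if "g \<noteq> h" for g
    using assms that bump_in_hole(1)[OF assms(3,4)] by (intro prod_zero) (auto intro!: bexI[of _ h])
  show "hole_cut J w = 0" unfolding hole_cut_def
    using assms bump_in_hole(1)[OF assms(3,4)] by (intro prod_zero) (auto intro!: bexI[of _ h])
  show "hole_cut_x J w = 0" "hole_cut_y J w = 0" unfolding hole_cut_x_def hole_cut_y_def
    using z bump_in_hole(2,3)[OF assms(3,4)] by (intro sum.neutral; metis mult_zero_left mult_zero_right minus_zero)+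
qed

text \<open>Green's formula; the integrand on the right is twice the Wirtinger derivative of \<open>G\<close> by the conjugate variable.\<close>

lemma rect_bd_Green:
  fixes G Gx Gy :: "complex \<Rightarrow> complex"
  assumes der: "\<And>w. w \<in> Q \<Longrightarrow> (G has_derivative (\<lambda>k. of_real (Re k) * Gx w + of_real (Im k) * Gy w)) (at w)"
    and cx: "\<And>w. w \<in> Q \<Longrightarrow> isCont Gx w" and cy: "\<And>w. w \<in> Q \<Longrightarrow> isCont Gy w"
  shows "rect_bd 0 1 G = integral {-1..1} (\<lambda>y. integral {0..1} (\<lambda>x. Gx (Complex x y) + \<i> * Gy (Complex x y)))"
proof -
  have Qc: "Complex x y \<in> Q" if "x \<in> {0..1}" "y \<in> {-1..1}" for x y using that by (auto simp: Q_def)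
  have cQ: "continuous_on Q Gx" "continuous_on Q Gy" using cx cy by (auto intro: continuous_at_imp_continuous_on)
  have cc: "continuous_on A (\<lambda>(x, y). Complex x y)" "continuous_on A (\<lambda>(y, x). Complex x y)" for A
    by (simp_all add: Complex_eq split_beta continuous_intros)
  have c2: "continuous_on ({0..1} \<times> {-1..1}) (\<lambda>(x, y). Gy (Complex x y))"
    using continuous_on_compose2[OF cQ(2) cc(1)[of "{0..1} \<times> {-1..1}"]] Qc
    by (auto simp: split_beta image_subset_iff)
  have c3: "continuous_on ({-1..1} \<times> {0..1}) (\<lambda>(y, x). Gx (Complex x y))"
    "continuous_on ({-1..1} \<times> {0..1}) (\<lambda>(y, x). Gy (Complex x y))"
    using continuous_on_compose2[OF cQ(1) cc(2)[of "{-1..1} \<times> {0..1}"]]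
      continuous_on_compose2[OF cQ(2) cc(2)[of "{-1..1} \<times> {0..1}"]] Qc
    by (auto simp: split_beta image_subset_iff)
  have hx: "integral {0..1} (\<lambda>x. Gx (Complex x y)) = G (Complex 1 y) - G (Complex 0 y)" if y: "y \<in> {-1..1}" for y
  proof (intro integral_unique fundamental_theorem_of_calculus)
    fix x :: real assume x: "x \<in> {0..1}"
    have "((\<lambda>x. Complex x y) has_derivative of_real) (at x within {0..1})"
      unfolding Complex_eq by (auto intro!: derivative_eq_intros)
    from has_derivative_compose[OF this der[OF Qc[OF x y]]]
    show "((\<lambda>x. G (Complex x y)) has_vector_derivative Gx (Complex x y)) (at x within {0..1})"
      by (simp add: has_vector_derivative_def scaleR_conv_of_real)
  qed auto
  have hy: "integral {-1..1} (\<lambda>y. Gy (Complex x y)) = G (Complex x 1) - G (Complex x (-1))" if x: "x \<in> {0..1}" for x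
  proof (intro integral_unique fundamental_theorem_of_calculus)
    fix y :: real assume y: "y \<in> {-1..1}"
    have "((\<lambda>y. Complex x y) has_derivative (\<lambda>t. \<i> * of_real t)) (at y within {-1..1})"
      unfolding Complex_eq by (auto intro!: derivative_eq_intros)
    from has_derivative_compose[OF this der[OF Qc[OF x y]]]
    show "((\<lambda>y. G (Complex x y)) has_vector_derivative Gy (Complex x y)) (at y within {-1..1})"
      by (simp add: has_vector_derivative_def scaleR_conv_of_real)
  qed auto
  have i1: "(\<lambda>x. Gx (Complex x y)) integrable_on {0..1}" "(\<lambda>x. \<i> * Gy (Complex x y)) integrable_on {0..1}"
    "(\<lambda>x. Gy (Complex x y)) integrable_on {0..1}" if "y \<in> {-1..1}" for y
    using that Qc by (auto intro!: integrable_continuous_real continuous_intros continuous_on_edge[OF cQ(1)] continuous_on_edge[OF cQ(2)])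
  have o: "(\<lambda>y. integral {0..1} (\<lambda>x. Gx (Complex x y))) integrable_on {-1..1}"
    "(\<lambda>y. integral {0..1} (\<lambda>x. Gy (Complex x y))) integrable_on {-1..1}"
    using integral_continuous_on_param[of "{-1..1}" 0 1 "\<lambda>y x. Gx (Complex x y)"] c3(1)
      integral_continuous_on_param[of "{-1..1}" 0 1 "\<lambda>y x. Gy (Complex x y)"] c3(2)
    by (auto intro!: integrable_continuous_real)
  have "integral {-1..1} (\<lambda>y. integral {0..1} (\<lambda>x. Gx (Complex x y) + \<i> * Gy (Complex x y))) =
      integral {-1..1} (\<lambda>y. integral {0..1} (\<lambda>x. Gx (Complex x y)) + \<i> * integral {0..1} (\<lambda>x. Gy (Complex x y)))"
    by (intro integral_cong) (subst integral_add; simp add: i1)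
  also have "\<dots> = integral {-1..1} (\<lambda>y. integral {0..1} (\<lambda>x. Gx (Complex x y))) +
      \<i> * integral {-1..1} (\<lambda>y. integral {0..1} (\<lambda>x. Gy (Complex x y)))"
    using o by (simp add: integral_add integrable_on_cmult_left)
  also have "integral {-1..1} (\<lambda>y. integral {0..1} (\<lambda>x. Gy (Complex x y))) =
      integral {0..1} (\<lambda>x. integral {-1..1} (\<lambda>y. Gy (Complex x y)))"
    using integral_swap_continuous[of 0 "-1" 1 1 "\<lambda>x y. Gy (Complex x y)"] c2
    by (simp add: cbox_Pair_eq)
  also have "\<dots> = integral {0..1} (\<lambda>x. G (Complex x 1) - G (Complex x (-1)))"
    by (intro integral_cong hy)
  also have "integral {-1..1} (\<lambda>y. integral {0..1} (\<lambda>x. Gx (Complex x y))) =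
      integral {-1..1} (\<lambda>y. G (Complex 1 y) - G (Complex 0 y))"
    by (intro integral_cong hx)
  finally show ?thesis unfolding rect_bd_def by simp
qed

section \<open>Estimates for area and boundary integrals\<close>

lemma integral_indicator_le:
  fixes a b l u :: real
  assumes "a \<le> b"
  shows "indicat_real {a..b} integrable_on {l..u}" "integral {l..u} (indicat_real {a..b}) \<le> b - a"
proof -
  have m: "{a..b} \<inter> {l..u} \<in> lmeasurable" by (simp add: Int_atLeastAtMost)
  then show "indicat_real {a..b} integrable_on {l..u}" by (simp add: integrable_on_indicator)
  have "integral {l..u} (indicat_real {a..b}) = measure lebesgue ({a..b} \<inter> {l..u})"
    using m by (rule integral_indicator)
  also have "\<dots> \<le> measure lebesgue {a..b}" by (intro measure_mono_fmeasurable) auto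
  also have "\<dots> = b - a" using assms by simp
  finally show "integral {l..u} (indicat_real {a..b}) \<le> b - a" .
qed

text \<open>Each summand is integrated separately in x and then in y, where a side of its square
  contributes at most \<open>d h\<close>; parts of the square outside the domain only help.\<close>

lemma iterated_integral_bound:
  fixes f :: "real \<Rightarrow> real \<Rightarrow> complex" and c :: "'h \<Rightarrow> real"
  assumes J: "finite J" and cont: "continuous_on ({l..u} \<times> {a..b}) (\<lambda>(y, x). f y x)"
    and le: "\<And>x y. x \<in> {a..b} \<Longrightarrow> y \<in> {l..u} \<Longrightarrow>
      cmod (f y x) \<le> (\<Sum>h\<in>J. c h * (indicator {p h..p h + d h} x * indicator {q h..q h + d h} y))"
    and c: "\<And>h. h \<in> J \<Longrightarrow> 0 \<le> c h" and d: "\<And>h. h \<in> J \<Longrightarrow> 0 \<le> d h"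
  shows "cmod (integral {l..u} (\<lambda>y. integral {a..b} (f y))) \<le> (\<Sum>h\<in>J. c h * d h * d h)"
proof -
  define I where "I h = integral {a..b} (indicat_real {p h..p h + d h})" for h
  have I: "indicat_real {p h..p h + d h} integrable_on {a..b}" "0 \<le> I h" "I h \<le> d h" if "h \<in> J" for h
    using integral_indicator_le[of "p h" "p h + d h" a b] d[OF that] unfolding I_def by (auto intro: integral_nonneg)
  have hi: "((\<lambda>x. \<Sum>h\<in>J. c h * (indicator {p h..p h + d h} x * indicator {q h..q h + d h} y)) has_integral
      (\<Sum>h\<in>J. c h * (I h * indicator {q h..q h + d h} y))) {a..b}" for y
    unfolding I_def by (intro has_integral_sum[OF J] has_integral_mult_right has_integral_mult_left integrable_integral I(1))
  have inner: "cmod (integral {a..b} (f y)) \<le> (\<Sum>h\<in>J. c h * (I h * indicator {q h..q h + d h} y))" if y: "y \<in> {l..u}" for y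
  proof -
    have "continuous_on {a..b} (\<lambda>x. (y, x))" by (intro continuous_on_Pair continuous_on_const continuous_on_id)
    then have "continuous_on {a..b} (f y)"
      using continuous_on_compose2[OF cont, of "{a..b}" "\<lambda>x. (y, x)"] y by (auto simp: image_subset_iff)
    then have "f y integrable_on {a..b}" by (rule integrable_continuous_real)
    then have "cmod (integral {a..b} (f y)) \<le> integral {a..b} (\<lambda>x. \<Sum>h\<in>J. c h * (indicator {p h..p h + d h} x * indicator {q h..q h + d h} y))"
      using hi[of y] le[OF _ y] by (intro integral_norm_bound_integral) (auto simp: has_integral_integrable)
    then show ?thesis using integral_unique[OF hi[of y]] by simp
  qed
  define I' where "I' h = integral {l..u} (indicat_real {q h..q h + d h})" for h
  have I': "indicat_real {q h..q h + d h} integrable_on {l..u}" "0 \<le> I' h" "I' h \<le> d h" if "h \<in> J" for h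
    using integral_indicator_le[of "q h" "q h + d h" l u] d[OF that] unfolding I'_def by (auto intro: integral_nonneg)
  have ho: "((\<lambda>y. \<Sum>h\<in>J. c h * (I h * indicator {q h..q h + d h} y)) has_integral (\<Sum>h\<in>J. c h * (I h * I' h))) {l..u}"
    unfolding I'_def by (intro has_integral_sum[OF J] has_integral_mult_right integrable_integral I'(1))
  have "continuous_on {l..u} (\<lambda>y. integral {a..b} (f y))"
    using integral_continuous_on_param[of "{l..u}" a b f] cont by simp
  then have "cmod (integral {l..u} (\<lambda>y. integral {a..b} (f y))) \<le> integral {l..u} (\<lambda>y. \<Sum>h\<in>J. c h * (I h * indicator {q h..q h + d h} y))"
    using inner ho by (intro integral_norm_bound_integral) (auto simp: has_integral_integrable intro: integrable_continuous_real)
  also have "\<dots> = (\<Sum>h\<in>J. c h * (I h * I' h))" by (rule integral_unique[OF ho])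
  also have "\<dots> \<le> (\<Sum>h\<in>J. c h * (d h * d h))"
    using I I' c d by (intro sum_mono mult_left_mono mult_mono) auto
  finally show ?thesis by (simp add: mult_ac)
qed

text \<open>The factor 6 is the perimeter of \<open>Q\<close>. Only boundary points enter, and these
  satisfy Re w = 0 or |w| >= 1, which is where |E w| <= exp 1.\<close>

lemma rect_bd_diff_le:
  assumes G: "continuous_on Q G"
    and Fh: "\<And>y. y \<in> {-1, 1} \<Longrightarrow> continuous_on {0..1} (\<lambda>x. F (Complex x y))"
    and Fv: "\<And>x. x \<in> {0, 1} \<Longrightarrow> continuous_on {-1..1} (\<lambda>y. F (Complex x y))"
    and le: "\<And>w. w \<in> Q \<Longrightarrow> Re w = 0 \<or> 1 \<le> cmod w \<Longrightarrow> cmod (G w - F w) \<le> c"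
  shows "cmod (rect_bd 0 1 G - rect_bd 0 1 F) \<le> 6 * c"
proof -
  have Gh: "continuous_on {0..1} (\<lambda>x. G (Complex x y))" if "y \<in> {-1, 1}" for y
    using that by (intro continuous_on_edge[OF G]) (auto simp: Q_def)
  have Gv: "continuous_on {-1..1} (\<lambda>y. G (Complex x y))" if "x \<in> {0, 1}" for x
    using that by (intro continuous_on_edge[OF G]) (auto simp: Q_def)
  define u where "u y = (G (Complex 1 y) - G (Complex 0 y)) - (F (Complex 1 y) - F (Complex 0 y))" for y
  define v where "v x = (G (Complex x 1) - G (Complex x (-1))) - (F (Complex x 1) - F (Complex x (-1)))" for x
  have cu: "continuous_on {-1..1} u" and cv: "continuous_on {0..1} v"
    unfolding u_def v_def by (intro continuous_intros Gv Gh Fv Fh; simp)+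
  have int: "(\<lambda>y. G (Complex 1 y) - G (Complex 0 y)) integrable_on {-1..1}"
    "(\<lambda>y. F (Complex 1 y) - F (Complex 0 y)) integrable_on {-1..1}"
    "(\<lambda>x. G (Complex x 1) - G (Complex x (-1))) integrable_on {0..1}"
    "(\<lambda>x. F (Complex x 1) - F (Complex x (-1))) integrable_on {0..1}"
    by (intro integrable_continuous_real continuous_intros Gv Gh Fv Fh; simp)+
  have "rect_bd 0 1 G - rect_bd 0 1 F = integral {-1..1} u + \<i> * integral {0..1} v"
  proof -
    have "integral {-1..1} u = integral {-1..1} (\<lambda>y. G (Complex 1 y) - G (Complex 0 y)) - integral {-1..1} (\<lambda>y. F (Complex 1 y) - F (Complex 0 y))"
      unfolding u_def by (rule integral_diff[OF int(1,2)])
    moreover have "integral {0..1} v = integral {0..1} (\<lambda>x. G (Complex x 1) - G (Complex x (-1))) - integral {0..1} (\<lambda>x. F (Complex x 1) - F (Complex x (-1)))"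
      unfolding v_def by (rule integral_diff[OF int(3,4)])
    ultimately show ?thesis unfolding rect_bd_def by (simp add: right_diff_distrib)
  qed
  also have "cmod \<dots> \<le> cmod (integral {-1..1} u) + cmod (integral {0..1} v)"
    using norm_triangle_ineq[of "integral {-1..1} u" "\<i> * integral {0..1} v"] by (simp add: norm_mult)
  also have "\<dots> \<le> (2 * c) * (1 - (-1)) + (2 * c) * (1 - 0)"
  proof (intro add_mono integral_bound cu cv)
    have m: "1 \<le> cmod (Complex 1 y)" for y using complex_Re_le_cmod[of "Complex 1 y"] by simp
    show "norm (u y) \<le> 2 * c" if "y \<in> {-1..1}" for y
    proof -
      have "u y = (G (Complex 1 y) - F (Complex 1 y)) - (G (Complex 0 y) - F (Complex 0 y))" by (simp add: u_def)
      also have "cmod \<dots> \<le> cmod (G (Complex 1 y) - F (Complex 1 y)) + cmod (G (Complex 0 y) - F (Complex 0 y))"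
        by (rule norm_triangle_ineq4)
      also have "\<dots> \<le> c + c" using that m by (intro add_mono le) (auto simp: Q_def)
      finally show ?thesis by simp
    qed
    have n: "1 \<le> cmod (Complex x 1)" "1 \<le> cmod (Complex x (-1))" for x
      using abs_Im_le_cmod[of "Complex x 1"] abs_Im_le_cmod[of "Complex x (-1)"] by simp_all
    show "norm (v x) \<le> 2 * c" if "x \<in> {0..1}" for x
    proof -
      have "v x = (G (Complex x 1) - F (Complex x 1)) - (G (Complex x (-1)) - F (Complex x (-1)))" by (simp add: v_def)
      also have "cmod \<dots> \<le> cmod (G (Complex x 1) - F (Complex x 1)) + cmod (G (Complex x (-1)) - F (Complex x (-1)))"
        by (rule norm_triangle_ineq4)
      also have "\<dots> \<le> c + c" using that n by (intro add_mono le) (auto simp: Q_def)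
      finally show ?thesis by simp
    qed
  qed auto
  finally show ?thesis by simp
qed

text \<open>Glue \<open>a\<close> outside the holes to \<open>F = w E w\<close> inside them by means of a partition of unity and
  apply Green's formula: since \<open>a - F\<close> is small, both the area integral and the change of the
  boundary integral are small, contradicting \<open>rect_bd 0 1 F = \<pi>\<close>.\<close>

theorem E_not_approximable:
  assumes H: "\<forall>(p, d)\<in>H. 0 < d \<and> 6 * d \<le> cmod p"
    and weight: "\<And>F. finite F \<Longrightarrow> F \<subseteq> H \<Longrightarrow> sum hole_weight F \<le> 1"
    and a: "a \<in> hol_germs (Q - (\<Union>(p, d)\<in>H. ball p d))"
  shows "\<not> (\<forall>w\<in>Q - (\<Union>(p, d)\<in>H. ball p d). cmod (a w - w * E w) \<le> (1/200) * (cmod (E w) + 1))"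
proof
  define K where "K = Q - (\<Union>(p, d)\<in>H. ball p d)"
  define F where "F w = w * E w" for w
  assume "\<forall>w\<in>Q - (\<Union>(p, d)\<in>H. ball p d). cmod (a w - w * E w) \<le> (1/200) * (cmod (E w) + 1)"
  then have bd: "cmod (a w - F w) \<le> (1/200) * (cmod (E w) + 1)" if "w \<in> K" for w
    using that unfolding K_def F_def by blast
  have Hh: "0 < snd h" "6 * snd h \<le> cmod (fst h)" if "h \<in> H" for h using H that by force+
  obtain U where U: "open U" "K \<subseteq> U" "a holomorphic_on U" using a unfolding hol_germs_def K_def by auto
  have K0: "0 \<in> K" using Hh by (fastforce simp: K_def Q_def dist_norm)
  have E0: "E 0 = 1" by (simp add: E_def)
  have a0: "cmod (a 0) \<le> 2 / 200" using bd[OF K0] by (simp add: F_def E0)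
  have Fhol: "F holomorphic_on - {0}" unfolding F_def by (intro holomorphic_intros E_holomorphic) auto
  have o0: "open (- {0::complex})" by (simp add: open_Compl)
  \<comment> \<open>\<open>E\<close> is not continuous at 0, so a neighbourhood of 0 is treated by
    hand: \<open>a\<close> is close to \<open>a 0\<close>, where |a 0| <= 2/200 because E 0 = 1, and
    |F w| <= |E w| / 200 because |w| <= 1/200.\<close>
  obtain \<rho> where \<rho>: "\<rho> > 0" "ball 0 \<rho> \<subseteq> U" "\<And>w. w \<in> ball 0 \<rho> \<Longrightarrow> cmod (a w - F w) \<le> 3/200 * (cmod (E w) + 1)"
  proof -
    have "continuous_on U a" using U(3) by (rule holomorphic_on_imp_continuous_on)
    then have "isCont a 0" using U K0 continuous_on_eq_continuous_at by blast
    then obtain r where r: "r > 0" "\<And>w. dist w 0 < r \<Longrightarrow> dist (a w) (a 0) < 1/200"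
      unfolding continuous_at_eps_delta by (meson zero_less_divide_1_iff zero_less_numeral)
    obtain r' where r': "r' > 0" "ball 0 r' \<subseteq> U" using U K0 open_contains_ball by blast
    show ?thesis
    proof (rule that[of "min (min r r') (1/200)"])
      fix w :: complex assume w: "w \<in> ball 0 (min (min r r') (1/200))"
      then have 1: "cmod (a w - a 0) < 1/200" using r(2)[of w] by (simp add: dist_norm)
      have "cmod w \<le> 1/200" using w by simp
      then have "cmod (F w) \<le> (1/200) * cmod (E w)" unfolding F_def norm_mult by (rule mult_right_mono) simp
      then have "cmod (a w - F w) \<le> 3/200 + (1/200) * cmod (E w)"
        using 1 a0 norm_triangle_ineq4[of "a w" "F w"] norm_triangle_ineq[of "a w - a 0" "a 0"] by simp
      then show "cmod (a w - F w) \<le> 3/200 * (cmod (E w) + 1)" using norm_ge_zero[of "E w"] by argo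
    qed (use r(1) r' in auto)
  qed
  \<comment> \<open>Relaxing 1/200 to 3/200 gives an open condition satisfied on \<open>K\<close>
    minus 0. What remains of \<open>Q\<close> outside \<open>V\<close> and the disc around 0 is
    compact and covered by finitely many holes.\<close>
  define V where "V = {w \<in> U - {0}. cmod (a w - F w) < 3/200 * (cmod (E w) + 1)}"
  have Vo: "open V"
  proof -
    have "continuous_on (U - {0}) (\<lambda>w. cmod (a w - F w) - 3/200 * (cmod (E w) + 1))"
      by (intro continuous_intros holomorphic_on_imp_continuous_on holomorphic_on_subset[OF U(3)]
          holomorphic_on_subset[OF Fhol] E_holomorphic) auto
    from continuous_open_preimage[OF this, of "{..<0}"] show ?thesis
      using U(1) unfolding V_def by (simp add: vimage_def Int_def open_delete)
  qed
  have "compact (Q - (ball 0 \<rho> \<union> V))" using compact_Q Vo by (intro compact_diff) auto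
  moreover have cov: "Q - (ball 0 \<rho> \<union> V) \<subseteq> (\<Union>h\<in>H. ball (fst h) (snd h))"
  proof
    fix w assume w: "w \<in> Q - (ball 0 \<rho> \<union> V)"
    show "w \<in> (\<Union>h\<in>H. ball (fst h) (snd h))"
    proof (rule ccontr)
      assume "\<not> ?thesis"
      then have "w \<in> K" using w unfolding K_def by force
      moreover have "w \<noteq> 0" using w \<rho>(1) by auto
      moreover have "cmod (a w - F w) < 3/200 * (cmod (E w) + 1)" using bd[OF \<open>w \<in> K\<close>] norm_ge_zero[of "E w"] by argo
      ultimately have "w \<in> V" using U(2) by (auto simp: V_def)
      then show False using w by blast
    qed
  qed
  ultimately obtain J where J: "J \<subseteq> H" "finite J" "Q - (ball 0 \<rho> \<union> V) \<subseteq> (\<Union>h\<in>J. ball (fst h) (snd h))"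
    using compactE_image[of "Q - (ball 0 \<rho> \<union> V)" H "\<lambda>h. ball (fst h) (snd h)"] by (metis open_ball)
  have alt: "(\<exists>h\<in>J. w \<in> ball (fst h) (snd h)) \<or> w \<in> U \<and> cmod (a w - F w) \<le> 3/200 * (cmod (E w) + 1)"
    if w: "w \<in> Q" for w
  proof (cases "w \<in> ball 0 \<rho>")
    case True then show ?thesis using \<rho> by blast
  next
    case False then show ?thesis using J(3) w unfolding V_def by fastforce
  qed
  have Jh: "0 < snd h" "6 * snd h \<le> cmod (fst h)" if "h \<in> J" for h using Hh[of h] J(1) that by blast+
  define G where "G w = of_real (hole_cut J w) * a w + (1 - of_real (hole_cut J w)) * F w" for w
  define S where "S w = of_real (hole_cut J w) * deriv a w + (1 - of_real (hole_cut J w)) * deriv F w" for w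
  define Gx where "Gx w = of_real (hole_cut_x J w) * (a w - F w) + S w" for w
  define Gy where "Gy w = of_real (hole_cut_y J w) * (a w - F w) + \<i> * S w" for w
  \<comment> \<open>Where G agrees locally with a holomorphic function, the formal derivatives
    \<open>Gx\<close> and \<open>Gy\<close> are the true ones. This settles the points inside holes,
    where only \<open>F\<close> is available, and the point 0, where only \<open>a\<close>
    is.\<close>
  have loc: "(G has_derivative (\<lambda>k. of_real (Re k) * Gx w + of_real (Im k) * Gy w)) (at w) \<and> isCont Gx w \<and> isCont Gy w"
    if W: "open W" "w \<in> W" and f: "f holomorphic_on W"
      and eq: "\<And>z. z \<in> W \<Longrightarrow> G z = f z \<and> Gx z = deriv f z \<and> Gy z = \<i> * deriv f z" for w W f
  proof (intro conjI)
    have "(f has_derivative (*) (deriv f w)) (at w)"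
      using holomorphic_derivI[OF f W] by (simp add: has_field_derivative_def)
    then have "(G has_derivative (*) (deriv f w)) (at w)"
      by (rule has_derivative_transform_within_open[OF _ W]) (use eq in auto)
    then show "(G has_derivative (\<lambda>k. of_real (Re k) * Gx w + of_real (Im k) * Gy w)) (at w)"
    proof (rule has_derivative_eq_rhs)
      have "deriv f w * k = of_real (Re k) * deriv f w + of_real (Im k) * (\<i> * deriv f w)" for k
        by (subst complex_eq[of k]) (simp add: algebra_simps)
      then show "(*) (deriv f w) = (\<lambda>k. of_real (Re k) * Gx w + of_real (Im k) * Gy w)"
        using eq[OF W(2)] by (simp add: fun_eq_iff)
    qed
    have c: "continuous_on W (deriv f)" using f W(1) by (intro holomorphic_on_imp_continuous_on holomorphic_deriv)
    have "continuous_on W Gx" using c by (rule continuous_on_eq) (use eq in auto)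
    then show "isCont Gx w" using W continuous_on_eq_continuous_at by blast
    have "continuous_on W (\<lambda>z. \<i> * deriv f z)" using c by (intro continuous_intros)
    then have "continuous_on W Gy" by (rule continuous_on_eq) (use eq in auto)
    then show "isCont Gy w" using W continuous_on_eq_continuous_at by blast
  qed
  have main: "(G has_derivative (\<lambda>k. of_real (Re k) * Gx w + of_real (Im k) * Gy w)) (at w) \<and> isCont Gx w \<and> isCont Gy w"
    if w: "w \<in> Q" for w
  proof -
    consider h where "h \<in> J" "w \<in> ball (fst h) (snd h)" | "w = 0" | "w \<noteq> 0" "w \<in> U"
      using alt[OF w] by blast
    then show ?thesis
    proof cases
      case 1
      have "0 \<notin> ball (fst h) (snd h)" using Jh[OF 1(1)] by (auto simp: dist_norm)
      then have "F holomorphic_on ball (fst h) (snd h)" by (intro holomorphic_on_subset[OF Fhol]) auto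
      then show ?thesis
        by (rule loc[OF open_ball 1(2)])
          (use hole_cut_in_hole[OF J(2) 1(1) Jh(1)[OF 1(1)]] in \<open>auto simp: G_def Gx_def Gy_def S_def\<close>)
    next
      case 2
      \<comment> \<open>Within this radius all bumps of \<open>J\<close> vanish: |z| < |p|/2 and 3 d
        <= |p|/2 put z outside the disc of radius 3 d around p.\<close>
      define r where "r = Min (insert \<rho> ((\<lambda>h. cmod (fst h) / 2) ` J))"
      have r: "r > 0" "r \<le> \<rho>" "\<And>h. h \<in> J \<Longrightarrow> r \<le> cmod (fst h) / 2"
      proof -
        have "0 < cmod (fst h) / 2" if "h \<in> J" for h using Jh[OF that] by linarith
        then show "r > 0" using J(2) \<rho>(1) unfolding r_def by (subst Min_gr_iff) auto
        show "r \<le> \<rho>" using J(2) unfolding r_def by (intro Min_le) auto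
        show "r \<le> cmod (fst h) / 2" if "h \<in> J" for h using J(2) that unfolding r_def by (intro Min_le) auto
      qed
      have far: "bump h z = 0" "bump_x h z = 0" "bump_y h z = 0" if z: "z \<in> ball 0 r" and h: "h \<in> J" for z h
      proof -
        have "cmod (fst h) \<le> dist (fst h) z + cmod z" using norm_triangle_ineq[of "fst h - z" z] by (simp add: dist_norm)
        then have "3 * snd h < dist (fst h) z" using z r(3)[OF h] Jh(2)[OF h] by auto
        then show "bump h z = 0" "bump_x h z = 0" "bump_y h z = 0" using bump_far[OF Jh(1)[OF h]] by auto
      qed
      have "a holomorphic_on ball 0 r" using r(2) \<rho>(2) by (intro holomorphic_on_subset[OF U(3)]) auto
      moreover have "w \<in> ball 0 r" using 2 r(1) by simp
      ultimately show ?thesis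
        by (intro loc[OF open_ball])
          (auto simp: G_def Gx_def Gy_def S_def hole_cut_def hole_cut_x_def hole_cut_y_def far)
    next
      case 3
      define W where "W = U - {0}"
      have W: "open W" "w \<in> W" using 3 U(1) by (auto simp: W_def open_delete)
      have ah: "a holomorphic_on W" and Fh: "F holomorphic_on W"
        by (auto simp: W_def intro: holomorphic_on_subset[OF U(3)] holomorphic_on_subset[OF Fhol])
      have da: "(a has_derivative (*) (deriv a w)) (at w)" and dF: "(F has_derivative (*) (deriv F w)) (at w)"
        using holomorphic_derivI[OF ah W] holomorphic_derivI[OF Fh W] by (simp_all add: has_field_derivative_def)
      have dc: "((\<lambda>z. complex_of_real (hole_cut J z)) has_derivative
          (\<lambda>k. of_real (Re k * hole_cut_x J w + Im k * hole_cut_y J w))) (at w)"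
        by (rule has_derivative_of_real[OF hole_cut_deriv])
      have "(G has_derivative (\<lambda>k. of_real (hole_cut J w) * (deriv a w * k) +
          of_real (Re k * hole_cut_x J w + Im k * hole_cut_y J w) * a w +
          ((1 - of_real (hole_cut J w)) * (deriv F w * k) +
          (0 - of_real (Re k * hole_cut_x J w + Im k * hole_cut_y J w)) * F w))) (at w)"
        unfolding G_def[abs_def]
        by (intro has_derivative_add has_derivative_mult has_derivative_diff has_derivative_const da dF dc)
      then have "(G has_derivative (\<lambda>k. of_real (Re k) * Gx w + of_real (Im k) * Gy w)) (at w)"
      proof (rule has_derivative_eq_rhs, intro ext)
        fix k
        have k: "c * k = of_real (Re k) * c + of_real (Im k) * (\<i> * c)" for c
          by (subst complex_eq[of k]) (simp add: algebra_simps)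
        show "of_real (hole_cut J w) * (deriv a w * k) +
          of_real (Re k * hole_cut_x J w + Im k * hole_cut_y J w) * a w +
          ((1 - of_real (hole_cut J w)) * (deriv F w * k) +
          (0 - of_real (Re k * hole_cut_x J w + Im k * hole_cut_y J w)) * F w) =
          of_real (Re k) * Gx w + of_real (Im k) * Gy w"
          unfolding k[of "deriv a w"] k[of "deriv F w"] Gx_def Gy_def S_def by (simp add: algebra_simps)
      qed
      moreover have "continuous_on W Gx" "continuous_on W Gy"
        unfolding Gx_def Gy_def S_def using W(1) ah Fh
        by (intro continuous_intros continuous_on_hole_cut holomorphic_on_imp_continuous_on holomorphic_deriv; simp)+
      then have "isCont Gx w" "isCont Gy w" using W continuous_on_eq_continuous_at by blast+
      ultimately show ?thesis by blast
    qed
  qed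
  have green: "rect_bd 0 1 G = integral {-1..1} (\<lambda>y. integral {0..1} (\<lambda>x. Gx (Complex x y) + \<i> * Gy (Complex x y)))"
    by (rule rect_bd_Green) (use main in auto)
  have sum_eq: "Gx w + \<i> * Gy w = (of_real (hole_cut_x J w) + \<i> * of_real (hole_cut_y J w)) * (a w - F w)" for w
    by (simp add: Gx_def Gy_def algebra_simps)
  \<comment> \<open>24/200 is the 8 of \<open>bump_grad_bound\<close> times the 3/200 for the
    closeness of \<open>a\<close> and \<open>F\<close>. Over a square of side 4 d it amounts to
    384/200 times the weight of the hole.\<close>
  define c where "c h = 24/200 / snd h * (1 + exp (2 / cmod (fst h)))" for h :: "complex \<times> real"
  have c0: "0 \<le> c h" if "h \<in> J" for h using Jh(1)[OF that] by (simp add: c_def add_nonneg_nonneg)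
  have area: "cmod (rect_bd 0 1 G) \<le> (\<Sum>h\<in>J. c h * (4 * snd h) * (4 * snd h))"
    unfolding green
  proof (rule iterated_integral_bound[OF J(2), where p = "\<lambda>h. Re (fst h) - 2 * snd h" and q = "\<lambda>h. Im (fst h) - 2 * snd h"])
    have cQ: "continuous_on Q (\<lambda>w. Gx w + \<i> * Gy w)"
      using main by (intro continuous_intros continuous_at_imp_continuous_on) auto
    have "continuous_on ({-1..1} \<times> {0..1}) (\<lambda>(y, x). Complex x y)"
      by (simp add: Complex_eq split_beta continuous_intros)
    moreover have "(\<lambda>(y, x). Complex x y) ` ({-1..1} \<times> {0..1}) \<subseteq> Q" by (auto simp: Q_def)
    ultimately have "continuous_on ({-1..1} \<times> {0..1}) (\<lambda>z. Gx (case z of (y, x) \<Rightarrow> Complex x y) + \<i> * Gy (case z of (y, x) \<Rightarrow> Complex x y))"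
      by (rule continuous_on_compose2[OF cQ])
    then show "continuous_on ({-1..1} \<times> {0..1}) (\<lambda>(y, x). Gx (Complex x y) + \<i> * Gy (Complex x y))"
      by (simp add: split_beta)
    fix x y :: real assume xy: "x \<in> {0..1}" "y \<in> {-1..1}"
    define w where "w = Complex x y"
    have wQ: "w \<in> Q" using xy by (auto simp: w_def Q_def)
    have sgn: "cmod (of_real (hole_cut_x J w) + \<i> * of_real (hole_cut_y J w)) \<le>
        (\<Sum>h\<in>J. (\<bar>bump_x h w\<bar> + \<bar>bump_y h w\<bar>) * (\<Prod>k\<in>J - {h}. 1 - bump k w))"
    proof -
      have "cmod (of_real (hole_cut_x J w) + \<i> * of_real (hole_cut_y J w)) \<le> \<bar>hole_cut_x J w\<bar> + \<bar>hole_cut_y J w\<bar>"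
        using norm_triangle_ineq[of "of_real (hole_cut_x J w)" "\<i> * of_real (hole_cut_y J w)"] by (simp add: norm_mult)
      also have "\<dots> \<le> (\<Sum>h\<in>J. \<bar>- bump_x h w * (\<Prod>k\<in>J - {h}. 1 - bump k w)\<bar>) + (\<Sum>h\<in>J. \<bar>- bump_y h w * (\<Prod>k\<in>J - {h}. 1 - bump k w)\<bar>)"
        unfolding hole_cut_x_def hole_cut_y_def by (intro add_mono sum_abs)
      also have "\<dots> = (\<Sum>h\<in>J. (\<bar>bump_x h w\<bar> + \<bar>bump_y h w\<bar>) * (\<Prod>k\<in>J - {h}. 1 - bump k w))"
      proof -
        have "\<bar>\<Prod>k\<in>J - {h}. 1 - bump k w\<bar> = (\<Prod>k\<in>J - {h}. 1 - bump k w)" for h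
          using bump_bounds by (intro abs_of_nonneg prod_nonneg) auto
        then show ?thesis by (simp add: abs_mult sum.distrib[symmetric] distrib_right)
      qed
      finally show ?thesis .
    qed
    have "cmod (Gx w + \<i> * Gy w) \<le> (\<Sum>h\<in>J. (\<bar>bump_x h w\<bar> + \<bar>bump_y h w\<bar>) * (\<Prod>k\<in>J - {h}. 1 - bump k w)) * cmod (a w - F w)"
      unfolding sum_eq norm_mult by (intro mult_right_mono sgn) auto
    also have "\<dots> = (\<Sum>h\<in>J. (\<bar>bump_x h w\<bar> + \<bar>bump_y h w\<bar>) * (\<Prod>k\<in>J - {h}. 1 - bump k w) * cmod (a w - F w))"
      by (simp add: sum_distrib_right)
    also have "\<dots> \<le> (\<Sum>h\<in>J. c h * (indicator {Re (fst h) - 2 * snd h..Re (fst h) - 2 * snd h + 4 * snd h} x *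
        indicator {Im (fst h) - 2 * snd h..Im (fst h) - 2 * snd h + 4 * snd h} y))"
    proof (rule sum_mono)
      fix h assume h: "h \<in> J"
      define I where "I = (indicator {Re (fst h) - 2 * snd h..Re (fst h) + 2 * snd h} x *
        indicator {Im (fst h) - 2 * snd h..Im (fst h) + 2 * snd h} y :: real)"
      define P where "P = (\<Prod>k\<in>J - {h}. 1 - bump k w)"
      define b where "b = \<bar>bump_x h w\<bar> + \<bar>bump_y h w\<bar>"
      have P: "0 \<le> P" "P \<le> 1" unfolding P_def using bump_bounds by (auto intro!: prod_nonneg prod_le_1)
      have b: "0 \<le> b" "b \<le> 8 / snd h * I" using bump_grad_bound[OF Jh(1)[OF h], of w] by (auto simp: b_def I_def w_def)
      have "b * P * cmod (a w - F w) \<le> c h * I"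
      proof (cases "b = 0 \<or> P = 0")
        case True
        then show ?thesis using c0[OF h] by (auto simp: I_def)
      next
        case False
        have nh: "w \<notin> ball (fst k) (snd k)" if k: "k \<in> J" for k
        proof
          assume w: "w \<in> ball (fst k) (snd k)"
          show False
          proof (cases "k = h")
            case True
            then show False using False bump_in_hole[OF Jh(1)[OF h]] w by (auto simp: b_def)
          next
            case kh: False
            have "P = 0" unfolding P_def using J(2) k kh bump_in_hole(1)[OF Jh(1)[OF k] w]
              by (intro prod_zero) (auto intro!: bexI[of _ k])
            then show False using False by blast
          qed
        qed
        then have d: "cmod (a w - F w) \<le> 3/200 * (cmod (E w) + 1)" using alt[OF wQ] by blast
        \<comment> \<open>A point where the gradient does not vanish is within 3 d <= |p|/2 of the
          centre p, so |w| >= |p|/2. This is the origin of the exponent 2/|p| in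
          \<open>hole_weight\<close> and of the condition 6 d <= |p|.\<close>
        have "\<not> 3 * snd h < dist (fst h) w" using False bump_far[OF Jh(1)[OF h], of w] by (auto simp: b_def)
        then have "cmod (fst h) / 2 \<le> cmod w"
          using Jh(2)[OF h] norm_triangle_ineq[of "fst h - w" w] by (simp add: dist_norm)
        moreover have "0 < cmod (fst h) / 2" using Jh[OF h] by linarith
        ultimately have "1 / cmod w \<le> 1 / (cmod (fst h) / 2)" by (intro divide_left_mono mult_pos_pos) auto
        then have "cmod (E w) \<le> exp (2 / cmod (fst h))" using cmod_E_le[of w] by (simp add: order_trans)
        then have d': "cmod (a w - F w) \<le> 3/200 * (1 + exp (2 / cmod (fst h)))" using d by argo
        have "b * P * cmod (a w - F w) \<le> (8 / snd h * I * 1) * (3/200 * (1 + exp (2 / cmod (fst h))))"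
          using b P d' Jh(1)[OF h] by (intro mult_mono) (auto simp: I_def)
        also have "\<dots> = c h * I" by (simp add: c_def)
        finally show ?thesis .
      qed
      then show "(\<bar>bump_x h w\<bar> + \<bar>bump_y h w\<bar>) * (\<Prod>k\<in>J - {h}. 1 - bump k w) * cmod (a w - F w) \<le>
         c h * (indicator {Re (fst h) - 2 * snd h..Re (fst h) - 2 * snd h + 4 * snd h} x *
        indicator {Im (fst h) - 2 * snd h..Im (fst h) - 2 * snd h + 4 * snd h} y)"
        unfolding b_def P_def I_def by (simp add: algebra_simps)
    qed
    finally show "cmod (Gx (Complex x y) + \<i> * Gy (Complex x y)) \<le> (\<Sum>h\<in>J. c h * (indicator {Re (fst h) - 2 * snd h..Re (fst h) - 2 * snd h + 4 * snd h} x *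
        indicator {Im (fst h) - 2 * snd h..Im (fst h) - 2 * snd h + 4 * snd h} y))"
      unfolding w_def .
  qed (use c0 Jh in \<open>auto simp: less_imp_le\<close>)
  also have "\<dots> = (\<Sum>h\<in>J. 384/200 * hole_weight h)"
  proof (rule sum.cong)
    fix h assume "h \<in> J"
    then have "snd h \<noteq> 0" using Jh(1)[of h] by simp
    then show "c h * (4 * snd h) * (4 * snd h) = 384/200 * hole_weight h" by (simp add: c_def hole_weight_def)
  qed simp
  also have "\<dots> = 384/200 * sum hole_weight J" by (simp add: sum_distrib_left)
  also have "\<dots> \<le> 384/200 * 1" using weight[OF J(2,1)] by (intro mult_left_mono) auto
  finally have 1: "cmod (rect_bd 0 1 G) \<le> 384/200" by simp
  \<comment> \<open>12/200 = 3/200 * (3 + 1), as |E w| <= exp 1 <= 3 on the boundary.\<close>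
  have 2: "cmod (rect_bd 0 1 G - rect_bd 0 1 F) \<le> 6 * (12/200)"
  proof (rule rect_bd_diff_le)
    show "continuous_on Q G"
      using main by (intro continuous_at_imp_continuous_on ballI has_derivative_continuous) auto
    have cF: "continuous_on (- {0}) F" by (rule holomorphic_on_imp_continuous_on[OF Fhol])
    show "continuous_on {0..1} (\<lambda>x. F (Complex x y))" if "y \<in> {-1, 1}" for y
      using that by (intro continuous_on_edge[OF cF]) (auto simp: complex_eq_iff)
    show "continuous_on {-1..1} (\<lambda>y. F (Complex x y))" if "x \<in> {0, 1}" for x
    proof (cases "x = 1")
      case True then show ?thesis by (intro continuous_on_edge[OF cF]) (auto simp: complex_eq_iff)
    next
      case False
      then show ?thesis using that unfolding F_def by (intro continuous_on_edge[OF continuous_on_left_half_plane]) auto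
    qed
    fix w assume w: "w \<in> Q" "Re w = 0 \<or> 1 \<le> cmod w"
    have "cmod (E w) \<le> exp 1"
    proof (cases "Re w = 0")
      case True then show ?thesis by (simp add: cmod_E_imaginary)
    next
      case False
      then have "1 / cmod w \<le> 1" using w(2) by (simp add: divide_le_eq_1)
      then show ?thesis using cmod_E_le[of w] by (meson exp_le_cancel_iff order_trans)
    qed
    then have Ew: "cmod (E w) \<le> 3" using exp_le by linarith
    have "G w - F w = of_real (hole_cut J w) * (a w - F w)" by (simp add: G_def algebra_simps)
    then have e: "cmod (G w - F w) = hole_cut J w * cmod (a w - F w)" using hole_cut_bounds[of J w] by (simp add: norm_mult)
    show "cmod (G w - F w) \<le> 12/200"
    proof (cases "\<exists>h\<in>J. w \<in> ball (fst h) (snd h)")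
      case True
      then show ?thesis using e hole_cut_in_hole(1)[OF J(2)] Jh(1) by auto
    next
      case False
      then have "cmod (a w - F w) \<le> 12/200" using alt[OF w(1)] Ew by argo
      then have "hole_cut J w * cmod (a w - F w) \<le> 1 * (12/200)"
        using hole_cut_bounds by (intro mult_mono) auto
      then show ?thesis using e by simp
    qed
  qed
  have "pi \<le> cmod (rect_bd 0 1 F)" using rect_bd_essential unfolding F_def by simp
  \<comment> \<open>The right-hand side is 456/200 < 3; the tolerance 1/200 is small enough for
    that.\<close>
  then have "pi \<le> 384/200 + 6 * (12/200)"
    using 1 2 norm_triangle_ineq2[of "rect_bd 0 1 F" "rect_bd 0 1 G"] by (simp add: norm_minus_commute)
  then show False using pi_gt3 by simp
qed

section \<open>Adjoining roots of cut-off functions\<close>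

text \<open>The family has to be countable because products of its members will receive roots, and
  every root is a coordinate of a point of type \<open>nat \<Rightarrow> complex\<close>.\<close>

definition local_cuts :: "complex set \<Rightarrow> (complex \<Rightarrow> complex) set \<Rightarrow> bool"
  where "local_cuts K U \<longleftrightarrow> countable U \<and> U \<subseteq> HK K \<and>
    (\<forall>w\<in>K. \<forall>r>0. \<exists>u\<in>U. \<exists>s>0. (\<forall>z\<in>K. dist z w < s \<longrightarrow> u z = 1) \<and> (\<forall>z\<in>K. r \<le> dist z w \<longrightarrow> u z = 0))"

text \<open>Just above x there is always an interval on one side of 0, as \<open>cut_params\<close>
  demands: below 0 if x is negative, above 0 otherwise. In particular strips are available
  arbitrarily close to the axes, and so for cut-offs at 0.\<close>

lemma rational_interval_above:
  fixes x r :: real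
  assumes "0 < r"
  shows "\<exists>a b. a \<in> \<rat> \<and> b \<in> \<rat> \<and> x < a \<and> a < b \<and> b < x + r \<and> 0 < a * b"
proof (cases "0 \<le> x")
  case True
  obtain a where a: "a \<in> \<rat>" "x < a" "a < x + r" using Rats_dense_in_real[of x "x + r"] assms by auto
  obtain b where b: "b \<in> \<rat>" "a < b" "b < x + r" using Rats_dense_in_real[OF a(3)] by auto
  show ?thesis using a b True by (intro exI[of _ a] exI[of _ b]) (auto intro: mult_pos_pos)
next
  case False
  obtain a where a: "a \<in> \<rat>" "x < a" "a < min (x + r) 0" using Rats_dense_in_real[of x "min (x + r) 0"] assms False by auto
  obtain b where b: "b \<in> \<rat>" "a < b" "b < min (x + r) 0" using Rats_dense_in_real[OF a(3)] by auto
  show ?thesis using a b by (intro exI[of _ a] exI[of _ b]) (auto intro: mult_neg_neg)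
qed

lemma rational_interval_below:
  fixes x r :: real
  assumes "0 < r"
  shows "\<exists>a b. a \<in> \<rat> \<and> b \<in> \<rat> \<and> x - r < a \<and> a < b \<and> b < x \<and> 0 < a * b"
proof -
  obtain a b where "a \<in> \<rat>" "b \<in> \<rat>" "- x < a" "a < b" "b < - x + r" "0 < a * b"
    using rational_interval_above[OF assms, of "- x"] by blast
  then show ?thesis by (intro exI[of _ "- b"] exI[of _ "- a"]) (auto simp: mult.commute)
qed

theorem planar_cheese_exists:
  "\<exists>K U. compact K \<and> K \<subseteq> {w. 0 \<le> Re w} \<and> 0 \<in> K \<and> local_cuts K U \<and>
    (\<forall>a\<in>hol_germs K. \<not> (\<forall>w\<in>K. cmod (a w - w * E w) \<le> (1/200) * (cmod (E w) + 1)))"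
proof -
  obtain H where H1: "\<forall>(p, d)\<in>H. 0 < d \<and> 6 * d \<le> cmod p"
    and H2: "\<forall>F. finite F \<longrightarrow> F \<subseteq> H \<longrightarrow> sum hole_weight F \<le> 1"
    and H3: "\<forall>(\<omega>, a, b)\<in>cut_params. \<forall>K. compact K \<longrightarrow> K \<subseteq> ball 0 2 \<longrightarrow> holes_avoid H K \<longrightarrow>
       (\<exists>u\<in>HK K. \<forall>w\<in>K. (Re (\<omega> * w) \<le> a \<longrightarrow> u w = 1) \<and> (b \<le> Re (\<omega> * w) \<longrightarrow> u w = 0))"
    using swiss_cheese_exists by (elim exE conjE)
  define K where "K = Q - (\<Union>(p, d)\<in>H. ball p d)"
  have K: "compact K" unfolding K_def using compact_Q by (intro compact_diff open_UN) auto
  have KQ: "K \<subseteq> Q" by (auto simp: K_def)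
  have Kb: "K \<subseteq> ball 0 2" using KQ Q_subset_ball by blast
  have av: "holes_avoid H K" unfolding holes_avoid_def K_def by fast
  have K0: "0 \<in> K" using H1 by (fastforce simp: K_def Q_def dist_norm)
  have alg: "function_algebra K (HK K)" by (rule function_algebra_HK[OF K])
  have "\<exists>u\<in>HK K. \<forall>w\<in>K. (Re (fst x * w) \<le> fst (snd x) \<longrightarrow> u w = 1) \<and> (snd (snd x) \<le> Re (fst x * w) \<longrightarrow> u w = 0)"
    if x: "x \<in> cut_params" for x
    using H3[rule_format, OF x] K Kb av by (simp add: split_beta)
  then obtain u where u: "\<And>x. x \<in> cut_params \<Longrightarrow> u x \<in> HK K"
    "\<And>x w. x \<in> cut_params \<Longrightarrow> w \<in> K \<Longrightarrow> Re (fst x * w) \<le> fst (snd x) \<Longrightarrow> u x w = 1"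
    "\<And>x w. x \<in> cut_params \<Longrightarrow> w \<in> K \<Longrightarrow> snd (snd x) \<le> Re (fst x * w) \<Longrightarrow> u x w = 0" by metis
  \<comment> \<open>Four strips fence in a rectangle: \<open>x1\<close> and \<open>x2\<close> cut
    off from below and from above in Re w, \<open>x3\<close> and \<open>x4\<close> do so in Re (\<i>
    w) = - Im w. A point at distance r differs by at least r/2 in one of these, so strips within r/2
    suffice.\<close>
  define v where "v = (\<lambda>(x1, x2, x3, x4) w. ((1 + (-1) * u x1 w) * u x2 w) * ((1 + (-1) * u x3 w) * u x4 w))"
  define U where "U = v ` (cut_params \<times> cut_params \<times> cut_params \<times> cut_params)"
  have "local_cuts K U"
    unfolding local_cuts_def
  proof (intro conjI ballI allI impI)
    show "countable U" unfolding U_def by (intro countable_image countable_SIGMA countable_cut_params)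
    have "v (x1, x2, x3, x4) \<in> HK K"
      if "x1 \<in> cut_params" "x2 \<in> cut_params" "x3 \<in> cut_params" "x4 \<in> cut_params" for x1 x2 x3 x4
      unfolding v_def prod.case
      by (intro function_algebraD(2,3)[OF alg] function_algebraD(1)[OF alg] u(1) that)
    then show "U \<subseteq> HK K" unfolding U_def by auto
    fix w and r :: real assume w: "w \<in> K" and r: "0 < r"
    have r2: "0 < r / 2" using r by simp
    have ex: "\<exists>a b. (\<omega>, a, b) \<in> cut_params \<and> x < a \<and> a < b \<and> b < x + r/2"
      and ex': "\<exists>a b. (\<omega>, a, b) \<in> cut_params \<and> x - r/2 < a \<and> a < b \<and> b < x" if "\<omega> \<in> {1, \<i>}" for \<omega> x
      using rational_interval_above[OF r2, of x] rational_interval_below[OF r2, of x] that unfolding cut_params_def by auto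
    obtain a1 b1 where 1: "(1, a1, b1) \<in> cut_params" "Re w - r/2 < a1" "a1 < b1" "b1 < Re w" using ex'[of 1 "Re w"] by auto
    obtain a2 b2 where 2: "(1, a2, b2) \<in> cut_params" "Re w < a2" "a2 < b2" "b2 < Re w + r/2" using ex[of 1 "Re w"] by auto
    obtain a3 b3 where 3: "(\<i>, a3, b3) \<in> cut_params" "- Im w - r/2 < a3" "a3 < b3" "b3 < - Im w" using ex'[of \<i> "- Im w"] by auto
    obtain a4 b4 where 4: "(\<i>, a4, b4) \<in> cut_params" "- Im w < a4" "a4 < b4" "b4 < - Im w + r/2" using ex[of \<i> "- Im w"] by auto
    define s where "s = min (min (Re w - b1) (a2 - Re w)) (min (- Im w - b3) (a4 + Im w))"
    let ?v = "v ((1, a1, b1), (1, a2, b2), (\<i>, a3, b3), (\<i>, a4, b4))"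
    show "\<exists>u\<in>U. \<exists>s>0. (\<forall>z\<in>K. dist z w < s \<longrightarrow> u z = 1) \<and> (\<forall>z\<in>K. r \<le> dist z w \<longrightarrow> u z = 0)"
    proof (intro bexI[of _ ?v] exI[of _ s] conjI ballI impI)
      show "?v \<in> U" using 1 2 3 4 by (auto simp: U_def)
      show "s > 0" using 1 2 3 4 by (auto simp: s_def)
      fix z assume z: "z \<in> K"
      { assume d: "dist z w < s"
        have "\<bar>Re z - Re w\<bar> < s" "\<bar>Im z - Im w\<bar> < s"
          using d abs_Re_le_cmod[of "z - w"] abs_Im_le_cmod[of "z - w"] by (auto simp: dist_norm)
        then have "b1 \<le> Re z" "Re z \<le> a2" "b3 \<le> - Im z" "- Im z \<le> a4" by (auto simp: s_def)
        then show "?v z = 1" unfolding v_def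
          using u(3)[OF 1(1) z] u(2)[OF 2(1) z] u(3)[OF 3(1) z] u(2)[OF 4(1) z] by simp }
      { assume d: "r \<le> dist z w"
        then have "r \<le> \<bar>Re z - Re w\<bar> + \<bar>Im z - Im w\<bar>" using cmod_le[of "z - w"] by (simp add: dist_norm)
        then have "Re z \<le> a1 \<or> b2 \<le> Re z \<or> - Im z \<le> a3 \<or> b4 \<le> - Im z" using 1 2 3 4 by linarith
        then show "?v z = 0" unfolding v_def
          using u(2)[OF 1(1) z] u(3)[OF 2(1) z] u(2)[OF 3(1) z] u(3)[OF 4(1) z] by auto }
    qed
  qed
  moreover have "\<forall>a\<in>hol_germs K. \<not> (\<forall>w\<in>K. cmod (a w - w * E w) \<le> (1/200) * (cmod (E w) + 1))"
    using E_not_approximable[OF H1] H2 unfolding K_def by blast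
  moreover have "K \<subseteq> {w. 0 \<le> Re w}" using KQ by (auto simp: Q_def)
  ultimately show ?thesis using K K0 by (intro exI[of _ K] exI[of _ U] conjI)
qed

lemma local_cuts_two_points: "local_cuts {0, 1} {\<lambda>w. w, \<lambda>w. 1 - w}"
  unfolding local_cuts_def
proof (intro conjI ballI allI impI)
  have "(\<lambda>w. w) \<in> hol_germs {0, 1}" "(\<lambda>w. 1 - w) \<in> hol_germs {0, 1}"
    by (intro hol_germs_entire holomorphic_intros)+
  then show "{\<lambda>w. w, \<lambda>w. 1 - w} \<subseteq> HK {0, 1}" using uclosure_superset by blast
  fix w :: complex and r :: real assume w: "w \<in> {0, 1}" and r: "0 < r"
  consider "w = 0" | "w = 1" using w by auto
  then show "\<exists>u\<in>{\<lambda>w. w, \<lambda>w. 1 - w}. \<exists>s>0. (\<forall>z\<in>{0, 1}. dist z w < s \<longrightarrow> u z = 1) \<and> (\<forall>z\<in>{0, 1}. r \<le> dist z w \<longrightarrow> u z = 0)"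
  proof cases
    case 1 then show ?thesis using r by (intro bexI[of _ "\<lambda>w. 1 - w"] exI[of _ 1]) auto
  next
    case 2 then show ?thesis using r by (intro bexI[of _ "\<lambda>w. w"] exI[of _ 1]) auto
  qed
qed auto

text \<open>The even coordinates \<open>x (2 * n)\<close> of a point are those of the product of the \<open>Kc n\<close>, the odd
  coordinates \<open>x (2 * k + 1)\<close> are the values of the adjoined roots.\<close>

inductive_set coord_alg :: "(nat \<Rightarrow> complex set) \<Rightarrow> nat set \<Rightarrow> ((nat \<Rightarrow> complex) \<Rightarrow> complex) set"
  for Kc :: "nat \<Rightarrow> complex set" and J :: "nat set" where
  const: "(\<lambda>x. c) \<in> coord_alg Kc J"
| base: "u \<in> HK (Kc n) \<Longrightarrow> (\<lambda>x. u (x (2 * n))) \<in> coord_alg Kc J"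
| root: "k \<in> J \<Longrightarrow> (\<lambda>x. x (2 * k + 1)) \<in> coord_alg Kc J"
| add: "f \<in> coord_alg Kc J \<Longrightarrow> g \<in> coord_alg Kc J \<Longrightarrow> (\<lambda>x. f x + g x) \<in> coord_alg Kc J"
| mult: "f \<in> coord_alg Kc J \<Longrightarrow> g \<in> coord_alg Kc J \<Longrightarrow> (\<lambda>x. f x * g x) \<in> coord_alg Kc J"

lemma coord_alg_mono: "f \<in> coord_alg Kc J \<Longrightarrow> J \<subseteq> J' \<Longrightarrow> f \<in> coord_alg Kc J'"
proof (induction rule: coord_alg.induct)
  case (root k)
  then show ?case by (intro coord_alg.root) auto
qed (auto intro: coord_alg.intros)

lemma coord_alg_even:
  "f \<in> coord_alg Kc {} \<Longrightarrow> (\<And>n. x (2 * n) = y (2 * n)) \<Longrightarrow> f x = f y"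
  by (induction rule: coord_alg.induct) auto

lemma coord_alg_prod:
  "finite I \<Longrightarrow> (\<And>i. i \<in> I \<Longrightarrow> f i \<in> coord_alg Kc J) \<Longrightarrow> (\<lambda>x. \<Prod>i\<in>I. f i x) \<in> coord_alg Kc J"
proof (induction rule: finite_induct)
  case empty then show ?case using coord_alg.const[of 1] by simp
next
  case (insert i I)
  have "(\<lambda>x. f i x * (\<Prod>i\<in>I. f i x)) \<in> coord_alg Kc J" by (intro coord_alg.mult insert) auto
  then show ?case using insert by simp
qed

section \<open>Functions and cut-offs on the product of the planar sets\<close>

definition base_space :: "(nat \<Rightarrow> complex set) \<Rightarrow> (nat \<Rightarrow> complex) set"
  where "base_space Kc = {x. \<forall>n. x (2 * n) \<in> Kc n}"

lemma continuous_on_coord: "continuous_on A (\<lambda>x. x i)"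
  for A :: "(nat \<Rightarrow> complex) set"
  by (rule continuous_on_product_coordinates[THEN continuous_on_subset]) auto

lemma coord_alg_continuous_on:
  "f \<in> coord_alg Kc J \<Longrightarrow> continuous_on (base_space Kc) f"
proof (induction rule: coord_alg.induct)
  case (base u n)
  show ?case by (rule continuous_on_compose2[OF HK_continuous_on[OF base] continuous_on_coord]) (auto simp: base_space_def)
qed (auto intro: continuous_intros continuous_on_coord)

lemma open_fun_box:
  fixes x :: "nat \<Rightarrow> complex"
  assumes "open W" "x \<in> W"
  shows "\<exists>m. \<exists>e>0. \<forall>y. (\<forall>i<m. dist (y i) (x i) < e) \<longrightarrow> y \<in> W"
proof -
  have "openin (product_topology (\<lambda>i. euclidean) UNIV) W" using assms(1) unfolding open_fun_def .
  from product_topology_open_contains_basis[OF this assms(2)]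
  obtain X where X: "x \<in> (\<Pi>\<^sub>E i\<in>UNIV. X i)" "\<And>i. openin euclidean (X i)"
      "finite {i. X i \<noteq> topspace euclidean}" "(\<Pi>\<^sub>E i\<in>UNIV. X i) \<subseteq> W" by auto
  have "\<exists>e>0. \<forall>z. dist z (x i) < e \<longrightarrow> z \<in> X i" for i
  proof -
    have "open (X i)" "x i \<in> X i" using X(1) X(2)[of i] by (auto simp: PiE_def)
    then show ?thesis unfolding open_dist by blast
  qed
  then obtain e where e: "\<And>i. e i > 0" "\<And>i z. dist z (x i) < e i \<Longrightarrow> z \<in> X i" by metis
  obtain m where m: "{i. X i \<noteq> topspace euclidean} \<subseteq> {..<m}" using finite_nat_iff_bounded X(3) by blast
  define d where "d = Min (insert 1 (e ` {..<m}))"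
  have d: "d > 0" "\<And>i. i < m \<Longrightarrow> d \<le> e i" unfolding d_def using e(1) by (auto simp: Min_gr_iff)
  have "y \<in> W" if y: "\<forall>i<m. dist (y i) (x i) < d" for y
  proof -
    have "y i \<in> X i" for i
    proof (cases "i < m")
      case True
      then show ?thesis using y d(2) e(2) by (metis order_less_le_trans)
    next
      case False then show ?thesis using m by auto
    qed
    then show ?thesis using X(4) by (auto simp: PiE_def)
  qed
  then show ?thesis using d(1) by blast
qed

lemma eventually_box:
  fixes x :: "nat \<Rightarrow> complex" and m :: nat
  assumes "e > 0"
  shows "eventually (\<lambda>y. \<forall>i<m. dist (y (g i)) (x (g i)) < e) (nhds x)"
proof -
  have "eventually (\<lambda>y. dist (y i) (x i) < e) (nhds x)" for i
  proof -
    have "open {y. dist (y i) (x i) < e}"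
      by (intro open_Collect_less continuous_intros continuous_on_coord)
    then show ?thesis using assms unfolding eventually_nhds by auto
  qed
  then have "eventually (\<lambda>y. \<forall>i\<in>{..<m}. dist (y (g i)) (x (g i)) < e) (nhds x)"
    by (intro eventually_ball_finite) auto
  then show ?thesis by (rule eventually_mono) auto
qed

text \<open>A function without roots does not see odd coordinates, so those of y may be replaced by
  those of x; hence a neighbourhood restricting the even coordinates alone is enough.\<close>

lemma coord_alg_box_continuous:
  assumes "f \<in> coord_alg Kc {}" "x \<in> base_space Kc" "0 < e"
  shows "\<exists>m. \<exists>r>0. \<forall>y\<in>base_space Kc. (\<forall>n<m. dist (y (2 * n)) (x (2 * n)) < r) \<longrightarrow> dist (f y) (f x) < e"
proof -
  have "continuous_on (base_space Kc) f" by (rule coord_alg_continuous_on[OF assms(1)])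
  then have "\<exists>W. open W \<and> x \<in> W \<and> (\<forall>y\<in>base_space Kc. y \<in> W \<longrightarrow> f y \<in> ball (f x) e)"
    using assms(2,3) unfolding continuous_on_topological by (metis centre_in_ball open_ball)
  then obtain W where W: "open W" "x \<in> W" "\<And>y. y \<in> base_space Kc \<Longrightarrow> y \<in> W \<Longrightarrow> f y \<in> ball (f x) e" by blast
  obtain m r where m: "r > 0" "\<And>y. (\<forall>i<m. dist (y i) (x i) < r) \<Longrightarrow> y \<in> W" using open_fun_box[OF W(1,2)] by blast
  have "dist (f y) (f x) < e" if y: "y \<in> base_space Kc" "\<forall>n<m. dist (y (2 * n)) (x (2 * n)) < r" for y
  proof -
    define z where "z i = (if even i then y i else x i)" for i
    have "f z = f y" by (rule coord_alg_even[OF assms(1)]) (simp add: z_def)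
    moreover have "z \<in> base_space Kc" using y(1) by (simp add: base_space_def z_def)
    moreover have "z \<in> W"
      by (rule m(2)) (use y(2) m(1) in \<open>auto simp: z_def elim!: evenE\<close>)
    ultimately show ?thesis using W(3)[of z] by (simp add: dist_commute)
  qed
  then show ?thesis using m(1) by blast
qed

text \<open>The product of the \<open>Z n\<close> will carry \<open>L\<close>: \<open>Z n\<close> is
  {0} in a cheese factor and the whole set in a two-point factor. Peak functions are demanded at
  points of \<open>Z n\<close> since bounded cut-offs are produced only off
  \<open>L\<close>.\<close>

locale base_data =
  fixes Kc :: "nat \<Rightarrow> complex set" and Z :: "nat \<Rightarrow> complex set" and U :: "nat \<Rightarrow> (complex \<Rightarrow> complex) set"
  assumes compact_Kc: "\<And>n. compact (Kc n)"
    and Z_subset: "\<And>n. Z n \<subseteq> Kc n" and closed_Z: "\<And>n. closed (Z n)"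
    and cuts: "\<And>n. local_cuts (Kc n) (U n)"
    and peak: "\<And>n z. z \<in> Z n \<Longrightarrow> \<exists>h\<in>HK (Kc n). h z = 1 \<and> (\<forall>w\<in>Kc n - {z}. cmod (h w) < 1)"
begin

text \<open>This is membership in \<open>L\<close>. The functions that receive roots vanish at such
  points, so all roots are 0 there and the fibre over the base point is a single point.\<close>

definition roots_at :: "(nat \<Rightarrow> complex) \<Rightarrow> bool" where "roots_at x \<longleftrightarrow> (\<forall>n. x (2 * n) \<in> Z n)"

text \<open>Lists keep the family countable: there are only countably many finite lists over a
  countable set of planar cut-offs.\<close>

definition box_fun :: "(complex \<Rightarrow> complex) list \<Rightarrow> (nat \<Rightarrow> complex) \<Rightarrow> complex"
  where "box_fun us x = (\<Prod>n<length us. (us ! n) (x (2 * n)))"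

lemma box_fun_coord_alg:
  assumes "\<forall>n<length us. us ! n \<in> U n" shows "box_fun us \<in> coord_alg Kc {}"
  unfolding box_fun_def[abs_def]
  using assms cuts by (intro coord_alg_prod coord_alg.base) (auto simp: local_cuts_def)

lemma box_cut:
  assumes x: "x \<in> base_space Kc" and r: "0 < r"
  shows "\<exists>us. length us = m \<and> (\<forall>n<length us. us ! n \<in> U n) \<and>
    (\<exists>s>0. \<forall>y\<in>base_space Kc. (\<forall>n<m. dist (y (2 * n)) (x (2 * n)) < s) \<longrightarrow> box_fun us y = 1) \<and>
    (\<forall>y\<in>base_space Kc. (\<exists>n<m. r \<le> dist (y (2 * n)) (x (2 * n))) \<longrightarrow> box_fun us y = 0)"
proof -
  have "\<exists>u s. u \<in> U n \<and> s > 0 \<and> (\<forall>z\<in>Kc n. dist z (x (2 * n)) < s \<longrightarrow> u z = 1) \<and>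
     (\<forall>z\<in>Kc n. r \<le> dist z (x (2 * n)) \<longrightarrow> u z = 0)" for n
    using cuts[of n] x r unfolding local_cuts_def base_space_def by blast
  then obtain u s where us: "\<And>n. u n \<in> U n" "\<And>n. s n > (0::real)" "\<And>n z. z \<in> Kc n \<Longrightarrow> dist z (x (2 * n)) < s n \<Longrightarrow> u n z = 1"
     "\<And>n z. z \<in> Kc n \<Longrightarrow> r \<le> dist z (x (2 * n)) \<Longrightarrow> u n z = 0" by metis
  define t where "t = Min (insert 1 (s ` {..<m}))"
  have t: "t > 0" "\<And>n. n < m \<Longrightarrow> t \<le> s n" unfolding t_def using us(2) by (auto simp: Min_gr_iff)
  have e: "box_fun (map u [0..<m]) y = (\<Prod>n<m. u n (y (2 * n)))" for y by (simp add: box_fun_def)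
  show ?thesis
  proof (intro exI[of _ "map u [0..<m]"] conjI exI[of _ t] ballI impI)
    fix y assume y: "y \<in> base_space Kc"
    { assume "\<forall>n<m. dist (y (2 * n)) (x (2 * n)) < t"
      then have "u n (y (2 * n)) = 1" if "n < m" for n
        using that t(2)[of n] y us(3)[of "y (2 * n)" n] by (fastforce simp: base_space_def)
      then show "box_fun (map u [0..<m]) y = 1" unfolding e by simp }
    { assume "\<exists>n<m. r \<le> dist (y (2 * n)) (x (2 * n))"
      then obtain n where "n < m" "r \<le> dist (y (2 * n)) (x (2 * n))" by blast
      then have "u n (y (2 * n)) = 0" using y us(4)[of "y (2 * n)" n] by (simp add: base_space_def)
      then show "box_fun (map u [0..<m]) y = 0" unfolding e using \<open>n < m\<close> by (auto intro!: prod_zero) }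
  qed (use us t in auto)
qed

text \<open>\<open>N k\<close> is so large that the \<open>N k\<close>-th root of |f k| is at most
  3/2, whatever the size of \<open>f k\<close>. Cut-offs are demanded at points off \<open>L\<close>
  only, in boxes of every size; that all \<open>f k\<close> vanish on \<open>L\<close> leaves the
  slices through \<open>L\<close> essentially unchanged.\<close>

definition root_data :: "(nat \<Rightarrow> (nat \<Rightarrow> complex) \<Rightarrow> complex) \<Rightarrow> (nat \<Rightarrow> nat) \<Rightarrow> bool"
  where "root_data f N \<longleftrightarrow>
    (\<forall>k. f k \<in> coord_alg Kc {} \<and> 0 < N k \<and>
      (\<forall>x\<in>base_space Kc. roots_at x \<longrightarrow> f k x = 0) \<and> (\<forall>x\<in>base_space Kc. cmod (f k x) \<le> (3/2) ^ N k)) \<and>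
    (\<forall>x\<in>base_space Kc. \<not> roots_at x \<longrightarrow> (\<forall>m. \<forall>r>0. \<exists>k.
      (\<exists>m'. \<exists>s>0. \<forall>y\<in>base_space Kc. (\<forall>n<m'. dist (y (2 * n)) (x (2 * n)) < s) \<longrightarrow> f k y = 1) \<and>
      (\<forall>y\<in>base_space Kc. (\<exists>n<m. r \<le> dist (y (2 * n)) (x (2 * n))) \<longrightarrow> f k y = 0)))"

lemma coord_alg_base_bounded:
  assumes "f \<in> coord_alg Kc {}" shows "\<exists>C. \<forall>x\<in>base_space Kc. cmod (f x) \<le> C"
  using assms
proof (induction rule: coord_alg.induct)
  case (const c) then show ?case by blast
next
  case (base u n)
  show ?case using function_algebraD(4)[OF function_algebra_HK[OF compact_Kc] base]
    unfolding base_space_def by blast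
next
  case (add f g)
  then obtain C D where "\<forall>x\<in>base_space Kc. cmod (f x) \<le> C" "\<forall>x\<in>base_space Kc. cmod (g x) \<le> D" by blast
  then have "\<forall>x\<in>base_space Kc. cmod (f x + g x) \<le> C + D" by (meson add_mono norm_triangle_le)
  then show ?case by blast
next
  case (mult f g)
  then obtain C D where CD: "\<forall>x\<in>base_space Kc. cmod (f x) \<le> C" "\<forall>x\<in>base_space Kc. cmod (g x) \<le> D" by blast
  have "cmod (f x * g x) \<le> C * D" if "x \<in> base_space Kc" for x
    unfolding norm_mult using CD that by (intro mult_mono) (auto intro: order_trans[OF norm_ge_zero])
  then show ?case by blast
qed auto

lemma root_data_exists: "\<exists>f N. root_data f N"
proof -
  define F0 where "F0 = box_fun ` {us \<in> lists (\<Union>n. U n). \<forall>n<length us. us ! n \<in> U n}"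
  \<comment> \<open>The function 0 is inserted so that \<open>F\<close> is nonempty and can be
    enumerated.\<close>
  define F where "F = insert (\<lambda>x. 0) {g \<in> F0. \<forall>x\<in>base_space Kc. roots_at x \<longrightarrow> g x = 0}"
  have "countable (\<Union>n. U n)" using cuts by (auto simp: local_cuts_def)
  then have "countable {us \<in> lists (\<Union>n. U n). \<forall>n<length us. us ! n \<in> U n}"
    using countable_lists countable_subset by (metis (no_types, lifting) mem_Collect_eq subsetI)
  then have "countable F0" unfolding F0_def by (rule countable_image)
  then have cF: "countable F" unfolding F_def by (metis (no_types, lifting) countable_insert countable_subset mem_Collect_eq subsetI)
  define f where "f = from_nat_into F"
  have Fne: "F \<noteq> {}" by (simp add: F_def)
  have fF: "f k \<in> F" for k unfolding f_def by (rule from_nat_into[OF Fne])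
  have falg: "f k \<in> coord_alg Kc {}" for k
    using fF[of k] coord_alg.const[of 0 Kc] box_fun_coord_alg by (auto simp: F_def F0_def)
  have fL: "f k x = 0" if "x \<in> base_space Kc" "roots_at x" for k x using fF[of k] that by (auto simp: F_def)
  have "\<exists>N. 0 < N \<and> (\<forall>x\<in>base_space Kc. cmod (f k x) \<le> (3/2) ^ N)" for k
  proof -
    obtain C where C: "\<forall>x\<in>base_space Kc. cmod (f k x) \<le> C" using coord_alg_base_bounded[OF falg] by blast
    obtain N where "max C 1 < (3/2::real) ^ N" using real_arch_pow[of "3/2" "max C 1"] by auto
    moreover then have "0 < N" by (cases N) auto
    ultimately show ?thesis using C by (intro exI[of _ N]) fastforce
  qed
  then obtain N where N: "\<And>k. 0 < N k" "\<And>k x. x \<in> base_space Kc \<Longrightarrow> cmod (f k x) \<le> (3/2) ^ N k" by metis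
  have "\<exists>k. (\<exists>m'. \<exists>s>0. \<forall>y\<in>base_space Kc. (\<forall>n<m'. dist (y (2 * n)) (x (2 * n)) < s) \<longrightarrow> f k y = 1) \<and>
      (\<forall>y\<in>base_space Kc. (\<exists>n<m. r \<le> dist (y (2 * n)) (x (2 * n))) \<longrightarrow> f k y = 0)"
    if x: "x \<in> base_space Kc" "\<not> roots_at x" and r: "r > 0" for x m r
  proof -
    obtain n0 where n0: "x (2 * n0) \<notin> Z n0" using x(2) by (auto simp: roots_at_def)
    obtain r0 where r0: "r0 > 0" "ball (x (2 * n0)) r0 \<subseteq> - Z n0"
      using closed_Z[of n0] n0 open_contains_ball[of "- Z n0"] by (auto simp: open_Compl)
    \<comment> \<open>The box has more than \<open>n0\<close> coordinates and width at most
      \<open>r0\<close>, so it misses \<open>L\<close>; therefore its cut-off function vanishes on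
      \<open>L\<close> and belongs to \<open>F\<close>.\<close>
    define m1 where "m1 = max m (Suc n0)"
    define r1 where "r1 = min r r0"
    have "r1 > 0" using r r0 by (simp add: r1_def)
    from box_cut[OF x(1) this, of m1] obtain us where us: "length us = m1" "\<forall>n<length us. us ! n \<in> U n"
      "\<exists>s>0. \<forall>y\<in>base_space Kc. (\<forall>n<m1. dist (y (2 * n)) (x (2 * n)) < s) \<longrightarrow> box_fun us y = 1"
      "\<And>y n. y\<in>base_space Kc \<Longrightarrow> n < m1 \<Longrightarrow> r1 \<le> dist (y (2 * n)) (x (2 * n)) \<Longrightarrow> box_fun us y = 0" by blast
    have "box_fun us \<in> F"
    proof -
      have "us \<in> lists (\<Union>n. U n)" using us(2) by (intro in_listsI) (metis UN_I UNIV_I in_set_conv_nth)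
      then have "box_fun us \<in> F0" using us(2) unfolding F0_def by blast
      moreover have "box_fun us y = 0" if y: "y \<in> base_space Kc" "roots_at y" for y
      proof (rule us(4)[OF y(1), of n0])
        have "y (2 * n0) \<in> Z n0" using y(2) by (simp add: roots_at_def)
        then have "y (2 * n0) \<notin> ball (x (2 * n0)) r0" using r0(2) by blast
        then show "r1 \<le> dist (y (2 * n0)) (x (2 * n0))" by (simp add: r1_def dist_commute)
      qed (simp add: m1_def)
      ultimately show ?thesis by (simp add: F_def)
    qed
    then obtain k where k: "f k = box_fun us" using from_nat_into_surj[OF cF] unfolding f_def by metis
    show ?thesis
    proof (rule exI[of _ k], rule conjI)
      show "\<exists>m'. \<exists>s>0. \<forall>y\<in>base_space Kc. (\<forall>n<m'. dist (y (2 * n)) (x (2 * n)) < s) \<longrightarrow> f k y = 1"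
        using us(3) unfolding k by blast
      show "\<forall>y\<in>base_space Kc. (\<exists>n<m. r \<le> dist (y (2 * n)) (x (2 * n))) \<longrightarrow> f k y = 0"
      proof (intro ballI impI)
        fix y assume y: "y \<in> base_space Kc" "\<exists>n<m. r \<le> dist (y (2 * n)) (x (2 * n))"
        then obtain n where "n < m" "r \<le> dist (y (2 * n)) (x (2 * n))" by blast
        then have "n < m1" "r1 \<le> dist (y (2 * n)) (x (2 * n))" by (auto simp: m1_def r1_def)
        then show "f k y = 0" unfolding k by (rule us(4)[OF y(1)])
      qed
    qed
  qed
  then have "root_data f N" unfolding root_data_def using falg fL N by simp
  then show ?thesis by blast
qed

end

section \<open>Functional calculus and relative neighbourhoods\<close>

text \<open>\<open>g\<close> is needed only on a disc containing, with a margin, the image under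
  \<open>F\<close> of the support of \<open>u\<close>: there its Taylor polynomials converge
  uniformly, and elsewhere both sides vanish. With u = 1 this inverts functions; with a cut-off
  \<open>u\<close> it yields local roots and local inverses.\<close>

lemma uclosure_power_series:
  assumes A: "function_algebra S A" and F: "F \<in> uclosure S A" and u: "u \<in> uclosure S A"
    and r: "0 \<le> r'" "r' < r" and g: "g holomorphic_on ball c r"
    and supp: "\<And>y. y \<in> S \<Longrightarrow> r' < dist (F y) c \<Longrightarrow> u y = 0"
  shows "(\<lambda>y. u y * g (F y)) \<in> uclosure S A"
proof (rule uclosure_limit)
  fix e :: real assume e: "e > 0"
  note alg = function_algebraD[OF function_algebra_uclosure[OF A]]
  obtain C where C: "C > 0" "\<forall>x\<in>S. cmod (u x) \<le> C" using alg(4)[OF u] by blast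
  define a where "a n = (deriv ^^ n) g c / fact n" for n
  have sums: "(\<lambda>n. a n * (w - c) ^ n) sums g w" if "w \<in> ball c r" for w
    unfolding a_def by (rule holomorphic_power_series[OF g that])
  have "ereal r' < conv_radius a"
  proof -
    have "c + of_real ((r + r') / 2) \<in> ball c r" using r by (simp add: dist_norm del: of_real_add of_real_divide)
    from sums_summable[OF sums[OF this]] have "summable (\<lambda>n. a n * (of_real ((r + r') / 2)) ^ n)" by simp
    from conv_radius_geI[OF this] have "ereal ((r + r') / 2) \<le> conv_radius a" using r
      by (simp add: norm_divide del: of_real_add of_real_divide)
    moreover have "ereal r' < ereal ((r + r') / 2)" using r by simp
    ultimately show ?thesis by (rule order_less_le_trans[rotated])
  qed
  from powser_uniform_limit[OF this, of c]
  have "\<forall>\<^sub>F n in sequentially. \<forall>x\<in>cball c r'. dist (\<Sum>i<n. a i * (x - c) ^ i) (suminf (\<lambda>i. a i * (x - c) ^ i)) < e / C"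
    using e C(1) by (auto dest!: uniform_limitD[where e = "e / C"])
  from eventually_happens'[OF sequentially_bot this]
  obtain n where n: "\<And>x. x \<in> cball c r' \<Longrightarrow> dist (\<Sum>i<n. a i * (x - c) ^ i) (suminf (\<lambda>i. a i * (x - c) ^ i)) < e / C"
    by blast
  define p where "p y = (\<Sum>i<n. a i * (F y - c) ^ i)" for y
  have pow: "(\<lambda>y. (F y - c) ^ i) \<in> uclosure S A" for i
  proof (induction i)
    case 0 then show ?case using alg(1)[of 1] by simp
  next
    case (Suc i)
    have "(\<lambda>y. (F y + (- c)) * (F y - c) ^ i) \<in> uclosure S A"
      by (intro alg(3) alg(2) F alg(1) Suc)
    then show ?case by simp
  qed
  have pA: "(\<lambda>y. \<Sum>i<m. a i * (F y - c) ^ i) \<in> uclosure S A" for m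
  proof (induction m)
    case 0 then show ?case using alg(1)[of 0] by simp
  next
    case (Suc m)
    have "(\<lambda>y. (\<Sum>i<m. a i * (F y - c) ^ i) + a m * (F y - c) ^ m) \<in> uclosure S A"
      by (intro alg(2) Suc alg(3)[OF alg(1) pow])
    then show ?case by simp
  qed
  have "(\<lambda>y. u y * p y) \<in> uclosure S A" unfolding p_def by (intro alg(3) u pA)
  moreover have "cmod (u y * g (F y) - u y * p y) \<le> e" if y: "y \<in> S" for y
  proof (cases "r' < dist (F y) c")
    case True then show ?thesis using supp[OF y] e by simp
  next
    case False
    then have Fy: "F y \<in> cball c r'" "F y \<in> ball c r" using r by (auto simp: dist_commute)
    have "g (F y) = suminf (\<lambda>i. a i * (F y - c) ^ i)" using sums[OF Fy(2)] by (simp add: sums_iff)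
    then have "cmod (g (F y) - p y) \<le> e / C" using n[OF Fy(1)] by (simp add: p_def dist_norm norm_minus_commute)
    then have "cmod (u y) * cmod (g (F y) - p y) \<le> C * (e / C)" using C y by (intro mult_mono) auto
    then show ?thesis using C(1) by (simp add: right_diff_distrib[symmetric] norm_mult)
  qed
  ultimately show "\<exists>h\<in>uclosure S A. \<forall>y\<in>S. cmod (u y * g (F y) - h y) \<le> e"
    by (intro bexI[of _ "\<lambda>y. u y * p y"]) auto
qed

text \<open>Makes a continuous function with values in the n-th roots of unity equal to 1 near a
  point where it is 1.\<close>

lemma root_of_unity_isolated:
  assumes "0 < n"
  shows "\<exists>d>0. \<forall>z::complex. z ^ n = 1 \<longrightarrow> dist z 1 < d \<longrightarrow> z = 1"
proof -
  have "finite {z::complex. z ^ n = 1}" using assms by (intro finite_roots_unity) simp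
  from finite_set_avoid[OF this, of 1] show ?thesis by (force simp: dist_commute)
qed

lemma sum_powers_root_of_unity:
  assumes "0 < n" "(v::complex) ^ n = 1"
  shows "(\<Sum>i<n. v ^ i) = (if v = 1 then of_nat n else 0)"
  using assms geometric_sum[of v n] by auto

definition near :: "'a::topological_space set \<Rightarrow> 'a \<Rightarrow> ('a \<Rightarrow> bool) \<Rightarrow> bool"
  where "near S x P \<longleftrightarrow> eventually (\<lambda>y. y \<in> S \<longrightarrow> P y) (nhds x)"

lemma near_mono: "near S x P \<Longrightarrow> (\<And>y. y \<in> S \<Longrightarrow> P y \<Longrightarrow> P' y) \<Longrightarrow> near S x P'"
  unfolding near_def by (erule eventually_mono) auto

lemma near_conj: "near S x P \<Longrightarrow> near S x P' \<Longrightarrow> near S x (\<lambda>y. P y \<and> P' y)"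
  unfolding near_def by (auto elim: eventually_elim2)

lemma near_self: "near S x P \<Longrightarrow> x \<in> S \<Longrightarrow> P x"
  unfolding near_def using eventually_nhds_x_imp_x by fastforce

lemma near_continuous:
  fixes f :: "'a::topological_space \<Rightarrow> complex"
  assumes "continuous_on S f" "x \<in> S" "0 < e"
  shows "near S x (\<lambda>y. dist (f y) (f x) < e)"
proof -
  have "\<exists>W. open W \<and> x \<in> W \<and> (\<forall>y\<in>S. y \<in> W \<longrightarrow> f y \<in> ball (f x) e)"
    using assms unfolding continuous_on_topological by (metis centre_in_ball open_ball)
  then show ?thesis unfolding near_def eventually_nhds by (auto simp: dist_commute)
qed

section \<open>The space of roots and cut-offs on its sheets\<close>

locale root_extension = base_data +
  fixes f :: "nat \<Rightarrow> (nat \<Rightarrow> complex) \<Rightarrow> complex" and N :: "nat \<Rightarrow> nat"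
  assumes root_data: "root_data f N"
begin

lemma f_alg: "f k \<in> coord_alg Kc {}" and N_pos: "0 < N k"
  and f_roots: "x \<in> base_space Kc \<Longrightarrow> roots_at x \<Longrightarrow> f k x = 0"
  and f_bound: "x \<in> base_space Kc \<Longrightarrow> cmod (f k x) \<le> (3/2) ^ N k"
  using root_data unfolding root_data_def by auto

lemma f_cut:
  assumes "x \<in> base_space Kc" "\<not> roots_at x" "0 < r"
  shows "\<exists>k. (\<exists>m'. \<exists>s>0. \<forall>y\<in>base_space Kc. (\<forall>n<m'. dist (y (2 * n)) (x (2 * n)) < s) \<longrightarrow> f k y = 1) \<and>
      (\<forall>y\<in>base_space Kc. (\<exists>n<m. r \<le> dist (y (2 * n)) (x (2 * n))) \<longrightarrow> f k y = 0)"
  using root_data assms unfolding root_data_def by blast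

definition S :: "(nat \<Rightarrow> complex) set"
  where "S = {x \<in> base_space Kc. \<forall>k. x (2 * k + 1) ^ N k = f k x}"

definition Alg :: "((nat \<Rightarrow> complex) \<Rightarrow> complex) set" where "Alg = coord_alg Kc UNIV"

abbreviation "B \<equiv> uclosure S Alg"

lemma S_base: "x \<in> S \<Longrightarrow> x \<in> base_space Kc" and S_root: "x \<in> S \<Longrightarrow> x (2 * k + 1) ^ N k = f k x"
  by (simp_all add: S_def)

lemma S_root_bound: "x \<in> S \<Longrightarrow> cmod (x (2 * k + 1)) \<le> 3/2"
proof -
  assume x: "x \<in> S"
  have "cmod (x (2 * k + 1)) ^ N k = cmod (f k x)" using S_root[OF x] by (metis norm_power)
  also have "\<dots> \<le> (3/2) ^ N k" by (rule f_bound[OF S_base[OF x]])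
  finally have le: "cmod (x (2 * k + 1)) ^ N k \<le> (3/2) ^ N k" .
  show ?thesis
  proof (rule ccontr)
    assume "\<not> ?thesis"
    then have "(3/2) ^ N k < cmod (x (2 * k + 1)) ^ N k" using N_pos[of k] by (intro power_strict_mono) auto
    then show False using le by simp
  qed
qed

lemma compact_S: "compact S"
proof -
  define D where "D i = (if even i then Kc (i div 2) else cball 0 (3/2))" for i
  have "compactin (product_topology (\<lambda>i. euclidean) UNIV) (\<Pi>\<^sub>E i\<in>UNIV. D i)"
    unfolding compactin_PiE by (auto simp: D_def compact_Kc)
  then have cD: "compact (\<Pi>\<^sub>E i\<in>UNIV. D i)" by (simp add: euclidean_product_topology)
  have Db: "(\<Pi>\<^sub>E i\<in>UNIV. D i) \<subseteq> base_space Kc"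
  proof
    fix x assume "x \<in> (\<Pi>\<^sub>E i\<in>UNIV. D i)"
    then have "x (2 * n) \<in> D (2 * n)" for n by (auto simp: PiE_def)
    then show "x \<in> base_space Kc" by (simp add: base_space_def D_def)
  qed
  have cl: "closed {x \<in> (\<Pi>\<^sub>E i\<in>UNIV. D i). x (2 * k + 1) ^ N k - f k x = 0}" for k
  proof -
    have "continuous_on (\<Pi>\<^sub>E i\<in>UNIV. D i) (\<lambda>x. x (2 * k + 1) ^ N k - f k x)"
      by (intro continuous_intros continuous_on_coord continuous_on_subset[OF coord_alg_continuous_on[OF f_alg] Db])
    from continuous_closed_preimage_constant[OF this compact_imp_closed[OF cD]] show ?thesis .
  qed
  have "S = (\<Pi>\<^sub>E i\<in>UNIV. D i) \<inter> (\<Inter>k. {x \<in> (\<Pi>\<^sub>E i\<in>UNIV. D i). x (2 * k + 1) ^ N k - f k x = 0})"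
  proof (intro equalityI subsetI)
    fix x assume x: "x \<in> S"
    have "x i \<in> D i" for i
      using x S_base[OF x] S_root_bound[OF x, of "i div 2"] by (auto simp: D_def base_space_def elim!: evenE oddE)
    then have "x \<in> (\<Pi>\<^sub>E i\<in>UNIV. D i)" by (auto simp: PiE_def)
    then show "x \<in> (\<Pi>\<^sub>E i\<in>UNIV. D i) \<inter> (\<Inter>k. {x \<in> (\<Pi>\<^sub>E i\<in>UNIV. D i). x (2 * k + 1) ^ N k - f k x = 0})"
      using S_root[OF x] by auto
  next
    fix x assume "x \<in> (\<Pi>\<^sub>E i\<in>UNIV. D i) \<inter> (\<Inter>k. {x \<in> (\<Pi>\<^sub>E i\<in>UNIV. D i). x (2 * k + 1) ^ N k - f k x = 0})"
    then show "x \<in> S" using Db by (auto simp: S_def)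
  qed
  moreover have "compact ((\<Pi>\<^sub>E i\<in>UNIV. D i) \<inter> (\<Inter>k. {x \<in> (\<Pi>\<^sub>E i\<in>UNIV. D i). x (2 * k + 1) ^ N k - f k x = 0}))"
    by (intro compact_Int_closed cD closed_INT ballI cl)
  ultimately show ?thesis by simp
qed

lemma Alg_continuous_on: "g \<in> Alg \<Longrightarrow> continuous_on S g"
  unfolding Alg_def using coord_alg_continuous_on continuous_on_subset S_base by blast

lemma B_continuous_on: "g \<in> B \<Longrightarrow> continuous_on S g"
  by (rule uclosure_continuous_on[OF _ Alg_continuous_on])

lemma function_algebra_Alg: "function_algebra S Alg"
proof -
  have "\<exists>C. \<forall>x\<in>S. cmod (g x) \<le> C" if "g \<in> Alg" for g
    using compact_continuous_image[OF Alg_continuous_on[OF that] compact_S]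
    by (meson bounded_iff compact_imp_bounded imageI)
  then show ?thesis unfolding function_algebra_def by (auto simp: Alg_def intro: coord_alg.intros)
qed

lemmas B_alg = function_algebraD[OF function_algebra_uclosure[OF function_algebra_Alg]]

lemma Alg_subset_B: "g \<in> Alg \<Longrightarrow> g \<in> B"
  using uclosure_superset by blast

lemma f_in_B: "f k \<in> B"
  using coord_alg_mono[OF f_alg] Alg_subset_B unfolding Alg_def by blast

lemma root_in_B: "(\<lambda>x. x (2 * k + 1)) \<in> B"
  unfolding Alg_def by (rule subsetD[OF uclosure_superset], rule coord_alg.root) simp

lemma B_cmult: "g \<in> B \<Longrightarrow> (\<lambda>x. c * g x) \<in> B"
  using B_alg(3)[OF B_alg(1)] by blast

lemma near_box: "0 < s \<Longrightarrow> near S x (\<lambda>y. \<forall>n<m. dist (y (2 * n)) (x (2 * n)) < s)" for m :: nat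
  unfolding near_def by (rule eventually_mono[OF eventually_box[of s m "\<lambda>n. 2 * n" x]]) auto

definition supp_box :: "(nat \<Rightarrow> complex) \<Rightarrow> nat \<Rightarrow> real \<Rightarrow> ((nat \<Rightarrow> complex) \<Rightarrow> complex) \<Rightarrow> bool"
  where "supp_box x m r u \<longleftrightarrow> (\<forall>y\<in>S. (\<exists>n<m. r \<le> dist (y (2 * n)) (x (2 * n))) \<longrightarrow> u y = 0)"

lemma supp_box_mono:
  assumes "supp_box x m r u" "m' \<le> m" "r \<le> r'" shows "supp_box x m' r' u"
  unfolding supp_box_def
proof (intro ballI impI)
  fix y assume y: "y \<in> S" "\<exists>n<m'. r' \<le> dist (y (2 * n)) (x (2 * n))"
  then obtain n where "n < m'" "r' \<le> dist (y (2 * n)) (x (2 * n))" by blast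
  then have "n < m" "r \<le> dist (y (2 * n)) (x (2 * n))" using assms(2,3) by auto
  then show "u y = 0" using assms(1) y(1) unfolding supp_box_def by blast
qed

text \<open>The modulus must not grow: this preserves the bound 3/2 however many sheets are cut
  away.\<close>

definition shrinks :: "(nat \<Rightarrow> complex) \<Rightarrow> ((nat \<Rightarrow> complex) \<Rightarrow> bool) \<Rightarrow> ((nat \<Rightarrow> complex) \<Rightarrow> complex) \<Rightarrow>
    ((nat \<Rightarrow> complex) \<Rightarrow> complex) \<Rightarrow> bool"
  where "shrinks x P u u' \<longleftrightarrow> (\<forall>y\<in>S. cmod (u' y) \<le> cmod (u y)) \<and> near S x (\<lambda>y. u' y = u y) \<and> (\<forall>y\<in>S. P y \<longrightarrow> u' y = 0)"

text \<open>The box is fixed before \<open>u\<close>, so it depends only on \<open>x\<close> and on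
  the region to be removed. Several removals can then be composed for a \<open>u\<close> supported
  in the intersection of their boxes.\<close>

definition can_shrink :: "(nat \<Rightarrow> complex) \<Rightarrow> ((nat \<Rightarrow> complex) \<Rightarrow> bool) \<Rightarrow> bool"
  where "can_shrink x P \<longleftrightarrow> (\<exists>m r. 0 < r \<and> (\<forall>u\<in>B. supp_box x m r u \<longrightarrow> (\<exists>u'\<in>B. shrinks x P u u')))"

text \<open>Over a small box of the base, the sheets on which the \<open>j\<close>-th root takes different values
  are separated by an idempotent \<open>\<iota> = (1/N) \<Sum>\<^sub>i v\<^sup>i\<close>, where \<open>v\<close> is the quotient of the root
  by a local holomorphic branch.\<close>

lemma sheet_cut:
  assumes x: "x \<in> S" and eta: "0 < \<eta>"
  shows "can_shrink x (\<lambda>y. \<eta> \<le> dist (y (2 * j + 1)) (x (2 * j + 1)))"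
proof (cases "f j x = 0")
  case True
  \<comment> \<open>At a zero of \<open>f j\<close> all sheets meet. The root is small wherever
    \<open>f j\<close> is, so \<open>u\<close> vanishes on the unwanted set as soon as its box is
    small.\<close>
  then have xj: "x (2 * j + 1) = 0" using S_root[OF x, of j] N_pos[of j] by simp
  have "0 < \<eta> ^ N j" using eta by simp
  from coord_alg_box_continuous[OF f_alg S_base[OF x] this, of j] obtain m r where
    m: "r > 0" "\<And>y. y \<in> base_space Kc \<Longrightarrow> (\<forall>n<m. dist (y (2 * n)) (x (2 * n)) < r) \<Longrightarrow> dist (f j y) (f j x) < \<eta> ^ N j"
    by blast
  have "u y = 0" if u: "supp_box x m r u"
    and y: "y \<in> S" "\<eta> \<le> dist (y (2 * j + 1)) (x (2 * j + 1))" for u :: "(nat \<Rightarrow> complex) \<Rightarrow> complex" and y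
  proof -
    have "\<eta> ^ N j \<le> cmod (y (2 * j + 1)) ^ N j" using y(2) eta xj by (intro power_mono) auto
    also have "\<dots> = dist (f j y) (f j x)" using S_root[OF y(1), of j] True by (metis norm_power dist_0_norm dist_commute)
    finally have "\<exists>n<m. r \<le> dist (y (2 * n)) (x (2 * n))" using m(2)[OF S_base[OF y(1)]] by (meson linorder_not_less)
    then show ?thesis using u y(1) unfolding supp_box_def by blast
  qed
  then have "shrinks x (\<lambda>y. \<eta> \<le> dist (y (2 * j + 1)) (x (2 * j + 1))) u u" if "supp_box x m r u" for u
    using that unfolding shrinks_def by (simp add: near_def)
  then show ?thesis using m(1) unfolding can_shrink_def by blast
next
  case False
  define a where "a = x (2 * j + 1)"
  have aN: "a ^ N j = f j x" using S_root[OF x] by (simp add: a_def)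
  then have a0: "a \<noteq> 0" using False N_pos[of j] by (auto simp: power_0_left)
  define q where "q = 1 / complex_of_nat (N j)"
  have "isCont (\<lambda>t. t powr q) 1" by (intro continuous_intros) auto
  then obtain d where d: "d > 0" "\<And>t. dist t 1 < d \<Longrightarrow> dist (t powr q) (1 powr q) < \<eta> / cmod a"
    using eta a0 unfolding continuous_at_eps_delta by (meson divide_pos_pos zero_less_norm_iff)
  define r' where "r' = min d (1/2) / 2"
  have r': "0 < r'" "r' < d" "r' < 1/2" using d(1) by (auto simp: r'_def min_def)
  \<comment> \<open>Normalised to F x = 1, so that the principal branch of t^(-1/N) is holomorphic
    on the disc of radius 1/2 around 1. Then \<open>v\<close> below is an N-th root of unity at
    points where F is not 0, and v = 1 singles out the sheet of \<open>x\<close>.\<close>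
  define F where "F y = (1 / f j x) * f j y" for y
  have FB: "F \<in> B" unfolding F_def[abs_def] by (rule B_cmult[OF f_in_B])
  have Fx: "F x = 1" using False by (simp add: F_def)
  define g where "g t = t powr (- q)" for t :: complex
  have hol: "g holomorphic_on ball 1 (1/2)" unfolding g_def
  proof (intro holomorphic_intros)
    fix z :: complex assume "z \<in> ball 1 (1/2)"
    then have "\<bar>Re (1 - z)\<bar> < 1/2" using abs_Re_le_cmod[of "1 - z"] by (simp add: dist_norm)
    then show "z \<notin> \<real>\<^sub>\<le>\<^sub>0" by (auto simp: complex_nonpos_Reals_iff)
  qed
  define v where "v y = (1 / a) * y (2 * j + 1) * g (F y)" for y
  have v_pow: "v y ^ N j = 1" if y: "y \<in> S" "F y \<noteq> 0" for y
  proof -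
    have "g (F y) ^ N j = F y powr (of_nat (N j) * (- q))"
      using y(2) unfolding g_def powr_def by (simp add: exp_of_nat_mult[symmetric] mult.assoc)
    also have "of_nat (N j) * (- q) = -1" using N_pos[of j] by (simp add: q_def)
    finally have "g (F y) ^ N j = inverse (F y)" using y(2) by (simp add: powr_minus)
    moreover have "((1 / a) * y (2 * j + 1)) ^ N j = F y"
      using S_root[OF y(1), of j] by (simp add: power_mult_distrib power_divide aN F_def)
    ultimately show ?thesis using y(2) unfolding v_def by (simp only: power_mult_distrib[of _ "g (F y)"]) simp
  qed
  have v_one: "dist (y (2 * j + 1)) (x (2 * j + 1)) < \<eta>" if y: "dist (F y) 1 < d" "F y \<noteq> 0" "v y = 1" for y
  proof -
    have "(1 / a) * y (2 * j + 1) = F y powr q"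
      using y(2,3) by (simp add: v_def g_def powr_minus field_simps)
    then have "y (2 * j + 1) = a * F y powr q" using a0 by (simp add: field_simps)
    then have "dist (y (2 * j + 1)) a = cmod a * dist (F y powr q) 1"
      by (simp add: dist_norm norm_mult[symmetric] algebra_simps)
    also have "\<dots> < cmod a * (\<eta> / cmod a)" using d(2)[OF y(1)] a0 by (intro mult_strict_left_mono) auto
    finally show ?thesis using a0 by (simp add: a_def)
  qed
  from coord_alg_box_continuous[OF f_alg S_base[OF x], of "r' * cmod (f j x)" j] r'(1) False obtain m r where
    m: "r > 0" "\<And>y. y \<in> base_space Kc \<Longrightarrow> (\<forall>n<m. dist (y (2 * n)) (x (2 * n)) < r) \<Longrightarrow> dist (f j y) (f j x) < r' * cmod (f j x)"
    by auto
  have box: "dist (F y) 1 < r'" if y: "y \<in> S" "\<not> (\<exists>n<m. r \<le> dist (y (2 * n)) (x (2 * n)))" for y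
  proof -
    have "F y - 1 = (f j y - f j x) / f j x" using False by (simp add: F_def field_simps)
    then have "dist (F y) 1 = dist (f j y) (f j x) / cmod (f j x)" by (simp add: dist_norm norm_divide)
    also have "\<dots> < r'" using m(2)[OF S_base[OF y(1)]] y(2) False by (simp add: divide_less_eq not_le)
    finally show ?thesis .
  qed
  have nz: "F y \<noteq> 0" if "dist (F y) 1 < r'" for y using that r'(3) by auto
  show ?thesis unfolding can_shrink_def
  proof (intro exI[of _ m] exI[of _ r] conjI ballI impI m(1))
    fix u assume u: "u \<in> B" and supp: "supp_box x m r u"
    have u0: "u y = 0" if "y \<in> S" "r' \<le> dist (F y) 1" for y
      using box[OF that(1)] that supp unfolding supp_box_def by force
    \<comment> \<open>No claim is made that \<open>v\<close> itself lies in \<open>B\<close>.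
      Multiplied by \<open>u\<close>, whose support lies where F is close to 1, each power of
      \<open>v\<close> does so by the functional calculus.\<close>
    have V: "(\<lambda>y. u y * v y ^ i) \<in> B" for i
    proof (induction i)
      case 0 then show ?case using u by simp
    next
      case (Suc i)
      have "(\<lambda>y. (u y * v y ^ i * ((1 / a) * y (2 * j + 1))) * g (F y)) \<in> B"
      proof (rule uclosure_power_series[OF function_algebra_Alg FB _ _ _ hol])
        show "(\<lambda>y. u y * v y ^ i * ((1 / a) * y (2 * j + 1))) \<in> B"
          by (intro B_alg(3) Suc B_cmult root_in_B)
        show "u y * v y ^ i * ((1 / a) * y (2 * j + 1)) = 0" if "y \<in> S" "r' < dist (F y) 1" for y
          using u0[OF that(1)] that(2) by simp
      qed (use r' in auto)
      then show ?case by (simp add: v_def mult_ac)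
    qed
    define u' where "u' y = (1 / of_nat (N j)) * (\<Sum>i<N j. u y * v y ^ i)" for y
    have Vs: "(\<lambda>y. \<Sum>i<M. u y * v y ^ i) \<in> B" for M
    proof (induction M)
      case 0 then show ?case using B_alg(1)[of 0] by simp
    next
      case (Suc M) then show ?case using B_alg(2)[OF Suc V[of M]] by simp
    qed
    have u'B: "u' \<in> B" unfolding u'_def[abs_def] by (intro B_cmult Vs)
    have u'e: "u' y = (if v y = 1 then u y else 0)" if y: "y \<in> S" "u y \<noteq> 0" for y
    proof -
      have "dist (F y) 1 < r'" using u0[OF y(1)] y(2) by force
      then have "v y ^ N j = 1" using v_pow[OF y(1) nz] by simp
      then have "(\<Sum>i<N j. v y ^ i) = (if v y = 1 then of_nat (N j) else 0)"
        by (rule sum_powers_root_of_unity[OF N_pos])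
      then show ?thesis using N_pos[of j] by (simp add: u'_def sum_distrib_left[symmetric])
    qed
    have u'0: "u' y = 0" if "u y = 0" for y using that by (simp add: u'_def)
    show "\<exists>u'\<in>B. shrinks x (\<lambda>y. \<eta> \<le> dist (y (2 * j + 1)) (x (2 * j + 1))) u u'"
      unfolding shrinks_def
    proof (intro bexI[OF _ u'B] conjI ballI impI)
      show "cmod (u' y) \<le> cmod (u y)" if "y \<in> S" for y
        using u'e[OF that] u'0[of y] by (cases "u y = 0") auto
      show "u' y = 0" if y: "y \<in> S" "\<eta> \<le> dist (y (2 * j + 1)) (x (2 * j + 1))" for y
      proof (cases "u y = 0")
        case True then show ?thesis by (rule u'0)
      next
        case False
        then have "dist (F y) 1 < r'" using u0[OF y(1)] by force
        then have "v y \<noteq> 1" using v_one[of y] nz[of y] r'(2) y(2) by force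
        then show ?thesis using u'e[OF y(1) False] by simp
      qed
      \<comment> \<open>Near \<open>x\<close> the function \<open>v\<close> is continuous with v x =
        1, and on the support of \<open>u\<close> its values are N-th roots of unity; so it is 1
        there and u' = u.\<close>
      obtain \<delta> where \<delta>: "\<delta> > 0" "\<And>z::complex. z ^ N j = 1 \<Longrightarrow> dist z 1 < \<delta> \<Longrightarrow> z = 1"
        using root_of_unity_isolated[OF N_pos] by blast
      have cont: "continuous_on {y \<in> S. dist (F y) 1 < 1/2} v"
      proof -
        have "continuous_on {y \<in> S. dist (F y) 1 < 1/2} F" using B_continuous_on[OF FB] by (rule continuous_on_subset) auto
        then have "continuous_on {y \<in> S. dist (F y) 1 < 1/2} (\<lambda>y. g (F y))"
          by (intro continuous_on_compose2[OF holomorphic_on_imp_continuous_on[OF hol]]) (auto simp: dist_commute)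
        then show ?thesis unfolding v_def by (intro continuous_intros continuous_on_coord)
      qed
      have "v x = (1 / a) * a * g 1" unfolding v_def Fx a_def by (rule refl)
      then have vx: "v x = 1" using a0 by (simp add: g_def)
      have "x \<in> {y \<in> S. dist (F y) 1 < 1/2}" using x Fx by simp
      from near_continuous[OF cont this \<delta>(1)]
      have "near {y \<in> S. dist (F y) 1 < 1/2} x (\<lambda>y. dist (v y) 1 < \<delta>)" unfolding vx .
      then show "near S x (\<lambda>y. u' y = u y)"
        unfolding near_def
      proof (rule eventually_mono, intro impI)
        fix y assume 1: "y \<in> {y \<in> S. dist (F y) 1 < 1/2} \<longrightarrow> dist (v y) 1 < \<delta>" and y: "y \<in> S"
        show "u' y = u y"
        proof (cases "u y = 0")
          case True then show ?thesis using u'0 by simp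
        next
          case False
          then have F: "dist (F y) 1 < r'" using u0[OF y] by force
          then have "dist (v y) 1 < \<delta>" using 1 y r' by auto
          then have "v y = 1" using \<delta>(2)[OF v_pow[OF y nz[OF F]]] by simp
          then show ?thesis using u'e[OF y False] by simp
        qed
      qed
    qed
  qed
qed

text \<open>Each removal keeps |u1| <= |u|, so the support condition required for the next removal
  persists.\<close>

lemma sheets_cut:
  assumes x: "x \<in> S" and eta: "0 < \<eta>"
  shows "can_shrink x (\<lambda>y. \<exists>j<M. \<eta> \<le> dist (y (2 * j + 1)) (x (2 * j + 1)))"
proof (induction M)
  case 0
  have "shrinks x (\<lambda>y. \<exists>j<0. \<eta> \<le> dist (y (2 * j + 1)) (x (2 * j + 1))) u u" for u
    by (simp add: shrinks_def near_def)
  then show ?case unfolding can_shrink_def by (meson zero_less_one)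
next
  case (Suc M)
  let ?P = "\<lambda>y. \<exists>j<M. \<eta> \<le> dist (y (2 * j + 1)) (x (2 * j + 1))"
  let ?P' = "\<lambda>y. \<eta> \<le> dist (y (2 * M + 1)) (x (2 * M + 1))"
  obtain m1 r1 where 1: "r1 > 0" "\<And>u. u \<in> B \<Longrightarrow> supp_box x m1 r1 u \<Longrightarrow> \<exists>u'\<in>B. shrinks x ?P u u'"
    using Suc unfolding can_shrink_def by auto
  obtain m2 r2 where 2: "r2 > 0" "\<And>u. u \<in> B \<Longrightarrow> supp_box x m2 r2 u \<Longrightarrow> \<exists>u'\<in>B. shrinks x ?P' u u'"
    using sheet_cut[OF x eta, of M] unfolding can_shrink_def by auto
  have "\<exists>u'\<in>B. shrinks x (\<lambda>y. \<exists>j<Suc M. \<eta> \<le> dist (y (2 * j + 1)) (x (2 * j + 1))) u u'"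
    if u: "u \<in> B" and s: "supp_box x (max m1 m2) (min r1 r2) u" for u
  proof -
    have "supp_box x m1 r1 u" by (rule supp_box_mono[OF s]) auto
    from 1(2)[OF u this] obtain u1 where u1: "u1 \<in> B" "shrinks x ?P u u1" by blast
    have "supp_box x m2 r2 u" by (rule supp_box_mono[OF s]) auto
    then have "supp_box x m2 r2 u1" using u1(2) unfolding supp_box_def shrinks_def by fastforce
    from 2(2)[OF u1(1) this] obtain u2 where u2: "u2 \<in> B" "shrinks x ?P' u1 u2" by blast
    have "shrinks x (\<lambda>y. \<exists>j<Suc M. \<eta> \<le> dist (y (2 * j + 1)) (x (2 * j + 1))) u u2"
      unfolding shrinks_def
    proof (intro conjI ballI impI)
      have le: "cmod (u2 y) \<le> cmod (u1 y)" "cmod (u1 y) \<le> cmod (u y)" if "y \<in> S" for y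
        using u1(2) u2(2) that unfolding shrinks_def by auto
      show "cmod (u2 y) \<le> cmod (u y)" if "y \<in> S" for y using le[OF that] by linarith
      have "near S x (\<lambda>y. u1 y = u y)" "near S x (\<lambda>y. u2 y = u1 y)" using u1(2) u2(2) unfolding shrinks_def by auto
      from near_conj[OF this] show "near S x (\<lambda>y. u2 y = u y)" by (rule near_mono) simp
      fix y assume y: "y \<in> S" "\<exists>j<Suc M. \<eta> \<le> dist (y (2 * j + 1)) (x (2 * j + 1))"
      then consider "?P y" | "?P' y" using less_Suc_eq by auto
      then show "u2 y = 0"
      proof cases
        case 1
        then have "u1 y = 0" using u1(2) y(1) unfolding shrinks_def by blast
        then show ?thesis using le(1)[OF y(1)] by simp
      next
        case 2
        then show ?thesis using u2(2) y(1) unfolding shrinks_def by blast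
      qed
    qed
    then show ?thesis using u2(1) by (intro bexI[of _ u2])
  qed
  moreover have "0 < min r1 r2" using 1(1) 2(1) by simp
  ultimately show ?case unfolding can_shrink_def by blast
qed

text \<open>A basic neighbourhood constrains finitely many coordinates: the even ones are handled by
  the support in a box, the odd ones by the removal of sheets.\<close>

lemma refine_cut:
  assumes x: "x \<in> S" and W: "open W" "x \<in> W"
  shows "can_shrink x (\<lambda>y. y \<notin> W)"
proof -
  obtain M e where M: "e > 0" "\<And>y. (\<forall>i<M. dist (y i) (x i) < e) \<Longrightarrow> y \<in> W" using open_fun_box[OF W] by blast
  let ?P = "\<lambda>y. \<exists>j<M. e \<le> dist (y (2 * j + 1)) (x (2 * j + 1))"
  obtain m1 r1 where 1: "r1 > 0" "\<And>u. u \<in> B \<Longrightarrow> supp_box x m1 r1 u \<Longrightarrow> \<exists>u'\<in>B. shrinks x ?P u u'"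
    using sheets_cut[OF x M(1), of M] unfolding can_shrink_def by auto
  have "\<exists>u'\<in>B. shrinks x (\<lambda>y. y \<notin> W) u u'"
    if u: "u \<in> B" and s: "supp_box x (max m1 M) (min r1 e) u" for u
  proof -
    have "supp_box x m1 r1 u" by (rule supp_box_mono[OF s]) auto
    from 1(2)[OF u this] obtain u1 where u1: "u1 \<in> B" "shrinks x ?P u u1" by blast
    have "u1 y = 0" if y: "y \<in> S" "y \<notin> W" for y
    proof -
      obtain i where i: "i < M" "e \<le> dist (y i) (x i)" using M(2)[of y] y(2) by (meson linorder_not_less)
      show ?thesis
      proof (cases "even i")
        case True
        then obtain n where n: "i = 2 * n" by blast
        then have "n < max m1 M" "min r1 e \<le> dist (y (2 * n)) (x (2 * n))" using i by auto
        then have "u y = 0" using s y(1) unfolding supp_box_def by blast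
        then show ?thesis using u1(2) y(1) unfolding shrinks_def by fastforce
      next
        case False
        then obtain j where j: "i = 2 * j + 1" by (rule oddE)
        then have "j < M" "e \<le> dist (y (2 * j + 1)) (x (2 * j + 1))" using i by auto
        then show ?thesis using u1(2) y(1) unfolding shrinks_def by blast
      qed
    qed
    then have "shrinks x (\<lambda>y. y \<notin> W) u u1" using u1(2) unfolding shrinks_def by blast
    then show ?thesis using u1(1) by (intro bexI[of _ u1])
  qed
  moreover have "0 < min r1 e" using 1(1) M(1) by simp
  ultimately show ?thesis unfolding can_shrink_def by blast
qed

text \<open>Off \<open>L\<close> one starts from an adjoined root divided by its value at
  \<open>x\<close>, which has modulus 1; this function is bounded by 3/2 and vanishes wherever
  \<open>f k\<close> does. On \<open>L\<close> one starts from a product of planar cut-offs, whose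
  norm is not controlled.\<close>

theorem local_cut:
  assumes x: "x \<in> S" and W: "open W" "x \<in> W"
  shows "\<exists>u\<in>B. near S x (\<lambda>y. u y = 1) \<and> (\<forall>y\<in>S - W. u y = 0) \<and> (\<not> roots_at x \<longrightarrow> (\<forall>y\<in>S. cmod (u y) \<le> 3/2))"
proof -
  obtain m r where m: "r > 0" "\<And>u. u \<in> B \<Longrightarrow> supp_box x m r u \<Longrightarrow> \<exists>u'\<in>B. shrinks x (\<lambda>y. y \<notin> W) u u'"
    using refine_cut[OF x W] unfolding can_shrink_def by auto
  have "\<exists>u\<in>B. near S x (\<lambda>y. u y = 1) \<and> supp_box x m r u \<and>
     (\<not> roots_at x \<longrightarrow> (\<forall>y\<in>S. cmod (u y) \<le> 3/2))"
  proof (cases "roots_at x")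
    case True
    from box_cut[OF S_base[OF x] m(1), of m] obtain us s where us: "\<forall>n<length us. us ! n \<in> U n" "s > 0"
      "\<And>y. y \<in> base_space Kc \<Longrightarrow> (\<forall>n<m. dist (y (2 * n)) (x (2 * n)) < s) \<Longrightarrow> box_fun us y = 1"
      "\<And>y. y \<in> base_space Kc \<Longrightarrow> (\<exists>n<m. r \<le> dist (y (2 * n)) (x (2 * n))) \<Longrightarrow> box_fun us y = 0" by blast
    have "box_fun us \<in> B" using coord_alg_mono[OF box_fun_coord_alg[OF us(1)]] Alg_subset_B unfolding Alg_def by blast
    moreover have "near S x (\<lambda>y. box_fun us y = 1)"
      by (rule near_mono[OF near_box[OF us(2)]]) (use us(3) S_base in blast)
    moreover have "supp_box x m r (box_fun us)" using us(4) S_base unfolding supp_box_def by blast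
    ultimately show ?thesis using True by (intro bexI[of _ "box_fun us"]) auto
  next
    case False
    from f_cut[OF S_base[OF x] False m(1), of m] obtain k m' s where k: "s > 0"
      "\<And>y. y \<in> base_space Kc \<Longrightarrow> (\<forall>n<m'. dist (y (2 * n)) (x (2 * n)) < s) \<Longrightarrow> f k y = 1"
      "\<And>y. y \<in> base_space Kc \<Longrightarrow> (\<exists>n<m. r \<le> dist (y (2 * n)) (x (2 * n))) \<Longrightarrow> f k y = 0" by blast
    define a where "a = x (2 * k + 1)"
    have "f k x = 1" using k(1) by (intro k(2) S_base[OF x]) auto
    then have aN: "a ^ N k = 1" using S_root[OF x, of k] by (simp add: a_def)
    then have "cmod a ^ N k = 1" by (metis norm_one norm_power)
    then have ca: "cmod a = 1" using N_pos[of k] power_eq_imp_eq_base[of "cmod a" "N k" 1] by simp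
    define Y where "Y y = (1 / a) * y (2 * k + 1)" for y
    have YB: "Y \<in> B" unfolding Y_def[abs_def] by (intro B_cmult root_in_B)
    obtain \<delta> where \<delta>: "\<delta> > 0" "\<And>z::complex. z ^ N k = 1 \<Longrightarrow> dist z 1 < \<delta> \<Longrightarrow> z = 1"
      using root_of_unity_isolated[OF N_pos] by blast
    have Yx: "Y x = 1" using ca by (auto simp: Y_def a_def)
    have "near S x (\<lambda>y. dist (Y y) 1 < \<delta>)" using near_continuous[OF B_continuous_on[OF YB] x \<delta>(1)] Yx by simp
    from near_conj[OF this near_box[OF k(1), of x m']] have "near S x (\<lambda>y. Y y = 1)"
    proof (rule near_mono)
      fix y assume y: "y \<in> S" and h: "dist (Y y) 1 < \<delta> \<and> (\<forall>n<m'. dist (y (2 * n)) (x (2 * n)) < s)"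
      have "f k y = 1" using k(2)[OF S_base[OF y]] h by blast
      then have "Y y ^ N k = 1" using S_root[OF y, of k] by (simp add: Y_def power_mult_distrib power_divide aN)
      then show "Y y = 1" using \<delta>(2) h by blast
    qed
    moreover have "Y y = 0" if "y \<in> S" "\<exists>n<m. r \<le> dist (y (2 * n)) (x (2 * n))" for y
      using k(3)[OF S_base[OF that(1)] that(2)] S_root[OF that(1), of k] N_pos[of k] by (simp add: Y_def)
    then have "supp_box x m r Y" unfolding supp_box_def by blast
    moreover have "cmod (Y y) \<le> 3/2" if "y \<in> S" for y
      using S_root_bound[OF that, of k] ca by (simp add: Y_def norm_mult norm_divide)
    ultimately show ?thesis using YB by (intro bexI[of _ Y]) auto
  qed
  then obtain u where u: "u \<in> B" "near S x (\<lambda>y. u y = 1)" "supp_box x m r u"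
    "\<not> roots_at x \<longrightarrow> (\<forall>y\<in>S. cmod (u y) \<le> 3/2)" by blast
  from m(2)[OF u(1,3)] obtain u' where u'B: "u' \<in> B" and "shrinks x (\<lambda>y. y \<notin> W) u u'" by blast
  then have u': "\<And>y. y \<in> S \<Longrightarrow> cmod (u' y) \<le> cmod (u y)" "near S x (\<lambda>y. u' y = u y)"
    "\<And>y. y \<in> S - W \<Longrightarrow> u' y = 0" unfolding shrinks_def by blast+
  show ?thesis
  proof (intro bexI[OF _ u'B] conjI impI ballI)
    show "near S x (\<lambda>y. u' y = 1)" by (rule near_mono[OF near_conj[OF u(2) u'(2)]]) simp
    show "cmod (u' y) \<le> 3/2" if "\<not> roots_at x" "y \<in> S" for y using u(4) u'(1)[OF that(2)] that by force
  qed (use u'(3) in auto)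
qed

end

section \<open>Uniform algebras with cut-off functions\<close>

lemma function_ring_sel [simp]:
  "carrier (function_ring X C) = C"
  "f \<otimes>\<^bsub>function_ring X C\<^esub> g = (\<lambda>x\<in>topspace X. f x * g x)"
  "\<one>\<^bsub>function_ring X C\<^esub> = (\<lambda>x\<in>topspace X. 1)"
  "\<zero>\<^bsub>function_ring X C\<^esub> = (\<lambda>x\<in>topspace X. 0)"
  "f \<oplus>\<^bsub>function_ring X C\<^esub> g = (\<lambda>x\<in>topspace X. f x + g x)"
  by (simp_all add: function_ring_def)

definition ext_algebra :: "'a topology \<Rightarrow> ('a \<Rightarrow> complex) set \<Rightarrow> bool"
  where "ext_algebra X C \<longleftrightarrow> C \<subseteq> extensional (topspace X) \<and> (\<forall>c. (\<lambda>x\<in>topspace X. c) \<in> C) \<and>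
    (\<forall>f\<in>C. \<forall>g\<in>C. (\<lambda>x\<in>topspace X. f x + g x) \<in> C) \<and> (\<forall>f\<in>C. \<forall>g\<in>C. (\<lambda>x\<in>topspace X. f x * g x) \<in> C)"

lemma ext_algebraD:
  assumes "ext_algebra X C"
  shows "f \<in> C \<Longrightarrow> f \<in> extensional (topspace X)" "(\<lambda>x\<in>topspace X. c) \<in> C"
    "f \<in> C \<Longrightarrow> g \<in> C \<Longrightarrow> (\<lambda>x\<in>topspace X. f x + g x) \<in> C"
    "f \<in> C \<Longrightarrow> g \<in> C \<Longrightarrow> (\<lambda>x\<in>topspace X. f x * g x) \<in> C"
  using assms unfolding ext_algebra_def by auto

lemma ext_algebra_cmult:
  assumes "ext_algebra X C" "f \<in> C" shows "(\<lambda>x\<in>topspace X. c * f x) \<in> C"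
proof -
  have "(\<lambda>x\<in>topspace X. (\<lambda>x\<in>topspace X. c) x * f x) \<in> C"
    by (intro ext_algebraD[OF assms(1)] assms(2))
  moreover have "(\<lambda>x\<in>topspace X. (\<lambda>x\<in>topspace X. c) x * f x) = (\<lambda>x\<in>topspace X. c * f x)" by (auto simp: restrict_def)
  ultimately show ?thesis by simp
qed

lemma cring_function_ring:
  assumes C: "ext_algebra X C" shows "cring (function_ring X C)"
proof (rule cringI)
  note D = ext_algebraD[OF C]
  have ext: "f = g" if "f \<in> C" "g \<in> C" "\<And>x. x \<in> topspace X \<Longrightarrow> f x = g x" for f g
    using D(1)[OF that(1)] D(1)[OF that(2)] that(3) by (rule extensionalityI)
  show "abelian_group (function_ring X C)"
  proof (rule abelian_groupI)
    fix f assume f: "f \<in> carrier (function_ring X C)"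
    have "(\<lambda>x\<in>topspace X. - 1 * f x) \<in> C" using ext_algebra_cmult[OF C, of f "- 1"] f by simp
    then show "\<exists>g\<in>carrier (function_ring X C). g \<oplus>\<^bsub>function_ring X C\<^esub> f = \<zero>\<^bsub>function_ring X C\<^esub>"
      by (intro bexI[of _ "\<lambda>x\<in>topspace X. - 1 * f x"]) (auto simp: restrict_def)
    show "\<zero>\<^bsub>function_ring X C\<^esub> \<oplus>\<^bsub>function_ring X C\<^esub> f = f"
      using D(1)[of f] f by (auto intro!: extensionalityI[of _ "topspace X"])
  qed (use D in \<open>auto simp: restrict_def algebra_simps\<close>)
  show "Group.comm_monoid (function_ring X C)"
  proof (rule comm_monoidI)
    fix f assume f: "f \<in> carrier (function_ring X C)"
    show "\<one>\<^bsub>function_ring X C\<^esub> \<otimes>\<^bsub>function_ring X C\<^esub> f = f"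
      using D(1)[of f] f by (auto intro!: extensionalityI[of _ "topspace X"])
  qed (use D in \<open>auto simp: restrict_def algebra_simps\<close>)
  fix f g h assume "f \<in> carrier (function_ring X C)" "g \<in> carrier (function_ring X C)" "h \<in> carrier (function_ring X C)"
  then show "(f \<oplus>\<^bsub>function_ring X C\<^esub> g) \<otimes>\<^bsub>function_ring X C\<^esub> h =
      f \<otimes>\<^bsub>function_ring X C\<^esub> h \<oplus>\<^bsub>function_ring X C\<^esub> g \<otimes>\<^bsub>function_ring X C\<^esub> h"
    by (auto simp: restrict_def algebra_simps)
qed

lemma function_ring_a_inv:
  assumes C: "ext_algebra X C" and f: "f \<in> C"
  shows "\<ominus>\<^bsub>function_ring X C\<^esub> f = (\<lambda>x\<in>topspace X. - f x)"
proof -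
  interpret cring "function_ring X C" by (rule cring_function_ring[OF C])
  have "(\<lambda>x\<in>topspace X. - 1 * f x) \<in> C" by (rule ext_algebra_cmult[OF C f])
  then show ?thesis using f by (intro minus_equality) (auto simp: restrict_def)
qed

lemma function_ring_idealI:
  assumes C: "ext_algebra X C" and I: "I \<subseteq> C" "(\<lambda>x\<in>topspace X. 0) \<in> I"
    and add: "\<And>f g. f \<in> I \<Longrightarrow> g \<in> I \<Longrightarrow> (\<lambda>x\<in>topspace X. f x + g x) \<in> I"
    and mult: "\<And>f g. f \<in> I \<Longrightarrow> g \<in> C \<Longrightarrow> (\<lambda>x\<in>topspace X. g x * f x) \<in> I"
  shows "ideal I (function_ring X C)"
proof -
  interpret cring "function_ring X C" by (rule cring_function_ring[OF C])
  show ?thesis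
  proof (rule idealI)
    show "ring (function_ring X C)" by (rule ring_axioms)
    show "subgroup I (add_monoid (function_ring X C))"
    proof (rule group.subgroupI)
      show "Group.group (add_monoid (function_ring X C))" by (rule add.is_group)
      show "I \<noteq> {}" using I(2) by auto
      fix f assume f: "f \<in> I"
      have "(\<lambda>x\<in>topspace X. (\<lambda>x\<in>topspace X. - 1) x * f x) \<in> I" by (intro mult f ext_algebraD[OF C])
      moreover have "(\<lambda>x\<in>topspace X. (\<lambda>x\<in>topspace X. - 1) x * f x) = (\<lambda>x\<in>topspace X. - f x)"
        by (rule restrict_ext) simp
      moreover have "f \<in> C" using f I(1) by blast
      ultimately have "\<ominus>\<^bsub>function_ring X C\<^esub> f \<in> I" using function_ring_a_inv[OF C, of f] by simp
      then show "inv\<^bsub>add_monoid (function_ring X C)\<^esub> f \<in> I" by (simp add: a_inv_def)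
    qed (use I add in auto)
    fix f g assume fg: "f \<in> I" "g \<in> carrier (function_ring X C)"
    then show "g \<otimes>\<^bsub>function_ring X C\<^esub> f \<in> I" using mult by simp
    have "f \<otimes>\<^bsub>function_ring X C\<^esub> g = g \<otimes>\<^bsub>function_ring X C\<^esub> f" by (simp add: mult.commute)
    then show "f \<otimes>\<^bsub>function_ring X C\<^esub> g \<in> I" using mult fg by simp
  qed
qed

text \<open>If every ball around f met I, members of I would approximate f uniformly. This reduces
  closedness to pointwise estimates and hides the metric of bounded functions.\<close>

lemma closedin_C_metric:
  assumes I: "I \<subseteq> C_space X"
    and lim: "\<And>f. f \<in> C_space X \<Longrightarrow> (\<And>e. 0 < e \<Longrightarrow> \<exists>g\<in>I. \<forall>x\<in>topspace X. cmod (f x - g x) \<le> e) \<Longrightarrow> f \<in> I"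
  shows "closedin (mtopology_of (C_metric X)) I"
  unfolding mtopology_of_def Metric_space.closedin_metric[OF Metric_space_mspace_mdist]
proof (intro conjI I allI impI)
  fix f assume f: "f \<in> C_space X - I"
  show "\<exists>r>0. disjnt I (Metric_space.mball (C_space X) (mdist (C_metric X)) f r)"
  proof (rule ccontr)
    assume neg: "\<not> ?thesis"
    have "f \<in> I"
    proof (rule lim)
      fix e :: real assume "0 < e"
      then obtain g where g: "g \<in> I" "g \<in> Metric_space.mball (C_space X) (mdist (C_metric X)) f e"
        using neg unfolding disjnt_iff by blast
      then have gm: "mdist (C_metric X) f g \<le> e" "g \<in> C_space X"
        unfolding Metric_space.in_mball[OF Metric_space_mspace_mdist] by (blast intro: less_imp_le)+
      then have "mdist euclidean_metric (f x) (g x) \<le> e" if "x \<in> topspace X" for x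
        using mdist_cfunspace_imp_mdist_le[OF _ gm(2,1) that] f by blast
      then show "\<exists>g\<in>I. \<forall>x\<in>topspace X. cmod (f x - g x) \<le> e" using g(1) by (auto simp: dist_norm)
    qed (use f in auto)
    then show False using f by blast
  qed
qed

section \<open>Naturality, normality and primary ideals from local cut-offs\<close>

text \<open>\<open>character_eval\<close> offers multiplicativity, dependence on the values on
  \<open>S\<close> and the norm bound, and asks for evaluation on the dense algebra \<open>A\<close>
  only. The norm bound and the passage to the closure are settled once for all in
  \<open>character_eval_BB\<close>.\<close>

locale function_alg_on =
  fixes S :: "'a::metric_space set" and A :: "('a \<Rightarrow> complex) set"
  assumes compact: "compact S" and alg: "function_algebra S A"
    and cont: "\<And>g. g \<in> A \<Longrightarrow> continuous_on S g"
    and local_cut: "\<And>x W. x \<in> S \<Longrightarrow> open W \<Longrightarrow> x \<in> W \<Longrightarrow>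
      \<exists>u\<in>uclosure S A. near S x (\<lambda>y. u y = 1) \<and> (\<forall>y\<in>S - W. u y = 0)"
    and character_eval: "\<And>\<psi>.
      (\<And>f g. f \<in> uclosure S A \<Longrightarrow> g \<in> uclosure S A \<Longrightarrow> \<psi> (\<lambda>x. f x + g x) = \<psi> f + \<psi> g) \<Longrightarrow>
      (\<And>f g. f \<in> uclosure S A \<Longrightarrow> g \<in> uclosure S A \<Longrightarrow> \<psi> (\<lambda>x. f x * g x) = \<psi> f * \<psi> g) \<Longrightarrow>
      (\<And>c. \<psi> (\<lambda>x. c) = (c::complex)) \<Longrightarrow>
      (\<And>f g. f \<in> uclosure S A \<Longrightarrow> (\<And>x. x \<in> S \<Longrightarrow> f x = g x) \<Longrightarrow> \<psi> f = \<psi> g) \<Longrightarrow>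
      (\<And>f M. f \<in> uclosure S A \<Longrightarrow> (\<And>x. x \<in> S \<Longrightarrow> cmod (f x) \<le> M) \<Longrightarrow> 0 \<le> M \<Longrightarrow> cmod (\<psi> f) \<le> M) \<Longrightarrow>
      \<exists>p\<in>S. \<forall>g\<in>A. \<psi> g = g p"
begin

abbreviation "UA \<equiv> uclosure S A"
abbreviation "X \<equiv> top_of_set S"

definition BB :: "('a \<Rightarrow> complex) set" where "BB = {g \<in> extensional S. g \<in> UA}"

lemmas UA_alg = function_algebraD[OF function_algebra_uclosure[OF alg]]

lemma UA_continuous_on: "g \<in> UA \<Longrightarrow> continuous_on S g"
  by (rule uclosure_continuous_on[OF _ cont])

lemma UA_cong: "f \<in> UA \<Longrightarrow> (\<And>x. x \<in> S \<Longrightarrow> f x = g x) \<Longrightarrow> g \<in> UA"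
  by (rule uclosure_cong)

lemma restrict_BB: "g \<in> UA \<Longrightarrow> restrict g S \<in> BB"
  unfolding BB_def using UA_cong[of g "restrict g S"] by auto

lemma BB_UA: "g \<in> BB \<Longrightarrow> g \<in> UA" and BB_ext: "g \<in> BB \<Longrightarrow> g \<in> extensional S"
  by (simp_all add: BB_def)

lemma ext_algebra_BB: "ext_algebra X BB"
  unfolding ext_algebra_def
  by (auto simp: BB_UA BB_ext intro!: restrict_BB UA_alg)

lemma compact_space_X: "compact_space X"
  using compact by (simp add: compact_space_subtopology)

lemma C_space_X: "C_space X = {f \<in> extensional S. continuous_on S f}"
  using C_space_compact[OF compact_space_X] by simp

lemma BB_subset_C: "BB \<subseteq> C_space X"
  unfolding C_space_X BB_def using UA_continuous_on by auto

lemma ext_algebra_C: "ext_algebra X (C_space X)"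
  unfolding ext_algebra_def C_space_X
  by (auto intro!: continuous_intros cong: continuous_on_cong_simp)

lemma separates: "x \<in> S \<Longrightarrow> y \<in> S \<Longrightarrow> x \<noteq> y \<Longrightarrow> \<exists>f\<in>UA. f x = 1 \<and> f y = 0"
proof -
  assume xy: "x \<in> S" "y \<in> S" "x \<noteq> y"
  have "open (- {y})" "x \<in> - {y}" using xy by (auto simp: open_Compl)
  from local_cut[OF xy(1) this] obtain u where "u \<in> UA" "near S x (\<lambda>y. u y = 1)" "\<forall>z\<in>S - - {y}. u z = 0" by blast
  then show ?thesis using near_self[of S x] xy by (intro bexI[of _ u]) auto
qed

lemma uniform_algebra_BB: "uniform_algebra X BB"
  unfolding uniform_algebra_def
proof (intro conjI allI ballI impI)
  show "compact_space X" by (rule compact_space_X)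
  show "Hausdorff_space X" by (simp add: Hausdorff_space_subtopology)
  interpret C: cring "function_ring X (C_space X)" by (rule cring_function_ring[OF ext_algebra_C])
  show "subring BB (function_ring X (C_space X))"
  proof (rule C.subringI)
    show "\<ominus>\<^bsub>function_ring X (C_space X)\<^esub> f \<in> BB" if f: "f \<in> BB" for f
      using function_ring_a_inv[OF ext_algebra_C, of f] BB_subset_C f ext_algebra_cmult[OF ext_algebra_BB f, of "- 1"]
      by (auto simp: subset_iff)
  qed (use BB_subset_C ext_algebraD[OF ext_algebra_BB] in auto)
  show "(\<lambda>x\<in>topspace X. c) \<in> BB" for c by (rule ext_algebraD[OF ext_algebra_BB])
  show "closedin (mtopology_of (C_metric X)) BB"
  proof (rule closedin_C_metric[OF BB_subset_C])
    fix f assume f: "f \<in> C_space X" and lim: "\<And>e. 0 < e \<Longrightarrow> \<exists>g\<in>BB. \<forall>x\<in>topspace X. cmod (f x - g x) \<le> e"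
    have "f \<in> UA"
    proof (rule uclosure_limit)
      fix e :: real assume "0 < e"
      from lim[OF this] obtain g where "g \<in> BB" "\<forall>x\<in>S. cmod (f x - g x) \<le> e" by auto
      then show "\<exists>g\<in>UA. \<forall>x\<in>S. cmod (f x - g x) \<le> e" using BB_UA by blast
    qed
    then show "f \<in> BB" using f unfolding C_space_X BB_def by auto
  qed
  fix x y assume "x \<in> topspace X" "y \<in> topspace X" "x \<noteq> y"
  then obtain g where "g \<in> UA" "g x = 1" "g y = 0" "x \<in> S" "y \<in> S" using separates[of x y] by auto
  then show "\<exists>f\<in>BB. f x \<noteq> f y" using restrict_BB by (intro bexI[of _ "restrict g S"]) auto
qed

lemma character_eval_BB:
  assumes phi: "\<phi> \<in> characters X BB"
  shows "\<exists>p\<in>S. \<forall>g\<in>BB. \<phi> g = g p"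
proof -
  define \<psi> where "\<psi> g = \<phi> (restrict g S)" for g
  have ch: "f \<in> BB \<Longrightarrow> g \<in> BB \<Longrightarrow> \<phi> (\<lambda>x\<in>S. f x + g x) = \<phi> f + \<phi> g"
    "f \<in> BB \<Longrightarrow> \<phi> (\<lambda>x\<in>S. c * f x) = c * \<phi> f"
    "f \<in> BB \<Longrightarrow> g \<in> BB \<Longrightarrow> \<phi> (\<lambda>x\<in>S. f x * g x) = \<phi> f * \<phi> g" for f g c
    using phi unfolding characters_def by simp_all
  have add: "\<psi> (\<lambda>x. f x + g x) = \<psi> f + \<psi> g" if "f \<in> UA" "g \<in> UA" for f g
  proof -
    have "(\<lambda>x\<in>S. restrict f S x + restrict g S x) = restrict (\<lambda>x. f x + g x) S" by (auto simp: restrict_def)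
    then show ?thesis using ch(1)[OF restrict_BB[OF that(1)] restrict_BB[OF that(2)]] by (simp only: \<psi>_def)
  qed
  have mult: "\<psi> (\<lambda>x. f x * g x) = \<psi> f * \<psi> g" if "f \<in> UA" "g \<in> UA" for f g
  proof -
    have "(\<lambda>x\<in>S. restrict f S x * restrict g S x) = restrict (\<lambda>x. f x * g x) S" by (auto simp: restrict_def)
    then show ?thesis using ch(3)[OF restrict_BB[OF that(1)] restrict_BB[OF that(2)]] by (simp only: \<psi>_def)
  qed
  have hom: "\<psi> (\<lambda>x. c * f x) = c * \<psi> f" if "f \<in> UA" for f c
  proof -
    have "(\<lambda>x\<in>S. c * restrict f S x) = restrict (\<lambda>x. c * f x) S" by (auto simp: restrict_def)
    then show ?thesis using ch(2)[OF restrict_BB[OF that], of c] by (simp only: \<psi>_def)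
  qed
  have BBr: "restrict g S = g" if "g \<in> BB" for g using BB_ext[OF that] by (simp add: extensional_restrict)
  obtain h where h: "h \<in> BB" "\<phi> h \<noteq> 0" using phi unfolding characters_def by blast
  have one: "\<psi> (\<lambda>x. 1) = 1"
  proof -
    have "\<psi> (\<lambda>x. h x * 1) = \<psi> h * \<psi> (\<lambda>x. 1)" by (rule mult[OF BB_UA[OF h(1)] UA_alg(1)])
    moreover have "\<psi> h \<noteq> 0" using h BBr by (simp add: \<psi>_def)
    ultimately show ?thesis by simp
  qed
  have const: "\<psi> (\<lambda>x. c) = c" for c using hom[OF UA_alg(1), of c 1] one by simp
  have cong: "\<psi> f = \<psi> g" if "f \<in> UA" "\<And>x. x \<in> S \<Longrightarrow> f x = g x" for f g
  proof -
    have "restrict f S = restrict g S" using that(2) by (auto simp: restrict_def)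
    then show ?thesis by (simp add: \<psi>_def)
  qed
  \<comment> \<open>If c = \<open>\<psi> f\<close> exceeded the bound \<open>M\<close> in modulus, c
    - f would be invertible in the closure by the power series of 1 / (c - t), although
    \<open>\<psi>\<close> sends it to 0.\<close>
  have bound: "cmod (\<psi> f) \<le> M" if f: "f \<in> UA" and M: "\<And>x. x \<in> S \<Longrightarrow> cmod (f x) \<le> M" "0 \<le> M" for f M
  proof (rule ccontr)
    assume nb: "\<not> ?thesis"
    define c where "c = \<psi> f"
    have c: "M < cmod c" using nb by (simp add: c_def)
    have "(\<lambda>y. 1 * inverse (c - f y)) \<in> UA"
    proof (rule uclosure_power_series[OF alg f UA_alg(1) M(2) c])
      show "(\<lambda>t. inverse (c - t)) holomorphic_on ball 0 (cmod c)"
        by (intro holomorphic_intros) (auto simp: dist_norm)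
      show "1 = (0::complex)" if "y \<in> S" "M < dist (f y) 0" for y using M(1)[OF that(1)] that(2) by simp
    qed
    then have inv: "(\<lambda>y. inverse (c - f y)) \<in> UA" by simp
    have cf: "(\<lambda>y. c + (- 1) * f y) \<in> UA" by (intro UA_alg(2,3) UA_alg(1) f)
    have "1 = \<psi> (\<lambda>y. (c + (- 1) * f y) * inverse (c - f y))"
    proof -
      have "(1::complex) = (c + (- 1) * f y) * inverse (c - f y)" if "y \<in> S" for y
      proof -
        have "c \<noteq> f y" using M(1)[OF that] c by auto
        then show ?thesis by simp
      qed
      then have "\<psi> (\<lambda>y. 1) = \<psi> (\<lambda>y. (c + (- 1) * f y) * inverse (c - f y))" by (intro cong UA_alg(1))
      then show ?thesis using one by simp
    qed
    also have "\<dots> = \<psi> (\<lambda>y. c + (- 1) * f y) * \<psi> (\<lambda>y. inverse (c - f y))" by (rule mult[OF cf inv])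
    also have "\<psi> (\<lambda>y. c + (- 1) * f y) = 0"
      using add[OF UA_alg(1)[of c] UA_alg(3)[OF UA_alg(1)[of "- 1"] f]] const[of c] hom[OF f, of "- 1"] by (simp add: c_def)
    finally show False by simp
  qed
  obtain p where p: "p \<in> S" "\<And>g. g \<in> A \<Longrightarrow> \<psi> g = g p"
    using character_eval[of \<psi>, OF add mult const cong bound] by blast
  have "\<psi> f = f p" if f: "f \<in> UA" for f
  proof -
    have "cmod (\<psi> f - f p) \<le> 0 + e" if e: "0 < e" for e
    proof -
      have "e / 2 > 0" using e by simp
      then obtain g where g: "g \<in> A" "\<forall>x\<in>S. cmod (f x - g x) < e / 2" using f unfolding uclosure_def mem_Collect_eq by meson
      have gU: "g \<in> UA" using g(1) uclosure_superset by blast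
      have d: "(\<lambda>x. f x + (- 1) * g x) \<in> UA" by (intro UA_alg(2,3) UA_alg(1) f gU)
      have "cmod (\<psi> (\<lambda>x. f x + (- 1) * g x)) \<le> e / 2"
        using g(2) e by (intro bound[OF d]) (auto simp: less_imp_le)
      moreover have "\<psi> (\<lambda>x. f x + (- 1) * g x) = \<psi> f - \<psi> g"
        using add[OF f UA_alg(3)[OF UA_alg(1)[of "- 1"] gU]] hom[OF gU, of "- 1"] by simp
      ultimately have "cmod (\<psi> f - g p) \<le> e / 2" using p(2)[OF g(1)] by simp
      moreover have "cmod (g p - f p) \<le> e / 2" using g(2) p(1) by (force simp: norm_minus_commute)
      ultimately show ?thesis using norm_triangle_ineq[of "\<psi> f - g p" "g p - f p"] by simp
    qed
    then have "cmod (\<psi> f - f p) \<le> 0" by (rule field_le_epsilon)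
    then show ?thesis by simp
  qed
  then have "\<phi> g = g p" if "g \<in> BB" for g using BB_UA[OF that] BBr[OF that] by (metis \<psi>_def)
  then show ?thesis using p(1) by blast
qed

text \<open>The evaluation map is a continuous bijection from a compact space onto a Hausdorff
  space, hence a homeomorphism.\<close>

lemma natural_BB: "natural_uniform_algebra X BB"
  unfolding natural_uniform_algebra_def
proof (intro conjI uniform_algebra_BB continuous_imp_homeomorphic_map)
  let ?ev = "\<lambda>x. \<lambda>f\<in>BB. f x"
  have ch: "?ev x \<in> characters X BB" if x: "x \<in> S" for x
  proof -
    have "(\<lambda>x\<in>S. 1) \<in> BB" using ext_algebraD(2)[OF ext_algebra_BB] by simp
    moreover have "(\<lambda>x\<in>S. 1) x \<noteq> (0::complex)" using x by simp
    ultimately have "\<exists>f\<in>BB. ?ev x f \<noteq> 0" using x by (intro bexI[of _ "\<lambda>x\<in>S. 1"]) auto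
    then show ?thesis unfolding characters_def
      using x ext_algebraD[OF ext_algebra_BB] ext_algebra_cmult[OF ext_algebra_BB] by auto
  qed
  show "compact_space X" by (rule compact_space_X)
  show "Hausdorff_space (maximal_ideal_space X BB)"
    unfolding maximal_ideal_space_def by (simp add: Hausdorff_space_subtopology Hausdorff_space_product_topology)
  have ts: "topspace (maximal_ideal_space X BB) = characters X BB"
    unfolding maximal_ideal_space_def by (auto simp: characters_def PiE_def)
  show "continuous_map X (maximal_ideal_space X BB) ?ev"
    unfolding maximal_ideal_space_def continuous_map_in_subtopology continuous_map_componentwise
    using ch UA_continuous_on BB_UA by auto
  show "?ev ` topspace X = topspace (maximal_ideal_space X BB)"
    unfolding ts
  proof (intro equalityI subsetI)
    fix \<phi> assume phi: "\<phi> \<in> characters X BB"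
    obtain p where p: "p \<in> S" "\<forall>g\<in>BB. \<phi> g = g p" using character_eval_BB[OF phi] by blast
    have "\<phi> = ?ev p"
      using phi p(2) by (intro extensionalityI[of _ BB]) (auto simp: characters_def)
    then show "\<phi> \<in> ?ev ` topspace X" using p(1) by auto
  qed (use ch in auto)
  show "inj_on ?ev (topspace X)"
  proof (rule inj_onI, rule ccontr)
    fix x y assume xy: "x \<in> topspace X" "y \<in> topspace X" "?ev x = ?ev y" "x \<noteq> y"
    then obtain g where g: "g \<in> UA" "g x = 1" "g y = 0" using separates[of x y] by auto
    have "?ev x (restrict g S) = ?ev y (restrict g S)" using xy(3) by simp
    then show False using g xy(1,2) restrict_BB[OF g(1)] by simp
  qed
qed

lemma UA_prod: "finite I \<Longrightarrow> (\<And>i. i \<in> I \<Longrightarrow> g i \<in> UA) \<Longrightarrow> (\<lambda>x. \<Prod>i\<in>I. g i x) \<in> UA"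
proof (induction rule: finite_induct)
  case empty then show ?case using UA_alg(1)[of 1] by simp
next
  case (insert i I)
  have "(\<lambda>x. g i x * (\<Prod>i\<in>I. g i x)) \<in> UA" by (intro UA_alg(3) insert) auto
  then show ?case using insert by simp
qed

text \<open>Finitely many cut-offs u at points of \<open>K1\<close>, each vanishing on
  \<open>K0\<close>, are 1 on open sets that cover \<open>K1\<close>; then 1 - \<Prod> (1 - u) is 1
  on \<open>K1\<close> and 0 on \<open>K0\<close>.\<close>

theorem normal_BB: "normal_uniform_algebra X BB"
  unfolding normal_uniform_algebra_def
proof (intro conjI natural_BB allI impI)
  fix K0 K1 assume K: "closedin X K0 \<and> closedin X K1 \<and> disjnt K0 K1"
  have sub: "K0 \<subseteq> S" "K1 \<subseteq> S" using K closedin_subset by fastforce+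
  have K0: "closed K0" and K1: "compact K1"
    using K compact by (auto simp: closedin_compact_eq compact_imp_closed closedin_closed_eq)
  define P where "P x z \<longleftrightarrow> fst z \<in> UA \<and> open (snd z) \<and> x \<in> snd z \<and>
      (\<forall>y\<in>snd z. y \<in> S \<longrightarrow> fst z y = 1) \<and> (\<forall>y\<in>K0. fst z y = 0)" for x and z :: "('a \<Rightarrow> complex) \<times> 'a set"
  have "\<exists>z. P x z" if x: "x \<in> K1" for x
  proof -
    have "x \<in> - K0" using K x by (auto simp: disjnt_iff)
    moreover have "x \<in> S" using sub x by blast
    ultimately obtain u where u: "u \<in> UA" "near S x (\<lambda>y. u y = 1)" "\<forall>y\<in>S - (- K0). u y = 0"
      using local_cut[of x "- K0"] K0 open_Compl by blast
    obtain V where "open V" "x \<in> V" "\<forall>y\<in>V. y \<in> S \<longrightarrow> u y = 1"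
      using u(2) unfolding near_def eventually_nhds by blast
    then have "P x (u, V)" using u sub by (auto simp: P_def)
    then show ?thesis by blast
  qed
  then obtain z where z: "\<And>x. x \<in> K1 \<Longrightarrow> P x (z x)" by metis
  define u V where "u x = fst (z x)" and "V x = snd (z x)" for x
  have uV: "\<And>x. x \<in> K1 \<Longrightarrow> u x \<in> UA" "\<And>x. x \<in> K1 \<Longrightarrow> open (V x)" "\<And>x. x \<in> K1 \<Longrightarrow> x \<in> V x"
    "\<And>x y. x \<in> K1 \<Longrightarrow> y \<in> V x \<Longrightarrow> y \<in> S \<Longrightarrow> u x y = 1" "\<And>x y. x \<in> K1 \<Longrightarrow> y \<in> K0 \<Longrightarrow> u x y = 0"
    using z unfolding P_def u_def V_def by simp_all
  have "K1 \<subseteq> (\<Union>x\<in>K1. V x)" using uV(3) by blast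
  from compactE_image[OF K1 uV(2) this] obtain J where J: "J \<subseteq> K1" "finite J" "K1 \<subseteq> (\<Union>x\<in>J. V x)" by blast
  define g where "g y = 1 + (- 1) * (\<Prod>x\<in>J. 1 + (- 1) * u x y)" for y
  have "g \<in> UA" unfolding g_def[abs_def]
    using J(1) uV(1) by (intro UA_alg(2,3) UA_alg(1) UA_prod J(2)) auto
  moreover have "g y = 1" if y: "y \<in> K1" for y
  proof -
    obtain x where "x \<in> J" "y \<in> V x" using J(3) y by blast
    then have "(\<Prod>x\<in>J. 1 + (- 1) * u x y) = 0" using J y sub uV(4)[of x y] by (intro prod_zero) (auto intro!: bexI[of _ x])
    then show ?thesis by (simp add: g_def)
  qed
  moreover have "g y = 0" if y: "y \<in> K0" for y
  proof -
    have "(\<Prod>x\<in>J. 1 + (- 1) * u x y) = 1" using uV(5)[OF _ y] J(1) by (intro prod.neutral) auto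
    then show ?thesis by (simp add: g_def)
  qed
  ultimately show "\<exists>f\<in>BB. (\<forall>x\<in>K1. f x = 1) \<and> (\<forall>x\<in>K0. f x = 0)"
    using sub by (intro bexI[OF _ restrict_BB[of g]]) auto
qed

text \<open>A function that is not 0 at \<open>x\<close>, divided by its value there, differs from 1
  by an element of the ideal, so together they generate everything.\<close>

lemma maximalideal_M:
  assumes x: "x \<in> S" shows "maximalideal (M_ideal BB x) (function_ring X BB)"
proof -
  interpret R: cring "function_ring X BB" by (rule cring_function_ring[OF ext_algebra_BB])
  note D = ext_algebraD[OF ext_algebra_BB]
  have id: "ideal (M_ideal BB x) (function_ring X BB)"
    using x D by (intro function_ring_idealI[OF ext_algebra_BB]) (auto simp: M_ideal_def)
  show ?thesis
  proof (rule maximalidealI[OF id])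
    have "(\<lambda>x\<in>S. 1) \<in> BB" using D(2)[of 1] by simp
    moreover have "(\<lambda>x\<in>S. 1) \<notin> M_ideal BB x" using x by (simp add: M_ideal_def)
    ultimately show "carrier (function_ring X BB) \<noteq> M_ideal BB x" by auto
    fix J assume J: "ideal J (function_ring X BB)" "M_ideal BB x \<subseteq> J" "J \<subseteq> carrier (function_ring X BB)"
    interpret J: ideal J "function_ring X BB" by (rule J(1))
    show "J = M_ideal BB x \<or> J = carrier (function_ring X BB)"
    proof (cases "J \<subseteq> M_ideal BB x")
      case True then show ?thesis using J(2) by blast
    next
      case False
      then obtain f where f: "f \<in> J" "f x \<noteq> 0" using J(3) by (auto simp: M_ideal_def)
      have fB: "f \<in> BB" using f(1) J(3) by auto
      define g where "g = (\<lambda>y\<in>S. (1 / f x) * f y)"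
      have gB: "g \<in> BB" using ext_algebra_cmult[OF ext_algebra_BB fB, of "1 / f x"] by (simp add: g_def)
      have "(\<lambda>y\<in>S. 1 / f x) \<in> BB" using D(2)[of "1 / f x"] by simp
      then have "(\<lambda>y\<in>S. (\<lambda>y\<in>S. 1 / f x) y * f y) \<in> J"
        using J.I_l_closed[OF f(1), of "\<lambda>y\<in>S. 1 / f x"] by simp
      moreover have "(\<lambda>y\<in>S. (\<lambda>y\<in>S. 1 / f x) y * f y) = g" by (auto simp: g_def restrict_def)
      ultimately have gJ: "g \<in> J" by simp
      define k where "k = (\<lambda>y\<in>S. 1 + (- 1) * g y)"
      have "(\<lambda>y. 1 + (- 1) * g y) \<in> UA" by (intro UA_alg(2,3) UA_alg(1) BB_UA gB)
      then have "k \<in> BB" unfolding k_def by (rule restrict_BB)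
      then have "k \<in> J" using J(2) x f(2) by (auto simp: M_ideal_def k_def g_def)
      then have "(\<lambda>y\<in>S. g y + k y) \<in> J" using additive_subgroup.a_closed[OF ideal.axioms(1)[OF J(1)] gJ, of k] by simp
      moreover have "(\<lambda>y\<in>S. g y + k y) = (\<lambda>y\<in>S. 1)" by (auto simp: k_def restrict_def)
      ultimately have "\<one>\<^bsub>function_ring X BB\<^esub> \<in> J" by simp
      then show ?thesis using J.one_imp_carrier by blast
    qed
  qed
qed

text \<open>An ideal between \<open>J\<^sub>x\<close> and \<open>M\<^sub>x\<close> is primary: a function that does not vanish at \<open>x\<close>
  is invertible near \<open>x\<close>, hence invertible modulo \<open>J\<^sub>x\<close>.\<close>

lemma primary_idealI:
  assumes x: "x \<in> S" and I: "ideal I (function_ring X BB)" "J_ideal X BB x \<subseteq> I" "I \<subseteq> M_ideal BB x"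
  shows "primary_ideal X BB I"
  unfolding primary_ideal_def
proof (intro conjI I(1) ex1I[of _ "M_ideal BB x"])
  show "maximalideal (M_ideal BB x) (function_ring X BB)" by (rule maximalideal_M[OF x])
  show "I \<subseteq> M_ideal BB x" by (rule I(3))
  fix M assume "maximalideal M (function_ring X BB) \<and> I \<subseteq> M"
  then interpret M: maximalideal M "function_ring X BB" by simp
  have IM: "I \<subseteq> M" using \<open>maximalideal M (function_ring X BB) \<and> I \<subseteq> M\<close> by simp
  have MB: "M \<subseteq> BB" using M.Icarr by auto
  have idM: "ideal M (function_ring X BB)" by (rule M.is_ideal)
  show "M = M_ideal BB x"
  proof (cases "M \<subseteq> M_ideal BB x")
    case True
    interpret Mx: maximalideal "M_ideal BB x" "function_ring X BB" by (rule maximalideal_M[OF x])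
    have "M_ideal BB x = M \<or> M_ideal BB x = carrier (function_ring X BB)"
      by (rule M.I_maximal[OF Mx.is_ideal True]) (auto simp: M_ideal_def)
    then show ?thesis using Mx.I_notcarr by auto
  next
    case False
    then obtain f where f: "f \<in> M" "f x \<noteq> 0" using MB by (auto simp: M_ideal_def)
    have fB: "f \<in> BB" using f(1) MB by auto
    have "near S x (\<lambda>y. dist (f y) (f x) < cmod (f x) / 2)"
      using f(2) by (intro near_continuous UA_continuous_on BB_UA fB x) auto
    then obtain W where W: "open W" "x \<in> W" "\<And>y. y \<in> W \<Longrightarrow> y \<in> S \<Longrightarrow> dist (f y) (f x) < cmod (f x) / 2"
      unfolding near_def eventually_nhds by blast
    from local_cut[OF x W(1,2)] obtain u where u: "u \<in> UA" "near S x (\<lambda>y. u y = 1)" "\<forall>y\<in>S - W. u y = 0" by blast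
    define g where "g y = u y * inverse (f y)" for y
    have gU: "g \<in> UA" unfolding g_def[abs_def]
    proof (rule uclosure_power_series[OF alg BB_UA[OF fB] u(1)])
      show "inverse holomorphic_on ball (f x) (cmod (f x))"
        by (intro holomorphic_intros) (auto simp: dist_norm)
      show "cmod (f x) / 2 < cmod (f x)" using f(2) by simp
      show "u y = 0" if "y \<in> S" "cmod (f x) / 2 < dist (f y) (f x)" for y
        using that u(3) W(3)[of y] by force
    qed auto
    have "(\<lambda>y\<in>S. restrict g S y * f y) \<in> M" using M.I_l_closed[OF f(1), of "restrict g S"] restrict_BB[OF gU] by simp
    moreover have "(\<lambda>y\<in>S. restrict g S y * f y) = restrict u S"
    proof (rule ext)
      fix y
      have "g y * f y = u y" if y: "y \<in> S"
      proof (cases "y \<in> W")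
        case True
        have "f y \<noteq> 0" using W(3)[OF True y] f(2) by auto
        then show ?thesis by (simp add: g_def)
      next
        case False then show ?thesis using u(3) y by (simp add: g_def)
      qed
      then show "(\<lambda>y\<in>S. restrict g S y * f y) y = restrict u S y" by simp
    qed
    ultimately have uM: "restrict u S \<in> M" by simp
    \<comment> \<open>\<open>u\<close> = g f lies in \<open>M\<close>, and 1 - u vanishes near
      \<open>x\<close>, so it lies in \<open>I\<close> and therefore in \<open>M\<close>; their sum
      is 1.\<close>
    define k where "k = (\<lambda>y\<in>S. 1 + (- 1) * u y)"
    have "(\<lambda>y. 1 + (- 1) * u y) \<in> UA" by (intro UA_alg(2,3) UA_alg(1) u(1))
    then have kB: "k \<in> BB" unfolding k_def by (rule restrict_BB)
    obtain V where V: "open V" "x \<in> V" "\<forall>y\<in>V. y \<in> S \<longrightarrow> u y = 1" using u(2) unfolding near_def eventually_nhds by blast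
    have "k \<in> J_ideal X BB x" unfolding J_ideal_def
      using kB V x by (auto intro!: exI[of _ "S \<inter> V"] simp: k_def openin_open_Int)
    then have "k \<in> M" using I(2) IM by blast
    then have "(\<lambda>y\<in>S. restrict u S y + k y) \<in> M" using additive_subgroup.a_closed[OF ideal.axioms(1)[OF idM] uM, of k] by simp
    moreover have "(\<lambda>y\<in>S. restrict u S y + k y) = (\<lambda>y\<in>S. 1)" by (auto simp: k_def restrict_def)
    ultimately have "\<one>\<^bsub>function_ring X BB\<^esub> \<in> M" by simp
    then have "M = carrier (function_ring X BB)" using M.one_imp_carrier by blast
    then show ?thesis using M.I_notcarr by auto
  qed
qed

lemma closed_idealI:
  assumes I: "ideal I (function_ring X BB)"
    and lim: "\<And>f. f \<in> BB \<Longrightarrow> (\<And>e. 0 < e \<Longrightarrow> \<exists>g\<in>I. \<forall>x\<in>S. cmod (f x - g x) \<le> e) \<Longrightarrow> f \<in> I"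
  shows "closed_ideal X BB I"
proof -
  interpret I: ideal I "function_ring X BB" by (rule I)
  have IB: "I \<subseteq> BB" using I.Icarr by auto
  have "closedin (mtopology_of (C_metric X)) I"
  proof (rule closedin_C_metric)
    show "I \<subseteq> C_space X" using IB BB_subset_C by blast
    fix f assume f: "f \<in> C_space X" and l: "\<And>e. 0 < e \<Longrightarrow> \<exists>g\<in>I. \<forall>x\<in>topspace X. cmod (f x - g x) \<le> e"
    have "f \<in> UA"
    proof (rule uclosure_limit)
      fix e :: real assume "0 < e"
      from l[OF this] obtain g where "g \<in> I" "\<forall>x\<in>S. cmod (f x - g x) \<le> e" by auto
      then show "\<exists>g\<in>UA. \<forall>x\<in>S. cmod (f x - g x) \<le> e" using IB BB_UA by blast
    qed
    then have "f \<in> BB" using f unfolding C_space_X BB_def by auto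
    then show "f \<in> I" using lim l by simp
  qed
  then have "closedin (subtopology (mtopology_of (C_metric X)) BB) I"
    using IB closedin_subset_topspace by blast
  then show ?thesis unfolding closed_ideal_def using I by blast
qed

section \<open>Bounded relative units and peak points from bounded cut-offs\<close>

definition bounded_cuts :: "'a \<Rightarrow> bool"
  where "bounded_cuts x \<longleftrightarrow> (\<forall>W. open W \<longrightarrow> x \<in> W \<longrightarrow>
     (\<exists>u\<in>UA. near S x (\<lambda>y. u y = 1) \<and> (\<forall>y\<in>S - W. u y = 0) \<and> (\<forall>y\<in>S. cmod (u y) \<le> 3/2)))"

lemma bounded_relative_unitsI:
  assumes x: "x \<in> S" and b: "bounded_cuts x"
  shows "bounded_relative_units X BB x"
  unfolding bounded_relative_units_def
proof (intro exI[of _ "5/2"] conjI allI impI)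
  fix E assume E: "compactin X E \<and> E \<subseteq> topspace X - {x}"
  then have "closed E" by (simp add: compactin_subtopology compact_imp_closed)
  then have "open (- E)" "x \<in> - E" using E by auto
  then obtain u where u: "u \<in> UA" "near S x (\<lambda>y. u y = 1)" "\<forall>y\<in>S - (- E). u y = 0" "\<forall>y\<in>S. cmod (u y) \<le> 3/2"
    using b unfolding bounded_cuts_def by blast
  \<comment> \<open>The relative unit is 1 - u, whence the bound 5/2 = 1 + 3/2.\<close>
  define k where "k = (\<lambda>y\<in>S. 1 + (- 1) * u y)"
  have "(\<lambda>y. 1 + (- 1) * u y) \<in> UA" by (intro UA_alg(2,3) UA_alg(1) u(1))
  then have kB: "k \<in> BB" unfolding k_def by (rule restrict_BB)
  obtain V where V: "open V" "x \<in> V" "\<forall>y\<in>V. y \<in> S \<longrightarrow> u y = 1" using u(2) unfolding near_def eventually_nhds by blast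
  show "\<exists>f\<in>J_ideal X BB x. (\<forall>y\<in>E. f y = 1) \<and> sup_norm X f \<le> 5/2"
  proof (intro bexI[of _ k] conjI ballI)
    show "k \<in> J_ideal X BB x" unfolding J_ideal_def
      using kB V x by (auto intro!: exI[of _ "S \<inter> V"] simp: k_def openin_open_Int)
    show "k y = 1" if "y \<in> E" for y using u(3) E that by (auto simp: k_def)
    have "cmod (k y) \<le> 5/2" if y: "y \<in> S" for y
      using u(4) y norm_triangle_ineq4[of 1 "u y"] by (fastforce simp: k_def)
    then show "sup_norm X k \<le> 5/2" unfolding sup_norm_def using x by (intro cSUP_least) auto
  qed
qed simp

text \<open>Bishop's argument: \<open>\<Sum>\<^sub>n 2\<^sup>-\<^sup>n\<^sup>-\<^sup>1 u\<^sub>n\<close> peaks at \<open>x\<close> if \<open>u\<^sub>n\<close> is a cut-off function whose support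
  lies in the set where \<open>u\<^sub>0, \<dots>, u\<^sub>n\<^sub>-\<^sub>1\<close> are \<open>1\<close>, since \<open>\<bar>u\<^sub>n\<bar> < 2\<close>.\<close>

lemma peak_pointI_bounded_cuts:
  assumes x: "x \<in> S" and b: "bounded_cuts x"
  shows "peak_point X BB x"
proof -
  define P where "P n z \<longleftrightarrow> fst z \<in> UA \<and> open (snd z) \<and> x \<in> snd z \<and> snd z \<subseteq> ball x (1 / real (Suc n)) \<and>
    (\<forall>y\<in>snd z. y \<in> S \<longrightarrow> fst z y = 1) \<and> (\<forall>y\<in>S. cmod (fst z y) \<le> 3/2)" for n and z :: "('a \<Rightarrow> complex) \<times> 'a set"
  have step: "\<exists>z. P n z \<and> snd z \<subseteq> W \<and> (\<forall>y\<in>S - W. fst z y = 0)" if W: "open W" "x \<in> W" for n W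
  proof -
    obtain u where u: "u \<in> UA" "near S x (\<lambda>y. u y = 1)" "\<forall>y\<in>S - W. u y = 0" "\<forall>y\<in>S. cmod (u y) \<le> 3/2"
      using b W unfolding bounded_cuts_def by blast
    obtain V where V: "open V" "x \<in> V" "\<forall>y\<in>V. y \<in> S \<longrightarrow> u y = 1" using u(2) unfolding near_def eventually_nhds by blast
    show ?thesis
      using u V W by (intro exI[of _ "(u, V \<inter> W \<inter> ball x (1 / real (Suc n)))"]) (auto simp: P_def)
  qed
  have "\<exists>z. \<forall>n. P n (z n) \<and> (snd (z (Suc n)) \<subseteq> snd (z n) \<and> (\<forall>y\<in>S - snd (z n). fst (z (Suc n)) y = 0))"
  proof (rule dependent_nat_choice)
    show "\<exists>z. P 0 z" using step[of UNIV 0] by auto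
    show "\<exists>z'. P (Suc n) z' \<and> (snd z' \<subseteq> snd z \<and> (\<forall>y\<in>S - snd z. fst z' y = 0))" if "P n z" for z n
      using step[of "snd z" "Suc n"] that unfolding P_def by auto
  qed
  then obtain z where z: "\<And>n. P n (z n)" "\<And>n. snd (z (Suc n)) \<subseteq> snd (z n)"
    "\<And>n y. y \<in> S \<Longrightarrow> y \<notin> snd (z n) \<Longrightarrow> fst (z (Suc n)) y = 0" by blast
  define u where "u n = fst (z n)" for n
  define V where "V n = snd (z n)" for n
  have u: "u n \<in> UA" "x \<in> V n" "V n \<subseteq> ball x (1 / real (Suc n))" "\<And>y. y \<in> V n \<Longrightarrow> y \<in> S \<Longrightarrow> u n y = 1"
    "\<And>y. y \<in> S \<Longrightarrow> cmod (u n y) \<le> 3/2" for n using z(1)[of n] by (auto simp: P_def u_def V_def)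
  have V: "V (Suc n) \<subseteq> V n" "\<And>y. y \<in> S \<Longrightarrow> y \<notin> V n \<Longrightarrow> u (Suc n) y = 0" for n
    using z(2,3) by (auto simp: u_def V_def)
  have Vanti: "V m \<subseteq> V n" if "n \<le> m" for n m by (rule lift_Suc_antimono_le[of V, OF V(1) that])
  define F where "F y = (\<Sum>n. u n y / 2 ^ Suc n)" for y
  have g: "(\<lambda>n. (3/2) / 2 ^ Suc n) sums (3/2::real)" using sums_mult[OF power_half_series, of "3/2"] by (simp add: power_divide field_simps)
  have ub: "cmod (u n y / 2 ^ Suc n) \<le> (3/2) / 2 ^ Suc n" if "y \<in> S" for n y
    unfolding norm_divide norm_power using divide_right_mono[OF u(5)[OF that], of "2 ^ Suc n" n]
    by (simp del: power_Suc)
  have summ: "summable (\<lambda>n. u n y / 2 ^ Suc n)" if y: "y \<in> S" for y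
  proof (rule summable_comparison_test'[OF sums_summable[OF g], of 0])
    show "norm (u n y / 2 ^ Suc n) \<le> (3/2) / 2 ^ Suc n" for n
      by (rule ub[OF y])
  qed
  have tail: "cmod (F y - (\<Sum>n<k. u n y / 2 ^ Suc n)) \<le> (3/2) / 2 ^ k" if y: "y \<in> S" for y k
  proof -
    have gk: "(\<lambda>n. (3/2) / 2 ^ Suc (n + k)) sums ((3/2) / 2 ^ k :: real)"
      using sums_mult[OF g, of "1 / 2 ^ k"] by (simp add: power_add field_simps)
    have "F y - (\<Sum>n<k. u n y / 2 ^ Suc n) = (\<Sum>n. u (n + k) y / 2 ^ Suc (n + k))"
      unfolding F_def using suminf_split_initial_segment[OF summ[OF y], of k] by simp
    also have "cmod \<dots> \<le> (\<Sum>n. (3/2) / 2 ^ Suc (n + k))"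
    proof (rule norm_suminf_le)
      show "norm (u (n + k) y / 2 ^ Suc (n + k)) \<le> (3/2) / 2 ^ Suc (n + k)" for n
        by (rule ub[OF y])
    qed (rule sums_summable[OF gk])
    also have "\<dots> = (3/2) / 2 ^ k" using gk by (simp add: sums_iff)
    finally show ?thesis .
  qed
  have partial: "(\<lambda>y. \<Sum>n<k. u n y / 2 ^ Suc n) \<in> UA" for k
  proof (induction k)
    case 0 then show ?case using UA_alg(1)[of 0] by simp
  next
    case (Suc k)
    have "(\<lambda>y. (\<Sum>n<k. u n y / 2 ^ Suc n) + (1 / 2 ^ Suc k) * u k y) \<in> UA"
      by (intro UA_alg(2) Suc UA_alg(3)[OF UA_alg(1) u(1)])
    then show ?case by simp
  qed
  have FU: "F \<in> UA"
  proof (rule uclosure_limit)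
    fix e :: real assume "0 < e"
    then obtain k where k: "(1/2) ^ k < e / (3/2)" using real_arch_pow_inv[of "e / (3/2)" "1/2"] by auto
    then have "(3/2) / 2 ^ k \<le> e" by (simp add: power_divide field_simps)
    then have "\<forall>y\<in>S. cmod (F y - (\<Sum>n<k. u n y / 2 ^ Suc n)) \<le> e" using tail[of _ k] by force
    then show "\<exists>h\<in>UA. \<forall>y\<in>S. cmod (F y - h y) \<le> e" by (intro bexI[OF _ partial[of k]])
  qed
  have Fx: "F x = 1"
  proof -
    have "(\<lambda>n. (1/2) ^ Suc n :: complex) sums 1" using sums_of_real[OF power_half_series, where 'a = complex] by simp
    then have "(\<lambda>n. u n x / 2 ^ Suc n) sums 1" using u(2) u(4)[OF _ x] by (simp add: power_divide)
    then show ?thesis unfolding F_def by (simp add: sums_iff)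
  qed
  have Fy: "cmod (F y) < 1" if y: "y \<in> S" "y \<noteq> x" for y
  proof -
    have "\<exists>n. y \<notin> V n"
    proof -
      obtain n where "1 / real (Suc n) < dist x y" using nat_approx_posE[of "dist x y"] y(2) by auto
      then have "y \<notin> V n" using u(3)[of n] by fastforce
      then show ?thesis by blast
    qed
    \<comment> \<open>For the first n with y outside \<open>V n\<close>, the terms before n have u =
      1 and those after n vanish, so |F y| is at most 1 - 2^(-n) + (3/2) 2^(-n-1) = 1 - (1/4)
      2^(-n).\<close>
    then obtain n where n: "y \<notin> V n" "\<And>j. j < n \<Longrightarrow> y \<in> V j" using exists_least_iff[of "\<lambda>n. y \<notin> V n"] by blast
    have z: "u j y = 0" if "n < j" for j
    proof -
      have i: "j = Suc (j - 1)" "n \<le> j - 1" using that by auto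
      then have "y \<notin> V (j - 1)" using Vanti[of n "j - 1"] n(1) by blast
      then have "u (Suc (j - 1)) y = 0" by (rule V(2)[OF y(1)])
      then show ?thesis using i(1) by simp
    qed
    have "F y = (\<Sum>j<Suc n. u j y / 2 ^ Suc j)"
      unfolding F_def by (rule suminf_finite) (use z in auto)
    also have "\<dots> = (\<Sum>j<n. 1 / 2 ^ Suc j) + u n y / 2 ^ Suc n" using n(2) u(4) y(1) by simp
    also have "(\<Sum>j<n. 1 / 2 ^ Suc j) = (1 - 1 / 2 ^ n :: complex)"
    proof (induction n)
      case (Suc n)
      have "(\<Sum>j<Suc n. 1 / 2 ^ Suc j) = (1 - 1 / 2 ^ n :: complex) + 1 / 2 ^ Suc n" using Suc by (simp only: sum.lessThan_Suc)
      also have "\<dots> = (1 - 1 / 2 ^ Suc n :: complex)" by (simp add: field_simps)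
      finally show ?case .
    qed simp
    also have "cmod (1 - 1 / 2 ^ n + u n y / 2 ^ Suc n) \<le> cmod (1 - 1 / 2 ^ n) + cmod (u n y / 2 ^ Suc n)"
      by (rule norm_triangle_ineq)
    also have "cmod (1 - 1 / 2 ^ n) = 1 - 1 / 2 ^ n"
    proof -
      have "(1 - 1 / 2 ^ n :: complex) = of_real (1 - 1 / 2 ^ n)" by simp
      then show ?thesis by (metis abs_of_nonneg diff_ge_0_iff_ge divide_le_eq_1_pos norm_of_real one_le_numeral one_le_power zero_less_numeral zero_less_power)
    qed
    also have "cmod (u n y / 2 ^ Suc n) \<le> (3/2) / 2 ^ Suc n"
      by (rule ub[OF y(1)])
    also have "1 - 1 / 2 ^ n + (3/2) / 2 ^ Suc n = 1 - (1/4) / (2::real) ^ n" by (simp add: field_simps)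
    also have "\<dots> < 1" by simp
    finally show ?thesis by simp
  qed
  show ?thesis unfolding peak_point_def
  proof (intro conjI bexI[OF _ restrict_BB[OF FU]] ballI)
    show "cmod (restrict F S y) < 1" if "y \<in> topspace X - {x}" for y using Fy[of y] that by simp
  qed (use x Fx in auto)
qed

end

section \<open>Characters and peak points of the root extension\<close>

context root_extension
begin

lemma base_coord_in_B: "u \<in> HK (Kc n) \<Longrightarrow> (\<lambda>x. u (x (2 * n))) \<in> B"
  unfolding Alg_def by (rule subsetD[OF uclosure_superset], rule coord_alg.base)

text \<open>A character is determined by its values on the coordinates: germs are treated by
  division by z - a, their limits by the norm bound, and polynomials in the roots by
  multiplicativity. The candidate point satisfies the equations of \<open>S\<close> because the
  character preserves them.\<close>

lemma character_is_evaluation: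
  assumes add: "\<And>f g. f \<in> B \<Longrightarrow> g \<in> B \<Longrightarrow> \<psi> (\<lambda>x. f x + g x) = \<psi> f + \<psi> g"
    and mult: "\<And>f g. f \<in> B \<Longrightarrow> g \<in> B \<Longrightarrow> \<psi> (\<lambda>x. f x * g x) = \<psi> f * \<psi> g"
    and const: "\<And>c. \<psi> (\<lambda>x. c) = (c::complex)"
    and cong: "\<And>f g. f \<in> B \<Longrightarrow> (\<And>x. x \<in> S \<Longrightarrow> f x = g x) \<Longrightarrow> \<psi> f = \<psi> g"
    and bound: "\<And>f M. f \<in> B \<Longrightarrow> (\<And>x. x \<in> S \<Longrightarrow> cmod (f x) \<le> M) \<Longrightarrow> 0 \<le> M \<Longrightarrow> cmod (\<psi> f) \<le> M"
  shows "\<exists>p\<in>S. \<forall>g\<in>Alg. \<psi> g = g p"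
proof -
  define a where "a n = \<psi> (\<lambda>x. x (2 * n))" for n
  define b where "b k = \<psi> (\<lambda>x. x (2 * k + 1))" for k
  have germ: "(\<lambda>x. u (x (2 * n))) \<in> B" if "u \<in> hol_germs (Kc n)" for u n
    using that uclosure_superset by (blast intro: base_coord_in_B)
  have cB: "(\<lambda>x. x (2 * n)) \<in> B" for n
    by (rule germ[of "\<lambda>w. w"]) (intro hol_germs_entire holomorphic_intros)
  have diff: "\<psi> (\<lambda>x. x (2 * n) + - c) = a n - c" for n c
    using add[OF cB B_alg(1)[of "- c"], of n] const[of "- c"] by (simp add: a_def)
  have dB: "(\<lambda>x. x (2 * n) + - c) \<in> B" for n c by (intro B_alg(2) cB B_alg(1))
  \<comment> \<open>Otherwise the coordinate minus \<open>a n\<close> would be invertible in the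
    algebra, yet the character sends it to 0.\<close>
  have aK: "a n \<in> Kc n" for n
  proof (rule ccontr)
    assume na: "a n \<notin> Kc n"
    have "(\<lambda>w. inverse (w - a n)) \<in> hol_germs (Kc n)"
    proof (rule hol_germs_inverse)
      show "(\<lambda>w. w - a n) \<in> hol_germs (Kc n)" by (intro hol_germs_entire holomorphic_intros)
      show "w - a n \<noteq> 0" if "w \<in> Kc n" for w using na that by auto
    qed
    from germ[OF this] have iB: "(\<lambda>x. inverse (x (2 * n) - a n)) \<in> B" .
    have "\<psi> (\<lambda>x. 1) = \<psi> (\<lambda>x. (x (2 * n) + - a n) * inverse (x (2 * n) - a n))"
    proof (rule cong[OF B_alg(1)])
      fix x assume "x \<in> S"
      from S_base[OF this] have "x (2 * n) \<in> Kc n" by (simp add: base_space_def)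
      then have "x (2 * n) \<noteq> a n" using na by metis
      then show "1 = (x (2 * n) + - a n) * inverse (x (2 * n) - a n)" by simp
    qed
    also have "\<dots> = (a n - a n) * \<psi> (\<lambda>x. inverse (x (2 * n) - a n))" using mult[OF dB iB] diff by simp
    finally show False using const by simp
  qed
  have evg: "\<psi> (\<lambda>x. u (x (2 * n))) = u (a n)" if u: "u \<in> hol_germs (Kc n)" for u n
  proof -
    obtain V where V: "open V" "Kc n \<subseteq> V" "u holomorphic_on V" using u unfolding hol_germs_def by auto
    define q where "q = (\<lambda>z. if z = a n then deriv u (a n) else (u z - u (a n)) / (z - a n))"
    have "a n \<in> interior V" using aK V interior_open by blast
    then have "q holomorphic_on V" unfolding q_def by (intro pole_lemma V(3))
    then have "q \<in> hol_germs (Kc n)" using V unfolding hol_germs_def by blast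
    from germ[OF this] have qB: "(\<lambda>x. q (x (2 * n))) \<in> B" .
    have pB: "(\<lambda>x. (x (2 * n) + - a n) * q (x (2 * n))) \<in> B" by (intro B_alg(3) dB qB)
    have "\<psi> (\<lambda>x. u (x (2 * n))) = \<psi> (\<lambda>x. u (a n) + (x (2 * n) + - a n) * q (x (2 * n)))"
      by (rule cong[OF germ[OF u]]) (simp add: q_def)
    also have "\<dots> = u (a n) + \<psi> (\<lambda>x. (x (2 * n) + - a n) * q (x (2 * n)))"
      using add[OF B_alg(1) pB] const by simp
    also have "\<psi> (\<lambda>x. (x (2 * n) + - a n) * q (x (2 * n))) = 0" using mult[OF dB qB] diff by simp
    finally show ?thesis by simp
  qed
  have ev: "\<psi> (\<lambda>x. u (x (2 * n))) = u (a n)" if u: "u \<in> HK (Kc n)" for u n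
  proof -
    have "cmod (\<psi> (\<lambda>x. u (x (2 * n))) - u (a n)) \<le> 0 + e" if e: "0 < e" for e
    proof -
      have "e / 2 > 0" using e by simp
      then obtain g where g: "g \<in> hol_germs (Kc n)" "\<forall>w\<in>Kc n. cmod (u w - g w) < e / 2"
        using u unfolding uclosure_def mem_Collect_eq by meson
      have nB: "(\<lambda>x. (-1) * g (x (2 * n))) \<in> B" by (intro B_cmult germ g(1))
      have "\<psi> (\<lambda>x. (-1) * g (x (2 * n))) = - g (a n)"
        using mult[OF B_alg(1) germ[OF g(1)], of "-1"] const[of "-1"] evg[OF g(1)] by simp
      then have "\<psi> (\<lambda>x. u (x (2 * n)) + (-1) * g (x (2 * n))) = \<psi> (\<lambda>x. u (x (2 * n))) - g (a n)"
        using add[OF base_coord_in_B[OF u] nB] by simp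
      moreover have "cmod (\<psi> (\<lambda>x. u (x (2 * n)) + (-1) * g (x (2 * n)))) \<le> e / 2"
        using g(2) e S_base
        by (intro bound B_alg(2) base_coord_in_B u nB) (auto simp: base_space_def less_imp_le)
      moreover have "cmod (g (a n) - u (a n)) \<le> e / 2" using g(2) aK[of n] by (force simp: norm_minus_commute)
      ultimately show ?thesis
        using norm_triangle_ineq[of "\<psi> (\<lambda>x. u (x (2 * n))) - g (a n)" "g (a n) - u (a n)"] by simp
    qed
    then have "cmod (\<psi> (\<lambda>x. u (x (2 * n))) - u (a n)) \<le> 0" by (rule field_le_epsilon)
    then show ?thesis by simp
  qed
  define p where "p i = (if even i then a (i div 2) else b (i div 2))" for i
  have p: "p (2 * n) = a n" "p (2 * n + 1) = b n" for n by (simp_all add: p_def)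
  have main: "\<psi> g = g p \<and> g \<in> B" if "g \<in> coord_alg Kc J" for g J
    using that
  proof (induction rule: coord_alg.induct)
    case (const c) then show ?case using assms(3) B_alg(1) by simp
  next
    case (base u n) then show ?case using ev base_coord_in_B p by simp
  next
    case (root k)
    show ?case using root_in_B[of k] unfolding p by (simp add: b_def)
  next
    case (add f g) then show ?case using assms(1) B_alg(2) by simp
  next
    case (mult f g) then show ?case using assms(2) B_alg(3) by simp
  qed
  have pb: "p \<in> base_space Kc" using aK by (simp add: base_space_def p(1))
  moreover have "p (2 * k + 1) ^ N k = f k p" for k
  proof -
    have pw: "\<psi> (\<lambda>x. x (2 * k + 1) ^ i) = b k ^ i \<and> (\<lambda>x. x (2 * k + 1) ^ i) \<in> B" for i
    proof (induction i)
      case 0 then show ?case using const[of 1] B_alg(1)[of 1] by simp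
    next
      case (Suc i)
      then show ?case using mult[OF root_in_B[of k], of "\<lambda>x. x (2 * k + 1) ^ i"] B_alg(3)[OF root_in_B[of k], of "\<lambda>x. x (2 * k + 1) ^ i"]
        by (simp add: b_def)
    qed
    have "\<psi> (\<lambda>x. x (2 * k + 1) ^ N k) = \<psi> (f k)" by (rule cong) (use pw S_root in auto)
    then show ?thesis using pw main[OF f_alg] p by simp
  qed
  ultimately have "p \<in> S" by (simp add: S_def)
  then show ?thesis using main unfolding Alg_def by blast
qed

sublocale FA: function_alg_on S Alg
proof
  show "compact S" by (rule compact_S)
  show "function_algebra S Alg" by (rule function_algebra_Alg)
  show "continuous_on S g" if "g \<in> Alg" for g by (rule Alg_continuous_on[OF that])
  show "\<exists>u\<in>B. near S x (\<lambda>y. u y = 1) \<and> (\<forall>y\<in>S - W. u y = 0)" if "x \<in> S" "open W" "x \<in> W" for x W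
    using local_cut[OF that] by blast
  fix \<psi> :: "((nat \<Rightarrow> complex) \<Rightarrow> complex) \<Rightarrow> complex"
  assume "\<And>f g. f \<in> B \<Longrightarrow> g \<in> B \<Longrightarrow> \<psi> (\<lambda>x. f x + g x) = \<psi> f + \<psi> g"
    "\<And>f g. f \<in> B \<Longrightarrow> g \<in> B \<Longrightarrow> \<psi> (\<lambda>x. f x * g x) = \<psi> f * \<psi> g"
    "\<And>c. \<psi> (\<lambda>x. c) = c"
    "\<And>f g. f \<in> B \<Longrightarrow> (\<And>x. x \<in> S \<Longrightarrow> f x = g x) \<Longrightarrow> \<psi> f = \<psi> g"
    "\<And>f M. f \<in> B \<Longrightarrow> (\<And>x. x \<in> S \<Longrightarrow> cmod (f x) \<le> M) \<Longrightarrow> 0 \<le> M \<Longrightarrow> cmod (\<psi> f) \<le> M"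
  from character_is_evaluation[of \<psi>, OF this] show "\<exists>p\<in>S. \<forall>g\<in>Alg. \<psi> g = g p" .
qed

lemma bounded_cuts_off_roots: "x \<in> S \<Longrightarrow> \<not> roots_at x \<Longrightarrow> FA.bounded_cuts x"
  unfolding FA.bounded_cuts_def using local_cut[of x] by blast

text \<open>Over \<open>L\<close> a power of each root is 0, so the roots are 0 and the even
  coordinates determine the point.\<close>

lemma roots_at_eqI:
  assumes x: "x \<in> S" "roots_at x" and y: "y \<in> S" "\<And>n. y (2 * n) = x (2 * n)"
  shows "y = x"
proof
  fix i
  have ry: "roots_at y" using x(2) y(2) by (simp add: roots_at_def)
  have z: "z (2 * k + 1) = 0" if "z \<in> S" "roots_at z" for z k
    using S_root[OF that(1), of k] f_roots[OF S_base[OF that(1)] that(2), of k] N_pos[of k] by simp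
  show "y i = x i"
  proof (cases "even i")
    case True then show ?thesis using y(2)[of "i div 2"] by simp
  next
    case False
    then obtain k where "i = 2 * k + 1" by (rule oddE)
    then show ?thesis using z[OF x, of k] z[OF y(1) ry, of k] by simp
  qed
qed

text \<open>A weighted sum, over all base coordinates, of planar peak functions has modulus below 1
  as soon as one even coordinate differs from that of \<open>x\<close>; over \<open>L\<close> no
  other point shares all even coordinates with \<open>x\<close>.\<close>

lemma peak_point_roots:
  assumes x: "x \<in> S" "roots_at x"
  shows "peak_point FA.X FA.BB x"
proof -
  have "\<exists>h. h \<in> HK (Kc n) \<and> h (x (2 * n)) = 1 \<and> (\<forall>w\<in>Kc n - {x (2 * n)}. cmod (h w) < 1)" for n
    using peak[of "x (2 * n)" n] x(2) unfolding roots_at_def by blast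
  then obtain h where h: "\<And>n. h n \<in> HK (Kc n)" "\<And>n. h n (x (2 * n)) = 1"
    "\<And>n w. w \<in> Kc n \<Longrightarrow> w \<noteq> x (2 * n) \<Longrightarrow> cmod (h n w) < 1" by (metis DiffI singletonD)
  define t where "t n y = (1/2) ^ Suc n * h n (y (2 * n))" for n y
  have hb: "cmod (h n (y (2 * n))) \<le> 1" if "y \<in> S" for n y
    using h(2)[of n] h(3)[of "y (2 * n)" n] S_base[OF that] by (cases "y (2 * n) = x (2 * n)") (auto simp: base_space_def less_imp_le)
  have tb: "cmod (t n y) \<le> (1/2) ^ Suc n" if "y \<in> S" for n y
    using hb[OF that, of n] by (simp add: t_def norm_mult norm_power norm_divide mult_left_le)
  note ps = power_half_series
  have summ: "summable (\<lambda>n. t n y)" if y: "y \<in> S" for y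
    by (rule summable_comparison_test'[OF sums_summable[OF ps], of 0]) (use tb[OF y] in auto)
  define F where "F y = (\<Sum>n. t n y)" for y
  have tB: "t n \<in> B" for n unfolding t_def[abs_def] by (intro B_cmult base_coord_in_B h(1))
  have partial: "(\<lambda>y. \<Sum>n<k. t n y) \<in> B" for k
  proof (induction k)
    case 0 then show ?case using B_alg(1)[of 0] by simp
  next
    case (Suc k) then show ?case using B_alg(2)[OF Suc tB[of k]] by simp
  qed
  have FB: "F \<in> B"
  proof (rule uclosure_limit)
    fix e :: real assume "0 < e"
    then obtain k where k: "(1/2) ^ k < e" using real_arch_pow_inv[of e "1/2"] by auto
    have "cmod (F y - (\<Sum>n<k. t n y)) \<le> e" if y: "y \<in> S" for y
    proof -
      have gk: "(\<lambda>n. (1/2) ^ Suc (n + k)) sums ((1/2) ^ k :: real)"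
        using sums_mult[OF ps, of "(1/2) ^ k"] by (simp add: power_add mult_ac)
      have "F y - (\<Sum>n<k. t n y) = (\<Sum>n. t (n + k) y)"
        unfolding F_def using suminf_split_initial_segment[OF summ[OF y], of k] by simp
      also have "cmod \<dots> \<le> (\<Sum>n. (1/2) ^ Suc (n + k))"
        by (rule norm_suminf_le[OF tb[OF y] sums_summable[OF gk]])
      also have "\<dots> = (1/2) ^ k" using gk by (simp add: sums_iff)
      finally show ?thesis using k by linarith
    qed
    then show "\<exists>g\<in>B. \<forall>y\<in>S. cmod (F y - g y) \<le> e" by (intro bexI[OF _ partial[of k]]) auto
  qed
  have Fx: "F x = 1"
  proof -
    have "(\<lambda>n. (1/2) ^ Suc n :: complex) sums 1" using sums_of_real[OF ps, where 'a = complex] by simp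
    then have "(\<lambda>n. t n x) sums 1" by (simp add: t_def h(2))
    then show ?thesis unfolding F_def by (simp add: sums_iff)
  qed
  have Fy: "cmod (F y) < 1" if y: "y \<in> S" "y \<noteq> x" for y
  proof -
    obtain m where m: "y (2 * m) \<noteq> x (2 * m)" using roots_at_eqI[OF x y(1)] y(2) by blast
    have hm: "cmod (h m (y (2 * m))) < 1" using h(3)[of "y (2 * m)" m] m S_base[OF y(1)] by (simp add: base_space_def)
    define d where "d n = (1/2) ^ Suc n - cmod (t n y)" for n
    have sn: "summable (\<lambda>n. cmod (t n y))"
      by (rule summable_comparison_test'[OF sums_summable[OF ps], of 0]) (use tb[OF y(1)] in auto)
    have sd: "summable d" unfolding d_def by (intro summable_diff sums_summable[OF ps] sn)
    have "0 < d m" using hm by (simp add: d_def t_def norm_mult norm_power norm_divide)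
    then have "0 < suminf d" using tb[OF y(1)] by (intro suminf_pos2[OF sd, of m]) (auto simp: d_def)
    moreover have "suminf d = 1 - (\<Sum>n. cmod (t n y))"
      unfolding d_def using suminf_diff[OF sums_summable[OF ps] sn] ps by (simp add: sums_iff)
    moreover have "cmod (F y) \<le> (\<Sum>n. cmod (t n y))" unfolding F_def by (rule summable_norm[OF sn])
    ultimately show ?thesis by linarith
  qed
  show ?thesis unfolding peak_point_def
  proof (intro conjI bexI[OF _ FA.restrict_BB[OF FB]] ballI)
    show "cmod (restrict F S y) < 1" if "y \<in> topspace FA.X - {x}" for y using Fy[of y] that by simp
  qed (use x Fx in auto)
qed

lemma peak_point_all:
  assumes "x \<in> S" shows "peak_point FA.X FA.BB x"
proof (cases "roots_at x")
  case True then show ?thesis by (rule peak_point_roots[OF assms])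
next
  case False then show ?thesis by (intro FA.peak_pointI_bounded_cuts bounded_cuts_off_roots assms)
qed

end

section \<open>Slices and their ideals\<close>

text \<open>\<open>slot m\<close> is the position of the m-th copy of the cheese. The half-open
  condition s <= q m < t in \<open>q_dense\<close> matches the strict inequality q m < t in
  \<open>slice_ideal\<close>: the m-th slice is constrained for t but not for s.\<close>

locale slices = root_extension +
  fixes K :: "complex set" and slot :: "nat \<Rightarrow> nat" and q :: "nat \<Rightarrow> real"
  assumes slot: "\<And>m. Kc (slot m) = K" "\<And>m. Z (slot m) = {0}" "inj slot"
    and K: "0 \<in> K" "K \<subseteq> {w. 0 \<le> Re w}"
    and K_not_approx: "\<And>a. a \<in> hol_germs K \<Longrightarrow> \<not> (\<forall>w\<in>K. cmod (a w - w * E w) \<le> (1/200) * (cmod (E w) + 1))"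
    and q_dense: "\<And>s t. s < t \<Longrightarrow> \<exists>m. s \<le> q m \<and> q m < t"
begin

text \<open>Only the even coordinates are frozen, so a slice contains all sheets over the m-th copy
  of the cheese through \<open>x\<close>. It is not itself a copy of \<open>K\<close>; averaging
  over the sheets leads back to functions on \<open>K\<close>.\<close>

definition Slice :: "(nat \<Rightarrow> complex) \<Rightarrow> nat \<Rightarrow> (nat \<Rightarrow> complex) set"
  where "Slice x m = {y \<in> S. \<forall>n. n \<noteq> slot m \<longrightarrow> y (2 * n) = x (2 * n)}"

lemma Slice_S: "y \<in> Slice x m \<Longrightarrow> y \<in> S" by (simp add: Slice_def)

lemma Slice_K: "y \<in> Slice x m \<Longrightarrow> y (2 * slot m) \<in> K"
  using S_base[OF Slice_S] slot(1)[of m] by (force simp: base_space_def)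

lemma compact_Slice: "compact (Slice x m)"
proof -
  have "closed {y. y (2 * n) = x (2 * n)}" for n
    by (intro closed_Collect_eq continuous_intros continuous_on_coord)
  then have "closed (\<Inter>n\<in>{n. n \<noteq> slot m}. {y. y (2 * n) = x (2 * n)})" by (intro closed_INT) auto
  then have "compact (S \<inter> (\<Inter>n\<in>{n. n \<noteq> slot m}. {y. y (2 * n) = x (2 * n)}))"
    by (rule compact_Int_closed[OF compact_S])
  moreover have "S \<inter> (\<Inter>n\<in>{n. n \<noteq> slot m}. {y. y (2 * n) = x (2 * n)}) = Slice x m" by (auto simp: Slice_def)
  ultimately show ?thesis by simp
qed

text \<open>\<open>Sp m M\<close> consists of the sums of monomials in the first \<open>M\<close> roots with coefficients
  depending on the coordinate of the \<open>m\<close>-th slice only.\<close>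

inductive_set Sp :: "nat \<Rightarrow> nat \<Rightarrow> ((nat \<Rightarrow> complex) \<Rightarrow> complex) set" for m M where
  mono: "a \<in> HK K \<Longrightarrow> (\<lambda>y. a (y (2 * slot m)) * (\<Prod>k<M. y (2 * k + 1) ^ (\<alpha> k :: nat))) \<in> Sp m M"
| add: "P \<in> Sp m M \<Longrightarrow> R \<in> Sp m M \<Longrightarrow> (\<lambda>y. P y + R y) \<in> Sp m M"

lemma K_alg: "function_algebra K (HK K)"
  using function_algebra_HK[OF compact_Kc[of "slot 0"]] slot(1) by simp

lemmas HK_alg = function_algebraD[OF K_alg]

lemma Sp_mult:
  assumes "P \<in> Sp m M" "R \<in> Sp m M" shows "(\<lambda>y. P y * R y) \<in> Sp m M"
  using assms(1)
proof (induction rule: Sp.induct)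
  case (mono a \<alpha>)
  note a = this
  show ?case using assms(2)
  proof (induction rule: Sp.induct)
    case (mono b \<beta>)
    have "(\<lambda>y. (\<lambda>w. a w * b w) (y (2 * slot m)) * (\<Prod>k<M. y (2 * k + 1) ^ (\<alpha> k + \<beta> k))) \<in> Sp m M"
      by (rule Sp.mono[OF HK_alg(3)[OF a mono]])
    then show ?case by (simp add: power_add prod.distrib mult_ac)
  next
    case (add P R)
    then show ?case using Sp.add[OF add.IH] by (simp add: distrib_left)
  qed
next
  case (add P P')
  then show ?case using Sp.add[OF add.IH] by (simp add: distrib_right)
qed

lemma Sp_mono:
  assumes "P \<in> Sp m M" "M \<le> M'" shows "P \<in> Sp m M'"
  using assms(1)
proof (induction rule: Sp.induct)
  case (mono a \<alpha>)
  define \<beta> where "\<beta> k = (if k < M then \<alpha> k else 0)" for k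
  have "(\<Prod>k<M'. y (2 * k + 1) ^ \<beta> k) = (\<Prod>k<M. y (2 * k + 1) ^ \<alpha> k)" for y :: "nat \<Rightarrow> complex"
  proof -
    have "(\<Prod>k<M. y (2 * k + 1) ^ \<alpha> k) = (\<Prod>k<M. y (2 * k + 1) ^ \<beta> k)" by (intro prod.cong) (auto simp: \<beta>_def)
    also have "\<dots> = (\<Prod>k<M'. y (2 * k + 1) ^ \<beta> k)"
      using assms(2) by (intro prod.mono_neutral_left) (auto simp: \<beta>_def)
    finally show ?thesis by simp
  qed
  then show ?case using Sp.mono[where m = m and M = M' and \<alpha> = \<beta>, OF mono] by simp
next
  case (add P R) then show ?case by (intro Sp.add)
qed

lemma base_on_Slice:
  assumes x: "x \<in> S" and g: "g \<in> coord_alg Kc {}"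
  shows "\<exists>a\<in>HK K. \<forall>y\<in>Slice x m. g y = a (y (2 * slot m))"
  using g
proof (induction rule: coord_alg.induct)
  case (const c)
  show ?case by (rule bexI[of _ "\<lambda>w. c"]) (auto intro: HK_alg(1))
next
  case (base u n)
  show ?case
  proof (cases "n = slot m")
    case True then show ?thesis using base slot(1) by (intro bexI[of _ u]) auto
  next
    case False
    then show ?thesis by (intro bexI[of _ "\<lambda>w. u (x (2 * n))"]) (auto simp: Slice_def intro: HK_alg(1))
  qed
next
  case (root k) then show ?case by simp
next
  case (add f g)
  then obtain a b where "a \<in> HK K" "b \<in> HK K" "\<forall>y\<in>Slice x m. f y = a (y (2 * slot m))" "\<forall>y\<in>Slice x m. g y = b (y (2 * slot m))" by blast
  then show ?case by (intro bexI[of _ "\<lambda>w. a w + b w"]) (auto intro: HK_alg(2))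
next
  case (mult f g)
  then obtain a b where "a \<in> HK K" "b \<in> HK K" "\<forall>y\<in>Slice x m. f y = a (y (2 * slot m))" "\<forall>y\<in>Slice x m. g y = b (y (2 * slot m))" by blast
  then show ?case by (intro bexI[of _ "\<lambda>w. a w * b w"]) (auto intro: HK_alg(3))
qed

lemma Alg_on_Slice:
  assumes x: "x \<in> S" and g: "g \<in> Alg"
  shows "\<exists>M. \<exists>P\<in>Sp m M. \<forall>y\<in>Slice x m. g y = P y"
  using g unfolding Alg_def
proof (induction rule: coord_alg.induct)
  case (const c)
  have "(\<lambda>y. c) \<in> Sp m 0" using Sp.mono[where m = m and M = 0, OF HK_alg(1)[of c]] by simp
  then show ?case by (intro exI[of _ 0] bexI[of _ "\<lambda>y. c"]) auto
next
  case (base u n)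
  obtain a where a: "a \<in> HK K" "\<forall>y\<in>Slice x m. u (y (2 * n)) = a (y (2 * slot m))"
    using base_on_Slice[OF x coord_alg.base[of u Kc n "{}", OF base], of m] by blast
  have "(\<lambda>y. a (y (2 * slot m))) \<in> Sp m 0" using Sp.mono[where m = m and M = 0, OF a(1)] by simp
  then show ?case using a(2) by (intro exI[of _ 0] bexI[of _ "\<lambda>y. a (y (2 * slot m))"]) auto
next
  case (root k)
  have "(\<lambda>y. 1 * (\<Prod>i<Suc k. y (2 * i + 1) ^ (if i = k then 1 else 0))) \<in> Sp m (Suc k)"
    by (rule Sp.mono[where m = m and M = "Suc k" and \<alpha> = "\<lambda>i. if i = k then 1 else 0", OF HK_alg(1)[of 1]])
  moreover have "(\<Prod>i<Suc k. y (2 * i + 1) ^ (if i = k then 1 else 0)) = y (2 * k + 1)" for y :: "nat \<Rightarrow> complex"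
    by simp
  ultimately have "(\<lambda>y. y (2 * k + 1)) \<in> Sp m (Suc k)" by simp
  then show ?case by (intro exI[of _ "Suc k"] bexI[of _ "\<lambda>y. y (2 * k + 1)"]) auto
next
  case (add f g)
  then obtain M P M' P' where "P \<in> Sp m M" "P' \<in> Sp m M'" and e: "\<forall>y\<in>Slice x m. f y = P y" "\<forall>y\<in>Slice x m. g y = P' y" by blast
  then have "P \<in> Sp m (max M M')" "P' \<in> Sp m (max M M')" by (auto intro: Sp_mono)
  from Sp.add[OF this] show ?case using e by (intro exI[of _ "max M M'"] bexI[of _ "\<lambda>y. P y + P' y"]) auto
next
  case (mult f g)
  then obtain M P M' P' where "P \<in> Sp m M" "P' \<in> Sp m M'" and e: "\<forall>y\<in>Slice x m. f y = P y" "\<forall>y\<in>Slice x m. g y = P' y" by blast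
  then have "P \<in> Sp m (max M M')" "P' \<in> Sp m (max M M')" by (auto intro: Sp_mono)
  from Sp_mult[OF this] show ?case using e by (intro exI[of _ "max M M'"] bexI[of _ "\<lambda>y. P y * P' y"]) auto
qed

section \<open>Averaging over the deck transformations\<close>

text \<open>A deck transformation of the k-th root for \<zeta> with \<zeta>^N = 1. The other
  equations of \<open>S\<close> are unaffected, since the functions \<open>f j\<close> depend on
  even coordinates only.\<close>

definition rot :: "nat \<Rightarrow> complex \<Rightarrow> (nat \<Rightarrow> complex) \<Rightarrow> nat \<Rightarrow> complex"
  where "rot k \<zeta> y = y(2 * k + 1 := \<zeta> * y (2 * k + 1))"

lemma rot_coord: "rot k \<zeta> y (2 * n) = y (2 * n)"
  "rot k \<zeta> y (2 * j + 1) = (if j = k then \<zeta> * y (2 * j + 1) else y (2 * j + 1))"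
  by (auto simp: rot_def) presburger

lemma rot_Slice:
  assumes y: "y \<in> Slice x m" and z: "\<zeta> ^ N k = 1"
  shows "rot k \<zeta> y \<in> Slice x m"
proof -
  have "f j (rot k \<zeta> y) = f j y" for j by (rule coord_alg_even[OF f_alg]) (simp add: rot_coord(1))
  moreover have "rot k \<zeta> y (2 * j + 1) ^ N j = y (2 * j + 1) ^ N j" for j
    unfolding rot_coord(2) using z by (simp add: power_mult_distrib)
  ultimately show ?thesis using y by (auto simp only: Slice_def S_def base_space_def rot_coord(1) mem_Collect_eq)
qed

definition rot_avg :: "nat \<Rightarrow> ((nat \<Rightarrow> complex) \<Rightarrow> complex) \<Rightarrow> (nat \<Rightarrow> complex) \<Rightarrow> complex"
  where "rot_avg k P y = (\<Sum>i<N k. P (rot k (exp (2 * of_real pi * \<i> * of_nat i / of_nat (N k))) y)) / of_nat (N k)"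

text \<open>Averaging annihilates monomials in which the exponent of the k-th root is not a multiple
  of \<open>N k\<close>. In the others the power of the root is a power of \<open>f k\<close>, which
  on the slice is a function of the slice coordinate.\<close>

lemma rot_avg_Sp:
  assumes x: "x \<in> S" and P: "P \<in> Sp m (Suc k)"
  shows "\<exists>P'\<in>Sp m k. \<forall>y\<in>Slice x m. rot_avg k P y = P' y"
  using P
proof (induction rule: Sp.induct)
  case (mono a \<alpha>)
  define \<zeta> where "\<zeta> i = exp (2 * complex_of_real pi * \<i> * of_nat i / of_nat (N k))" for i
  define c where "c y = a (y (2 * slot m)) * (\<Prod>j<k. y (2 * j + 1) ^ \<alpha> j)" for y
  have \<zeta>: "\<zeta> i ^ \<alpha> k = \<zeta> (\<alpha> k) ^ i" for i
    unfolding \<zeta>_def exp_of_nat_mult[symmetric] by (simp add: mult_ac)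
  have \<zeta>N: "\<zeta> i ^ N k = 1" for i
    unfolding \<zeta>_def using N_pos[of k] complex_root_unity[of "N k" i] by simp
  have e: "rot_avg k (\<lambda>y. a (y (2 * slot m)) * (\<Prod>j<Suc k. y (2 * j + 1) ^ \<alpha> j)) y =
      c y * y (2 * k + 1) ^ \<alpha> k * ((\<Sum>i<N k. \<zeta> (\<alpha> k) ^ i) / of_nat (N k))" for y
  proof -
    have "a (rot k (\<zeta> i) y (2 * slot m)) * (\<Prod>j<Suc k. rot k (\<zeta> i) y (2 * j + 1) ^ \<alpha> j) =
        c y * y (2 * k + 1) ^ \<alpha> k * \<zeta> (\<alpha> k) ^ i" for i
      unfolding rot_coord by (simp add: c_def power_mult_distrib \<zeta> mult_ac)
    then show ?thesis unfolding rot_avg_def \<zeta>_def[symmetric] by (simp add: sum_distrib_left)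
  qed
  show ?case
  proof (cases "N k dvd \<alpha> k")
    case True
    then obtain d where d: "\<alpha> k = N k * d" by blast
    have "\<zeta> (\<alpha> k) = 1" using True complex_root_unity_eq_1[of "N k" "\<alpha> k"] N_pos[of k] by (simp add: \<zeta>_def)
    then have e1: "rot_avg k (\<lambda>y. a (y (2 * slot m)) * (\<Prod>j<Suc k. y (2 * j + 1) ^ \<alpha> j)) y = c y * y (2 * k + 1) ^ \<alpha> k" for y
      unfolding e using N_pos[of k] by simp
    obtain b where b: "b \<in> HK K" "\<forall>y\<in>Slice x m. f k y = b (y (2 * slot m))" using base_on_Slice[OF x f_alg] by blast
    have bd: "(\<lambda>w. b w ^ d) \<in> HK K"
    proof (induction d)
      case 0 then show ?case using HK_alg(1)[of 1] by simp
    next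
      case (Suc d) then show ?case using HK_alg(3)[OF b(1) Suc] by simp
    qed
    have "(\<lambda>y. (\<lambda>w. a w * b w ^ d) (y (2 * slot m)) * (\<Prod>j<k. y (2 * j + 1) ^ \<alpha> j)) \<in> Sp m k"
      by (rule Sp.mono[OF HK_alg(3)[OF mono bd]])
    moreover have "rot_avg k (\<lambda>y. a (y (2 * slot m)) * (\<Prod>j<Suc k. y (2 * j + 1) ^ \<alpha> j)) y =
        (\<lambda>w. a w * b w ^ d) (y (2 * slot m)) * (\<Prod>j<k. y (2 * j + 1) ^ \<alpha> j)" if y: "y \<in> Slice x m" for y
    proof -
      have "y (2 * k + 1) ^ \<alpha> k = b (y (2 * slot m)) ^ d"
        unfolding d power_mult using S_root[OF Slice_S[OF y], of k] b(2) y by simp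
      then show ?thesis unfolding e1 by (simp add: c_def)
    qed
    ultimately show ?thesis by (intro bexI[of _ "\<lambda>y. (\<lambda>w. a w * b w ^ d) (y (2 * slot m)) * (\<Prod>j<k. y (2 * j + 1) ^ \<alpha> j)"]) auto
  next
    case False
    have "\<zeta> (\<alpha> k) \<noteq> 1" using False complex_root_unity_eq_1[of "N k" "\<alpha> k"] N_pos[of k] by (simp add: \<zeta>_def)
    then have "(\<Sum>i<N k. \<zeta> (\<alpha> k) ^ i) = 0" using sum_powers_root_of_unity[OF N_pos \<zeta>N] by simp
    then have e0: "rot_avg k (\<lambda>y. a (y (2 * slot m)) * (\<Prod>j<Suc k. y (2 * j + 1) ^ \<alpha> j)) y = 0" for y
      unfolding e by simp
    have "(\<lambda>y. 0) \<in> Sp m k" using Sp.mono[where m = m and M = k, OF HK_alg(1)[of 0]] by simp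
    then show ?thesis using e0 by (intro bexI[of _ "\<lambda>y. 0"]) auto
  qed
next
  case (add P R)
  then obtain P' R' where PR: "P' \<in> Sp m k" "R' \<in> Sp m k" "\<forall>y\<in>Slice x m. rot_avg k P y = P' y" "\<forall>y\<in>Slice x m. rot_avg k R y = R' y" by blast
  have "rot_avg k (\<lambda>y. P y + R y) y = rot_avg k P y + rot_avg k R y" for y
    by (simp add: rot_avg_def sum.distrib add_divide_distrib)
  then show ?case using PR Sp.add[OF PR(1,2)] by (intro bexI[of _ "\<lambda>y. P' y + R' y"]) auto
qed

text \<open>The target \<open>c\<close> and the tolerance \<open>\<beta>\<close> depend on the slice
  coordinate only, so they are invariant under \<open>rot\<close> and every average satisfies the
  same estimate. Removing the roots one by one leaves a function on \<open>K\<close>.\<close>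

lemma Sp_average:
  assumes x: "x \<in> S"
  shows "P \<in> Sp m M \<Longrightarrow> (\<And>y. y \<in> Slice x m \<Longrightarrow> cmod (P y - c (y (2 * slot m))) \<le> \<beta> (y (2 * slot m))) \<Longrightarrow>
    \<exists>a\<in>HK K. \<forall>w\<in>K. cmod (a w - c w) \<le> \<beta> w"
proof (induction M arbitrary: P)
  case 0
  have "\<exists>a\<in>HK K. \<forall>y. P y = a (y (2 * slot m))" using 0(1)
  proof (induction rule: Sp.induct)
    case (mono a \<alpha>) then show ?case by (intro bexI[of _ a]) auto
  next
    case (add P R)
    then obtain a b where "a \<in> HK K" "b \<in> HK K" "\<forall>y. P y = a (y (2 * slot m))" "\<forall>y. R y = b (y (2 * slot m))" by blast
    then show ?case by (intro bexI[of _ "\<lambda>w. a w + b w"]) (auto intro: HK_alg(2))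
  qed
  then obtain a where a: "a \<in> HK K" "\<And>y. P y = a (y (2 * slot m))" by blast
  have "cmod (a w - c w) \<le> \<beta> w" if w: "w \<in> K" for w
  proof -
    \<comment> \<open>The slice projects onto all of \<open>K\<close>: put \<open>w\<close> in the
      place of the slice coordinate of \<open>x\<close> and choose all the roots anew.\<close>
    define y0 where "y0 i = (if i = 2 * slot m then w else x i)" for i
    have "\<exists>z. f k y0 = z ^ N k" for k using exists_complex_root[of "N k" "f k y0"] N_pos[of k] by auto
    then obtain r where r: "\<And>k. r k ^ N k = f k y0" by metis
    define y where "y i = (if even i then y0 i else r (i div 2))" for i
    have ye: "y (2 * n) = y0 (2 * n)" "y (2 * k + 1) = r k" for n k by (simp_all add: y_def)
    have "f k y = f k y0" for k by (rule coord_alg_even[OF f_alg]) (simp add: ye)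
    moreover have "y \<in> base_space Kc" using S_base[OF x] w slot(1)[of m] by (auto simp: base_space_def ye y0_def)
    ultimately have "y \<in> S" unfolding S_def mem_Collect_eq ye(2) using r by simp
    then have "y \<in> Slice x m" by (auto simp: Slice_def ye y0_def)
    moreover have "y (2 * slot m) = w" by (simp add: ye y0_def)
    ultimately show ?thesis using 0(2)[of y] a(2)[of y] by simp
  qed
  then show ?case using a(1) by blast
next
  case (Suc M)
  obtain P' where P': "P' \<in> Sp m M" "\<And>y. y \<in> Slice x m \<Longrightarrow> rot_avg M P y = P' y" using rot_avg_Sp[OF x Suc.prems(1)] by blast
  have "cmod (P' y - c (y (2 * slot m))) \<le> \<beta> (y (2 * slot m))" if y: "y \<in> Slice x m" for y
  proof -
    define \<zeta> where "\<zeta> i = exp (2 * complex_of_real pi * \<i> * of_nat i / of_nat (N M))" for i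
    have n0: "real (N M) > 0" using N_pos[of M] by simp
    have b: "cmod (P (rot M (\<zeta> i) y) - c (y (2 * slot m))) \<le> \<beta> (y (2 * slot m))" for i
    proof -
      have "\<zeta> i ^ N M = 1" unfolding \<zeta>_def using N_pos[of M] complex_root_unity[of "N M" i] by simp
      from Suc.prems(2)[OF rot_Slice[OF y this]] show ?thesis by (simp add: rot_coord(1))
    qed
    have "P' y - c (y (2 * slot m)) = (\<Sum>i<N M. P (rot M (\<zeta> i) y) - c (y (2 * slot m))) / of_nat (N M)"
      using n0 unfolding P'(2)[OF y, symmetric] rot_avg_def \<zeta>_def[symmetric] by (simp add: sum_subtractf diff_divide_distrib)
    then have "cmod (P' y - c (y (2 * slot m))) = cmod (\<Sum>i<N M. P (rot M (\<zeta> i) y) - c (y (2 * slot m))) / N M"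
      by (simp add: norm_divide)
    also have "\<dots> \<le> (\<Sum>i<N M. \<beta> (y (2 * slot m))) / N M"
      using n0 b by (intro divide_right_mono sum_norm_le) auto
    also have "\<dots> = \<beta> (y (2 * slot m))" using n0 by simp
    finally show ?thesis .
  qed
  from Suc.IH[OF P'(1) this] show ?case .
qed

text \<open>Multiplication by the unbounded function \<open>E\<close> stays in the algebra for functions vanishing near
  \<open>x\<close>; approximating the product and averaging over the roots contradicts the choice of \<open>K\<close>.\<close>

lemma coordinate_not_near_vanishing:
  assumes x: "x \<in> S" "roots_at x" and g: "g \<in> B" and v: "near (Slice x m) x (\<lambda>y. g y = 0)"
  shows "\<not> (\<forall>y\<in>S. cmod (y (2 * slot m) - g y) \<le> 1/200)"
proof
  assume close: "\<forall>y\<in>S. cmod (y (2 * slot m) - g y) \<le> 1/200"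
  obtain W where W: "open W" "x \<in> W" "\<And>y. y \<in> W \<Longrightarrow> y \<in> Slice x m \<Longrightarrow> g y = 0"
    using v unfolding near_def eventually_nhds by blast
  have x0: "x (2 * slot m) = 0" using x(2) slot(2)[of m] unfolding roots_at_def by blast
  have xS: "x \<in> Slice x m" using x(1) by (simp add: Slice_def)
  have nz: "y (2 * slot m) \<noteq> 0" if y: "y \<in> Slice x m - W" for y
  proof
    assume "y (2 * slot m) = 0"
    then have "y (2 * n) = x (2 * n)" for n using y x0 by (cases "n = slot m") (auto simp: Slice_def)
    then have "y = x" using y Slice_S by (intro roots_at_eqI[OF x]) auto
    then show False using y W(2) by blast
  qed
  \<comment> \<open>On the slice the coordinate vanishes at \<open>x\<close> only, because the fibre
    over the base point of \<open>x\<close> is a single point. By compactness it is bounded away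
    from 0 outside \<open>W\<close>.\<close>
  obtain \<rho> where \<rho>: "\<rho> > 0" "\<And>y. y \<in> Slice x m - W \<Longrightarrow> \<rho> \<le> cmod (y (2 * slot m))"
  proof (cases "Slice x m - W = {}")
    case True then show ?thesis using that[of 1] by auto
  next
    case False
    have "compact (Slice x m - W)" using compact_Slice W(1) by (rule compact_diff)
    moreover have "continuous_on (Slice x m - W) (\<lambda>y. cmod (y (2 * slot m)))" by (intro continuous_intros continuous_on_coord)
    ultimately obtain y0 where "y0 \<in> Slice x m - W" "\<forall>y\<in>Slice x m - W. cmod (y0 (2 * slot m)) \<le> cmod (y (2 * slot m))"
      using continuous_attains_inf False by blast
    then show ?thesis using that[of "cmod (y0 (2 * slot m))"] nz by auto
  qed
  obtain C where C: "C > 0" "\<forall>y\<in>S. cmod (g y) \<le> C" using B_alg(4)[OF g] by blast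
  define \<delta> where "\<delta> = min 1 (1/800 / (C * exp (1 / \<rho>) * exp 1))"
  have \<delta>: "0 < \<delta>" "\<delta> \<le> 1" "C * (exp (1 / \<rho>) * (exp 1 * \<delta>)) \<le> 1/800"
  proof -
    define D where "D = C * exp (1 / \<rho>) * exp 1"
    have D: "D > 0" using C(1) by (simp add: D_def)
    have "\<delta> \<le> 1/800 / D" unfolding \<delta>_def D_def by simp
    then have "\<delta> * D \<le> 1/800" using D by (simp only: pos_le_divide_eq)
    then show "C * (exp (1 / \<rho>) * (exp 1 * \<delta>)) \<le> 1/800" by (simp add: D_def mult_ac)
    show "0 < \<delta>" "\<delta> \<le> 1" using D unfolding \<delta>_def D_def[symmetric] by auto
  qed
  define \<sigma> where "\<sigma> = \<delta> * \<rho>\<^sup>2"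
  have \<sigma>: "\<sigma> > 0" using \<delta> \<rho> by (simp add: \<sigma>_def)
  \<comment> \<open>Moving the singularity to -\<sigma> makes the exponential holomorphic near
    \<open>K\<close>, where Re w >= 0. At points of the slice outside \<open>W\<close> one has |w|
    >= \<rho>, so the exponents differ by at most \<sigma> / \<rho>^2 = \<delta>.\<close>
  define E\<sigma> where "E\<sigma> w = exp (1 / (w + of_real \<sigma>))" for w :: complex
  have Eg: "E\<sigma> \<in> hol_germs (Kc (slot m))"
  proof -
    have "open {w. - \<sigma> < Re w}" by (rule open_halfspace_Re_gt)
    moreover have "K \<subseteq> {w. - \<sigma> < Re w}" using K(2) \<sigma> by fastforce
    moreover have "E\<sigma> holomorphic_on {w. - \<sigma> < Re w}" unfolding E\<sigma>_def
      by (intro holomorphic_intros) (auto simp: complex_eq_iff)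
    ultimately show ?thesis unfolding hol_germs_def slot(1) by blast
  qed
  have EB: "(\<lambda>y. g y * E\<sigma> (y (2 * slot m))) \<in> B"
    by (intro B_alg(3) g base_coord_in_B subsetD[OF uclosure_superset] Eg)
  have "(0::real) < 1/800" by simp
  then obtain P where P: "P \<in> Alg" "\<forall>y\<in>S. cmod (g y * E\<sigma> (y (2 * slot m)) - P y) < 1/800"
    using EB unfolding uclosure_def mem_Collect_eq by meson
  have gE: "cmod (g y * E\<sigma> (y (2 * slot m)) - g y * E (y (2 * slot m))) \<le> 1/800" if y: "y \<in> Slice x m" for y
  proof (cases "y \<in> W")
    case True then show ?thesis using W(3)[OF True y] by simp
  next
    case False
    define w where "w = y (2 * slot m)"
    have w: "0 \<le> Re w" "\<rho> \<le> cmod w" using Slice_K[OF y] K(2) \<rho>(2)[of y] y False by (auto simp: w_def)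
    have w0: "w \<noteq> 0" using w \<rho>(1) by auto
    have "(cmod w)\<^sup>2 \<le> (cmod (w + of_real \<sigma>))\<^sup>2"
      unfolding cmod_power2 using w(1) \<sigma> by (simp add: power_mono)
    then have ws: "cmod w \<le> cmod (w + of_real \<sigma>)" by (rule power2_le_imp_le) simp
    have ws0: "w + of_real \<sigma> \<noteq> 0" using ws w0 by auto
    define d where "d = 1 / (w + of_real \<sigma>) - 1 / w"
    have "d = - of_real \<sigma> / ((w + of_real \<sigma>) * w)" using w0 ws0 by (simp add: d_def field_simps)
    then have "cmod d = \<sigma> / (cmod (w + of_real \<sigma>) * cmod w)" using \<sigma> by (simp add: norm_divide norm_mult)
    also have "\<dots> \<le> \<sigma> / (\<rho> * \<rho>)"
      using ws w(2) \<rho>(1) \<sigma> by (intro divide_left_mono mult_mono mult_pos_pos) auto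
    also have "\<dots> = \<delta>" using \<rho>(1) by (simp add: \<sigma>_def power2_eq_square)
    finally have d: "cmod d \<le> \<delta>" .
    have "E\<sigma> w - E w = E w * (exp d - 1)"
      by (simp add: E\<sigma>_def E_def d_def exp_diff right_diff_distrib)
    then have "cmod (E\<sigma> w - E w) = cmod (E w) * cmod (exp d - 1)" by (simp add: norm_mult)
    also have "\<dots> \<le> exp (1 / \<rho>) * (exp 1 * \<delta>)"
    proof (intro mult_mono)
      have "1 / cmod w \<le> 1 / \<rho>" using w(2) \<rho>(1) by (intro divide_left_mono mult_pos_pos) auto
      then show "cmod (E w) \<le> exp (1 / \<rho>)" using cmod_E_le[of w] by (meson exp_le_cancel_iff order_trans)
      have "cmod (exp d - 1) \<le> exp (cmod d) * cmod d" using Taylor_exp_field[of d 0] by simp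
      also have "\<dots> \<le> exp 1 * \<delta>" using d \<delta> by (intro mult_mono) auto
      finally show "cmod (exp d - 1) \<le> exp 1 * \<delta>" .
    qed auto
    finally have "cmod (g y) * cmod (E\<sigma> w - E w) \<le> C * (exp (1 / \<rho>) * (exp 1 * \<delta>))"
      using C Slice_S[OF y] by (intro mult_mono) auto
    then show ?thesis using \<delta>(3) unfolding w_def by (simp add: right_diff_distrib[symmetric] norm_mult)
  qed
  \<comment> \<open>The error consists of 1/800 for the approximation by \<open>Alg\<close>, 1/800
    for the shift of the singularity and |E w| / 200 for the distance of g from the coordinate. A
    further 1/400 is spent below on replacing a limit of germs by a germ, which gives (1/200) (|E w|
    + 1).\<close>
  have PE: "cmod (P y - y (2 * slot m) * E (y (2 * slot m))) \<le> 1/400 + (1/200) * cmod (E (y (2 * slot m)))"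
    if y: "y \<in> Slice x m" for y
  proof -
    define w where "w = y (2 * slot m)"
    have "P y - w * E w = (P y - g y * E\<sigma> w) + (g y * E\<sigma> w - g y * E w) - (w - g y) * E w" by (simp add: algebra_simps)
    also have "cmod \<dots> \<le> cmod (P y - g y * E\<sigma> w) + cmod (g y * E\<sigma> w - g y * E w) + cmod ((w - g y) * E w)"
      by (rule order_trans[OF norm_triangle_ineq4 add_right_mono[OF norm_triangle_ineq]])
    also have "\<dots> \<le> 1/800 + 1/800 + (1/200) * cmod (E w)"
    proof (intro add_mono)
      show "cmod (P y - g y * E\<sigma> w) \<le> 1/800" using P(2) Slice_S[OF y] by (force simp: w_def norm_minus_commute)
      show "cmod (g y * E\<sigma> w - g y * E w) \<le> 1/800" using gE[OF y] by (simp add: w_def)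
      show "cmod ((w - g y) * E w) \<le> (1/200) * cmod (E w)"
        unfolding norm_mult using close Slice_S[OF y] by (intro mult_right_mono) (auto simp: w_def)
    qed
    finally show ?thesis by (simp add: w_def)
  qed
  obtain M P' where P': "P' \<in> Sp m M" "\<And>y. y \<in> Slice x m \<Longrightarrow> P y = P' y" using Alg_on_Slice[OF x(1) P(1)] by blast
  have "cmod (P' y - (\<lambda>w. w * E w) (y (2 * slot m))) \<le> (\<lambda>w. 1/400 + (1/200) * cmod (E w)) (y (2 * slot m))"
    if "y \<in> Slice x m" for y using PE[OF that] P'(2)[OF that] by simp
  from Sp_average[OF x(1) P'(1) this] obtain a where a: "a \<in> HK K" "\<forall>w\<in>K. cmod (a w - w * E w) \<le> 1/400 + (1/200) * cmod (E w)" by auto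
  have "(0::real) < 1/400" by simp
  then obtain a' where a': "a' \<in> hol_germs K" "\<forall>w\<in>K. cmod (a w - a' w) < 1/400"
    using a(1) unfolding uclosure_def mem_Collect_eq by meson
  have "cmod (a' w - w * E w) \<le> (1/200) * (cmod (E w) + 1)" if w: "w \<in> K" for w
  proof -
    have "cmod (a' w - w * E w) \<le> cmod (a' w - a w) + cmod (a w - w * E w)"
      using norm_triangle_ineq[of "a' w - a w" "a w - w * E w"] by simp
    moreover have "cmod (a' w - a w) \<le> 1/400" using a'(2) w by (force simp: norm_minus_commute)
    moreover have "cmod (a w - w * E w) \<le> 1/400 + (1/200) * cmod (E w)" using a(2) w by blast
    ultimately show ?thesis by argo
  qed
  then show False using K_not_approx[OF a'(1)] by blast
qed

section \<open>The one-parameter family of closed ideals\<close>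

definition slice_ideal :: "(nat \<Rightarrow> complex) \<Rightarrow> real \<Rightarrow> ((nat \<Rightarrow> complex) \<Rightarrow> complex) set"
  where "slice_ideal x t = {g \<in> FA.BB. g x = 0 \<and> (\<forall>m. q m < t \<longrightarrow> near (Slice x m) x (\<lambda>y. g y = 0))}"

definition H :: "(nat \<Rightarrow> complex) \<Rightarrow> real \<Rightarrow> ((nat \<Rightarrow> complex) \<Rightarrow> complex) set"
  where "H x t = {f \<in> FA.BB. \<forall>e>0. \<exists>g\<in>slice_ideal x t. \<forall>y\<in>S. cmod (f y - g y) \<le> e}"

lemma slice_ideal_subset_H: "slice_ideal x t \<subseteq> H x t"
proof
  fix g assume "g \<in> slice_ideal x t"
  then show "g \<in> H x t" unfolding H_def by (auto simp: slice_ideal_def intro!: bexI[of _ g])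
qed

lemma slice_ideal_add:
  assumes "g \<in> slice_ideal x t" "h \<in> slice_ideal x t" and x: "x \<in> S"
  shows "(\<lambda>y\<in>S. g y + h y) \<in> slice_ideal x t"
  unfolding slice_ideal_def
proof (intro CollectI conjI allI impI)
  show "(\<lambda>y\<in>S. g y + h y) \<in> FA.BB" using assms ext_algebraD(3)[OF FA.ext_algebra_BB] by (simp add: slice_ideal_def)
  show "(\<lambda>y\<in>S. g y + h y) x = 0" using assms by (simp add: slice_ideal_def)
  fix m assume "q m < t"
  then have "near (Slice x m) x (\<lambda>y. g y = 0)" "near (Slice x m) x (\<lambda>y. h y = 0)" using assms by (auto simp: slice_ideal_def)
  from near_conj[OF this] show "near (Slice x m) x (\<lambda>y. (\<lambda>y\<in>S. g y + h y) y = 0)"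
    by (rule near_mono) (simp add: Slice_S)
qed

lemma slice_ideal_mult:
  assumes "g \<in> slice_ideal x t" "h \<in> FA.BB" and x: "x \<in> S"
  shows "(\<lambda>y\<in>S. h y * g y) \<in> slice_ideal x t"
  unfolding slice_ideal_def
proof (intro CollectI conjI allI impI)
  show "(\<lambda>y\<in>S. h y * g y) \<in> FA.BB" using assms ext_algebraD(4)[OF FA.ext_algebra_BB] by (simp add: slice_ideal_def)
  show "(\<lambda>y\<in>S. h y * g y) x = 0" using assms by (simp add: slice_ideal_def)
  fix m assume "q m < t"
  then have "near (Slice x m) x (\<lambda>y. g y = 0)" using assms by (auto simp: slice_ideal_def)
  then show "near (Slice x m) x (\<lambda>y. (\<lambda>y\<in>S. h y * g y) y = 0)"
    by (rule near_mono) (simp add: Slice_S)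
qed

lemma ideal_H:
  assumes x: "x \<in> S" shows "ideal (H x t) (function_ring FA.X FA.BB)"
proof (rule function_ring_idealI[OF FA.ext_algebra_BB])
  show "H x t \<subseteq> FA.BB" by (auto simp: H_def)
  have "(\<lambda>y\<in>S. 0) \<in> slice_ideal x t"
    using ext_algebraD(2)[OF FA.ext_algebra_BB, of 0] x by (auto simp: slice_ideal_def near_def Slice_def)
  then show "(\<lambda>y\<in>topspace FA.X. 0) \<in> H x t" using slice_ideal_subset_H by auto
  fix f g assume f: "f \<in> H x t"
  { assume g: "g \<in> H x t"
    have "(\<lambda>y\<in>S. f y + g y) \<in> H x t" unfolding H_def
    proof (intro CollectI conjI allI impI)
      show "(\<lambda>y\<in>S. f y + g y) \<in> FA.BB" using f g ext_algebraD(3)[OF FA.ext_algebra_BB] by (simp add: H_def)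
      fix e :: real assume "0 < e"
      then have "0 < e / 2" by simp
      then obtain f' g' where fg: "f' \<in> slice_ideal x t" "\<forall>y\<in>S. cmod (f y - f' y) \<le> e / 2"
        "g' \<in> slice_ideal x t" "\<forall>y\<in>S. cmod (g y - g' y) \<le> e / 2" using f g unfolding H_def mem_Collect_eq by meson
      have "cmod ((\<lambda>y\<in>S. f y + g y) y - (\<lambda>y\<in>S. f' y + g' y) y) \<le> e" if y: "y \<in> S" for y
      proof -
        have "f y + g y - (f' y + g' y) = (f y - f' y) + (g y - g' y)" by simp
        also have "cmod \<dots> \<le> cmod (f y - f' y) + cmod (g y - g' y)" by (rule norm_triangle_ineq)
        also have "\<dots> \<le> e / 2 + e / 2" using fg y by (intro add_mono) auto
        finally show ?thesis using y by simp
      qed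
      then show "\<exists>h\<in>slice_ideal x t. \<forall>y\<in>S. cmod ((\<lambda>y\<in>S. f y + g y) y - h y) \<le> e"
        by (intro bexI[OF _ slice_ideal_add[OF fg(1,3) x]]) auto
    qed
    then show "(\<lambda>y\<in>topspace FA.X. f y + g y) \<in> H x t" by simp }
  { assume g: "g \<in> FA.BB"
    obtain C where C: "C > 0" "\<forall>y\<in>S. cmod (g y) \<le> C" using B_alg(4)[OF FA.BB_UA[OF g]] by blast
    have "(\<lambda>y\<in>S. g y * f y) \<in> H x t" unfolding H_def
    proof (intro CollectI conjI allI impI)
      show "(\<lambda>y\<in>S. g y * f y) \<in> FA.BB" using f g ext_algebraD(4)[OF FA.ext_algebra_BB] by (simp add: H_def)
      fix e :: real assume "0 < e"
      then have "0 < e / C" using C by simp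
      then obtain f' where f': "f' \<in> slice_ideal x t" "\<forall>y\<in>S. cmod (f y - f' y) \<le> e / C"
        using f unfolding H_def mem_Collect_eq by meson
      have "cmod ((\<lambda>y\<in>S. g y * f y) y - (\<lambda>y\<in>S. g y * f' y) y) \<le> e" if y: "y \<in> S" for y
      proof -
        have "cmod (g y) * cmod (f y - f' y) \<le> C * (e / C)" using C f'(2) y by (intro mult_mono) auto
        then show ?thesis using y C(1) by (simp add: right_diff_distrib[symmetric] norm_mult)
      qed
      then show "\<exists>h\<in>slice_ideal x t. \<forall>y\<in>S. cmod ((\<lambda>y\<in>S. g y * f y) y - h y) \<le> e"
        by (intro bexI[OF _ slice_ideal_mult[OF f'(1) g x]]) auto
    qed
    then show "(\<lambda>y\<in>topspace FA.X. g y * f y) \<in> H x t" by simp }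
qed

lemma closed_ideal_H:
  assumes x: "x \<in> S" shows "closed_ideal FA.X FA.BB (H x t)"
proof (rule FA.closed_idealI[OF ideal_H[OF x]])
  fix f assume f: "f \<in> FA.BB" and lim: "\<And>e. 0 < e \<Longrightarrow> \<exists>g\<in>H x t. \<forall>y\<in>S. cmod (f y - g y) \<le> e"
  show "f \<in> H x t" unfolding H_def
  proof (intro CollectI conjI f allI impI)
    fix e :: real assume "0 < e"
    then have e: "0 < e / 2" by simp
    from lim[OF e] obtain g where g: "g \<in> H x t" "\<forall>y\<in>S. cmod (f y - g y) \<le> e / 2" by blast
    then obtain h where h: "h \<in> slice_ideal x t" "\<forall>y\<in>S. cmod (g y - h y) \<le> e / 2" using e unfolding H_def mem_Collect_eq by meson
    have "cmod (f y - h y) \<le> e" if "y \<in> S" for y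
    proof -
      have "cmod (f y - h y) \<le> cmod (f y - g y) + cmod (g y - h y)"
        using norm_triangle_ineq[of "f y - g y" "g y - h y"] by simp
      then show ?thesis using g(2) h(2) that by fastforce
    qed
    then show "\<exists>h\<in>slice_ideal x t. \<forall>y\<in>S. cmod (f y - h y) \<le> e" using h(1) by blast
  qed
qed

lemma H_subset_M:
  assumes x: "x \<in> S" shows "H x t \<subseteq> M_ideal FA.BB x"
proof
  fix f assume f: "f \<in> H x t"
  have "cmod (f x) \<le> 0 + e" if e: "0 < e" for e
  proof -
    obtain g where "g \<in> slice_ideal x t" "\<forall>y\<in>S. cmod (f y - g y) \<le> e" using f e unfolding H_def by blast
    then show ?thesis using x unfolding slice_ideal_def by fastforce
  qed
  then have "cmod (f x) \<le> 0" by (rule field_le_epsilon)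
  then show "f \<in> M_ideal FA.BB x" using f by (simp add: M_ideal_def H_def)
qed

lemma J_subset_H:
  assumes x: "x \<in> S" shows "J_ideal FA.X FA.BB x \<subseteq> H x t"
proof
  fix f assume "f \<in> J_ideal FA.X FA.BB x"
  then obtain V where f: "f \<in> FA.BB" "openin FA.X V" "x \<in> V" "\<forall>y\<in>V. f y = 0" unfolding J_ideal_def by blast
  then obtain W where W: "open W" "V = S \<inter> W" unfolding openin_open by blast
  have "near (Slice x m) x (\<lambda>y. f y = 0)" for m
    unfolding near_def eventually_nhds using W f Slice_S by blast
  then have "f \<in> slice_ideal x t" using f by (simp add: slice_ideal_def)
  then show "f \<in> H x t" using slice_ideal_subset_H by blast
qed

lemma H_antimono: "s \<le> t \<Longrightarrow> H x t \<subseteq> H x s"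
proof -
  assume "s \<le> t"
  then have "slice_ideal x t \<subseteq> slice_ideal x s" by (auto simp: slice_ideal_def)
  then show ?thesis unfolding H_def by blast
qed

text \<open>A slice coordinate with s <= q m < t separates the two ideals. It is 0 on every slice
  with q i < s, since this is another slice and the coordinate is frozen there at its value 0 at
  \<open>x\<close>; but no element of \<open>slice_ideal x t\<close> is within 1/200 of it.\<close>

lemma H_strict:
  assumes x: "x \<in> S" "roots_at x" and st: "s < t" shows "H x t \<subset> H x s"
proof -
  obtain m where m: "s \<le> q m" "q m < t" using q_dense[OF st] by blast
  define F where "F = restrict (\<lambda>y. y (2 * slot m)) S"
  have x0: "x (2 * slot i) = 0" for i using x(2) slot(2)[of i] unfolding roots_at_def by blast
  have "(\<lambda>w. w) \<in> HK (Kc (slot m))" by (rule subsetD[OF uclosure_superset]) (intro hol_germs_entire holomorphic_intros)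
  from FA.restrict_BB[OF base_coord_in_B[OF this]] have FB: "F \<in> FA.BB" by (simp add: F_def)
  have "F \<in> slice_ideal x s" unfolding slice_ideal_def
  proof (intro CollectI conjI FB allI impI)
    show "F x = 0" using x(1) x0[of m] by (simp add: F_def)
    fix i assume "q i < s"
    then have "m \<noteq> i" using m(1) by auto
    then have "slot m \<noteq> slot i" using slot(3) by (simp add: inj_eq)
    then have "F y = 0" if "y \<in> Slice x i" for y using that x0[of m] by (simp add: F_def Slice_def)
    then show "near (Slice x i) x (\<lambda>y. F y = 0)" by (simp add: near_def)
  qed
  then have 1: "F \<in> H x s" using slice_ideal_subset_H by blast
  have 2: "F \<notin> H x t"
  proof
    assume "F \<in> H x t"
    moreover have "(0::real) < 1/200" by simp
    ultimately obtain g where g: "g \<in> slice_ideal x t" "\<forall>y\<in>S. cmod (F y - g y) \<le> 1/200" unfolding H_def by blast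
    have "near (Slice x m) x (\<lambda>y. g y = 0)" using g(1) m(2) by (simp add: slice_ideal_def)
    moreover have "g \<in> B" using g(1) FA.BB_UA by (simp add: slice_ideal_def)
    moreover have "\<forall>y\<in>S. cmod (y (2 * slot m) - g y) \<le> 1/200" using g(2) by (simp add: F_def)
    ultimately show False using coordinate_not_near_vanishing[OF x, of g m] by blast
  qed
  show ?thesis using 1 2 H_antimono[of s t x] st by auto
qed

lemma ideal_family:
  assumes x: "x \<in> S" "roots_at x"
  shows "\<exists>H :: real \<Rightarrow> ((nat \<Rightarrow> complex) \<Rightarrow> complex) set.
       (\<forall>\<rho>\<ge>0. closed_ideal FA.X FA.BB (H \<rho>) \<and> primary_ideal FA.X FA.BB (H \<rho>) \<and> H \<rho> \<subseteq> M_ideal FA.BB x) \<and>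
       inj_on H {0..} \<and>
       (\<forall>\<rho>1 \<rho>2. 0 \<le> \<rho>1 \<and> \<rho>1 < \<rho>2 \<longrightarrow> H \<rho>2 \<subset> H \<rho>1)"
proof (intro exI[of _ "H x"] conjI allI impI)
  show "closed_ideal FA.X FA.BB (H x \<rho>)" for \<rho> by (rule closed_ideal_H[OF x(1)])
  show "primary_ideal FA.X FA.BB (H x \<rho>)" for \<rho>
    by (rule FA.primary_idealI[OF x(1) ideal_H[OF x(1)] J_subset_H[OF x(1)] H_subset_M[OF x(1)]])
  show "H x \<rho> \<subseteq> M_ideal FA.BB x" for \<rho> by (rule H_subset_M[OF x(1)])
  show "inj_on (H x) {0..}"
  proof (rule inj_onI)
    fix s t assume "H x s = H x t"
    then show "s = t" using H_strict[OF x, of s t] H_strict[OF x, of t s] by (cases s t rule: linorder_cases) auto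
  qed
  show "H x \<rho>2 \<subset> H x \<rho>1" if "0 \<le> \<rho>1 \<and> \<rho>1 < \<rho>2" for \<rho>1 \<rho>2 using H_strict[OF x] that by blast
qed

end

section \<open>The alternating product of two-point sets and cheeses\<close>

theorem theorem1p7:
  shows "\<exists>(X :: (nat \<Rightarrow> complex) topology) B L.
    metrizable_space X \<and>
    normal_uniform_algebra X B \<and>
    (\<forall>x\<in>topspace X. peak_point X B x) \<and>
    L \<subseteq> topspace X \<and> uncountable L \<and>
    (\<forall>x\<in>L. \<exists>H :: real \<Rightarrow> ((nat \<Rightarrow> complex) \<Rightarrow> complex) set.
       (\<forall>\<rho>\<ge>0. closed_ideal X B (H \<rho>) \<and> primary_ideal X B (H \<rho>) \<and> H \<rho> \<subseteq> M_ideal B x) \<and>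
       inj_on H {0..} \<and>
       (\<forall>\<rho>1 \<rho>2. 0 \<le> \<rho>1 \<and> \<rho>1 < \<rho>2 \<longrightarrow> H \<rho>2 \<subset> H \<rho>1)) \<and>
    (\<forall>x \<in> topspace X - L. bounded_relative_units X B x)"
proof -
  obtain K U where K: "compact K" "K \<subseteq> {w. 0 \<le> Re w}" "0 \<in> K" "local_cuts K U"
    "\<forall>a\<in>hol_germs K. \<not> (\<forall>w\<in>K. cmod (a w - w * E w) \<le> (1/200) * (cmod (E w) + 1))"
    using planar_cheese_exists by (elim exE conjE)
  \<comment> \<open>In a two-point factor \<open>Z n\<close> is the whole set, so that
    \<open>L\<close> is free to vary in these factors, while each cheese factor contributes one
    direction for a slice.\<close>
  define Kc where "Kc n = (if even n then {0, 1} else K)" for n :: nat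
  define Z where "Z n = (if even n then {0, 1} else {0::complex})" for n :: nat
  define Uc where "Uc n = (if even n then {\<lambda>w. w, \<lambda>w. 1 - w} else U)" for n :: nat
  have pk: "\<exists>h\<in>HK (Kc n). h z = 1 \<and> (\<forall>w\<in>Kc n - {z}. cmod (h w) < 1)" if z: "z \<in> Z n" for n z
  proof -
    consider "even n" "z = 0" | "even n" "z = 1" | "odd n" "z = 0" using z by (auto simp: Z_def split: if_splits)
    then show ?thesis
    proof cases
      case 1
      have "(\<lambda>w. 1 - w) \<in> HK (Kc n)" by (rule subsetD[OF uclosure_superset]) (intro hol_germs_entire holomorphic_intros)
      then show ?thesis using 1 by (intro bexI[of _ "\<lambda>w. 1 - w"]) (auto simp: Kc_def)
    next
      case 2
      have "(\<lambda>w. w) \<in> HK (Kc n)" by (rule subsetD[OF uclosure_superset]) (intro hol_germs_entire holomorphic_intros)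
      then show ?thesis using 2 by (intro bexI[of _ "\<lambda>w. w"]) (auto simp: Kc_def)
    next
      case 3
      have re: "0 \<le> Re w" if "w \<in> Kc n" for w using that K(2) 3 by (auto simp: Kc_def)
      have "(\<lambda>w. inverse (1 + w)) \<in> hol_germs (Kc n)"
      proof (rule hol_germs_inverse)
        show "(\<lambda>w. 1 + w) \<in> hol_germs (Kc n)" by (intro hol_germs_entire holomorphic_intros)
        show "1 + w \<noteq> 0" if "w \<in> Kc n" for w using re[OF that] by (auto simp: complex_eq_iff)
      qed
      moreover have "cmod (inverse (1 + w)) < 1" if w: "w \<in> Kc n" "w \<noteq> 0" for w
      proof -
        \<comment> \<open>|1 + w|^2 = 1 + 2 Re w + |w|^2, and Re w >= 0 on the cheese.\<close>
        have "0 < (Re w)\<^sup>2 + (Im w)\<^sup>2" using w(2) by (simp add: complex_neq_0)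
        then have "1\<^sup>2 < (cmod (1 + w))\<^sup>2"
          unfolding cmod_power2 using re[OF w(1)] by (simp add: power2_eq_square algebra_simps)
        then have "1 < cmod (1 + w)" by (rule power2_less_imp_less) simp
        then show ?thesis by (simp add: norm_inverse inverse_less_1_iff)
      qed
      ultimately show ?thesis using 3(2) uclosure_superset by (intro bexI[of _ "\<lambda>w. inverse (1 + w)"]) auto
    qed
  qed
  interpret base_data Kc Z Uc
  proof
    show "compact (Kc n)" for n using K(1) by (simp add: Kc_def)
    show "Z n \<subseteq> Kc n" "closed (Z n)" for n using K(3) by (auto simp: Z_def Kc_def)
    show "local_cuts (Kc n) (Uc n)" for n using K(4) local_cuts_two_points by (simp add: Kc_def Uc_def)
  qed (rule pk)
  obtain f N where "root_data f N" using root_data_exists by blast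
  then interpret root_extension Kc Z Uc f N by unfold_locales
  define q where "q m = (real_of_rat (from_nat_into UNIV m))" for m
  interpret slices Kc Z Uc f N K "\<lambda>m. 2 * m + 1" q
  proof
    show "Kc (2 * m + 1) = K" "Z (2 * m + 1) = {0}" for m by (simp_all add: Kc_def Z_def)
    show "inj (\<lambda>m::nat. 2 * m + 1)" by (simp add: inj_on_def)
    show "0 \<in> K" "K \<subseteq> {w. 0 \<le> Re w}" by (rule K)+
    show "\<not> (\<forall>w\<in>K. cmod (a w - w * E w) \<le> (1/200) * (cmod (E w) + 1))" if "a \<in> hol_germs K" for a using K(5) that by blast
    show "\<exists>m. s \<le> q m \<and> q m < t" if st: "s < t" for s t :: real
    proof -
      obtain r where r: "s < real_of_rat r" "real_of_rat r < t" using of_rat_dense[OF st] by blast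
      obtain m where "from_nat_into UNIV m = r" using from_nat_into_surj[of "UNIV :: rat set" r] by auto
      then show ?thesis using r by (intro exI[of _ m]) (simp add: q_def)
    qed
  qed
  define L where "L = {x \<in> S. roots_at x}"
  have "uncountable L"
  proof
    assume cL: "countable L"
    \<comment> \<open>The two-point factors sit at the even coordinates 2 n with n even, that is, at
      the multiples of 4. All other coordinates are 0, in particular the roots, as they must be over
      \<open>L\<close>.\<close>
    define p where "p A = (\<lambda>i. if i mod 4 = 0 \<and> i div 4 \<in> A then 1 else 0 :: complex)" for A :: "nat set"
    have pL: "p A \<in> L" for A
    proof -
      have e: "p A (2 * n) \<in> Z n" for n by (auto simp: p_def Z_def)
      have b: "p A \<in> base_space Kc" unfolding base_space_def using e Z_subset by blast
      have r: "roots_at (p A)" unfolding roots_at_def using e by blast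
      have "p A (2 * k + 1) = 0" for k
      proof -
        have "(2 * k + 1) mod 4 \<noteq> 0" by presburger
        then show ?thesis by (simp only: p_def simp_thms if_False)
      qed
      then have "p A (2 * k + 1) ^ N k = f k (p A)" for k using f_roots[OF b r, of k] N_pos[of k] by simp
      then show ?thesis using b r by (simp add: L_def S_def)
    qed
    have "inj p"
    proof (rule injI)
      fix A A' assume eq: "p A = p A'"
      have "n \<in> A \<longleftrightarrow> n \<in> A'" for n
        using fun_cong[OF eq, of "4 * n"] by (simp add: p_def split: if_splits)
      then show "A = A'" by blast
    qed
    have "countable (p ` UNIV)" using pL by (intro countable_subset[OF _ cL]) auto
    then have "countable (UNIV :: nat set set)" using \<open>inj p\<close> by (rule countable_image_inj_on)
    then obtain h :: "nat set \<Rightarrow> nat" where "inj h" unfolding countable_def by blast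
    then have "surj (inv_into UNIV h)" by (rule inj_imp_surj_inv)
    then show False using Cantors_theorem[of "UNIV :: nat set"] by auto
  qed
  moreover have "\<forall>x\<in>topspace FA.X - L. bounded_relative_units FA.X FA.BB x"
    using FA.bounded_relative_unitsI bounded_cuts_off_roots by (auto simp: L_def)
  moreover have "metrizable_space FA.X" by (simp add: metrizable_space_euclidean metrizable_space_subtopology)
  moreover have "\<forall>x\<in>topspace FA.X. peak_point FA.X FA.BB x" using peak_point_all by simp
  moreover have "L \<subseteq> topspace FA.X" by (auto simp: L_def)
  ultimately show ?thesis
    using FA.normal_BB ideal_family
    by (intro exI[of _ FA.X] exI[of _ FA.BB] exI[of _ L] conjI) (auto simp: L_def)
qed

end
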